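(* Let $\mathfrak{G}$ be a finite group acting on a locally compact Hausdorff space $\Omega$ via a family of automorphisms (homeomorphisms) $\sigma_{\mathfrak{G}}=\{\sigma_g\}_{g\in\mathfrak{G}}$. Then every approximately local derivation on the tensor algebra $\mathcal{T}^+(\Omega,\sigma_{\mathfrak{G}})$ is a derivation.
   Context: $(\Omega,\sigma_{\mathfrak{G}})$ is regarded as a multivariable dynamical system, with one self map $\sigma_g$ for each $g\in\mathfrak{G}$; as for all such systems in the source, $\Omega$ is assumed to be $\sigma$-compact. A $C^*$-correspondence $X$ over a $C^*$-algebra $A$ is a right Hilbert $A$-module with a left action of $A$ by adjointable operators (given by a $*$-homomorphism $A\to\mathcal{L}(X)$). A Toeplitz representation of $X$ is a pair $(\pi,t)$ of a $*$-homomorphism $\pi$ of $A$ and a linear map $t$ of $X$ into a $C^*$-algebra with $\pi(a)t(\xi)=t(a\xi)$ and $t(\xi)^*t(\eta)=\pi(\langle\xi,\eta\rangle)$; the tensor algebra $\mathcal{T}_X^+$ is the norm-closed algebra generated by the images of $A$ and $X$ under the universal Toeplitz representation. $\mathcal{T}^+(\Omega,\sigma_{\mathfrak{G}})$ is the tensor algebra of the topological graph with vertex space $\Omega$, edge space $\mathfrak{G}\times\Omega$, $s(g,x)=x$, $r(g,x)=\sigma_g(x)$; that is, it is $\mathcal{T}_X^+$ for $X=C_0(\mathfrak{G}\times\Omega)$ over $C_0(\Omega)$ with $(fFh)(g,x)=f(\sigma_g(x))F(g,x)h(x)$ and $\langle F,G\rangle(x)=\sum_{g\in\mathfrak{G}}\overline{F(g,x)}G(g,x)$.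 All linear maps are bounded. A derivation of a Banach algebra $\mathcal{A}$ is a bounded linear map $\delta:\mathcal{A}\to\mathcal{A}$ with $\delta(AB)=\delta(A)B+A\delta(B)$. A bounded linear map $\delta:\mathcal{A}\to\mathcal{A}$ is an approximately local derivation if for every $A\in\mathcal{A}$ there is a sequence of derivations $\delta_{A,k}$ of $\mathcal{A}$ with $\delta(A)=\lim_k\delta_{A,k}(A)$. *)

theory Defs
  imports "HOL-Analysis.Analysis" "HOL-Algebra.Group_Action"
begin

section \<open>Carrier-based complex vector spaces, Banach algebras and C*-algebras\<close>

text \<open>The universal property of a Toeplitz representation quantifies over C*-algebras inside one
  formula, so these are carrier-based structures rather than type classes. As in HOL-Algebra, the
  operations and maps are only relevant on the carriers.\<close>

record 'v cvec = "'v partial_object" +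
  vzero :: 'v
  vadd :: "'v \<Rightarrow> 'v \<Rightarrow> 'v"
  vscale :: "complex \<Rightarrow> 'v \<Rightarrow> 'v"

record 'v nvec = "'v cvec" +
  vnorm :: "'v \<Rightarrow> real"

record 'v nalg = "'v nvec" +
  vmult :: "'v \<Rightarrow> 'v \<Rightarrow> 'v"

record 'v salg = "'v nalg" +
  vstar :: "'v \<Rightarrow> 'v"

locale complex_vector_space =
  fixes V :: "('v, 'r) cvec_scheme"
  assumes add_group: "comm_group \<lparr>carrier = carrier V, mult = vadd V, one = vzero V\<rparr>"
    and scale_closed: "x \<in> carrier V \<Longrightarrow> vscale V c x \<in> carrier V"
    and scale_add_right: "\<lbrakk>x \<in> carrier V; y \<in> carrier V\<rbrakk>
      \<Longrightarrow> vscale V c (vadd V x y) = vadd V (vscale V c x) (vscale V c y)"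
    and scale_add_left: "x \<in> carrier V
      \<Longrightarrow> vscale V (c + d) x = vadd V (vscale V c x) (vscale V d x)"
    and scale_scale: "x \<in> carrier V \<Longrightarrow> vscale V c (vscale V d x) = vscale V (c * d) x"
    and scale_one: "x \<in> carrier V \<Longrightarrow> vscale V 1 x = x"

text \<open>The value 0 off the carrier is needed because the locale \<open>Metric_space\<close> requires
  symmetry and nonnegativity for all elements of the type.\<close>

definition vdist :: "('v, 'r) nvec_scheme \<Rightarrow> 'v \<Rightarrow> 'v \<Rightarrow> real" where
  "vdist V x y =
    (if x \<in> carrier V \<and> y \<in> carrier V then vnorm V (vadd V x (vscale V (- 1) y)) else 0)"

abbreviation norm_topology :: "('v, 'r) nvec_scheme \<Rightarrow> 'v topology" where
  "norm_topology V \<equiv> Metric_space.mtopology (carrier V) (vdist V)"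

locale complex_banach_space = complex_vector_space V
  for V :: "('v, 'r) nvec_scheme" +
  assumes norm_eq_0: "x \<in> carrier V \<Longrightarrow> vnorm V x = 0 \<longleftrightarrow> x = vzero V"
    and norm_triangle: "\<lbrakk>x \<in> carrier V; y \<in> carrier V\<rbrakk>
      \<Longrightarrow> vnorm V (vadd V x y) \<le> vnorm V x + vnorm V y"
    and norm_scale: "x \<in> carrier V \<Longrightarrow> vnorm V (vscale V c x) = cmod c * vnorm V x"
    and complete: "Metric_space.mcomplete (carrier V) (vdist V)"

locale complex_banach_algebra = complex_banach_space A
  for A :: "('a, 'r) nalg_scheme" +
  assumes mult_closed: "\<lbrakk>x \<in> carrier A; y \<in> carrier A\<rbrakk> \<Longrightarrow> vmult A x y \<in> carrier A"
    and mult_assoc: "\<lbrakk>x \<in> carrier A; y \<in> carrier A; z \<in> carrier A\<rbrakk>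
      \<Longrightarrow> vmult A (vmult A x y) z = vmult A x (vmult A y z)"
    and mult_add_left: "\<lbrakk>x \<in> carrier A; y \<in> carrier A; z \<in> carrier A\<rbrakk>
      \<Longrightarrow> vmult A (vadd A x y) z = vadd A (vmult A x z) (vmult A y z)"
    and mult_add_right: "\<lbrakk>x \<in> carrier A; y \<in> carrier A; z \<in> carrier A\<rbrakk>
      \<Longrightarrow> vmult A x (vadd A y z) = vadd A (vmult A x y) (vmult A x z)"
    and mult_scale_left: "\<lbrakk>x \<in> carrier A; y \<in> carrier A\<rbrakk>
      \<Longrightarrow> vmult A (vscale A c x) y = vscale A c (vmult A x y)"
    and mult_scale_right: "\<lbrakk>x \<in> carrier A; y \<in> carrier A\<rbrakk>
      \<Longrightarrow> vmult A x (vscale A c y) = vscale A c (vmult A x y)"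
    and norm_mult: "\<lbrakk>x \<in> carrier A; y \<in> carrier A\<rbrakk>
      \<Longrightarrow> vnorm A (vmult A x y) \<le> vnorm A x * vnorm A y"

locale cstar_algebra = complex_banach_algebra A
  for A :: "('a, 'r) salg_scheme" +
  assumes star_closed: "x \<in> carrier A \<Longrightarrow> vstar A x \<in> carrier A"
    and star_star: "x \<in> carrier A \<Longrightarrow> vstar A (vstar A x) = x"
    and star_add: "\<lbrakk>x \<in> carrier A; y \<in> carrier A\<rbrakk>
      \<Longrightarrow> vstar A (vadd A x y) = vadd A (vstar A x) (vstar A y)"
    and star_scale: "x \<in> carrier A \<Longrightarrow> vstar A (vscale A c x) = vscale A (cnj c) (vstar A x)"
    and star_mult: "\<lbrakk>x \<in> carrier A; y \<in> carrier A\<rbrakk>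
      \<Longrightarrow> vstar A (vmult A x y) = vmult A (vstar A y) (vstar A x)"
    and cstar_identity: "x \<in> carrier A \<Longrightarrow> vnorm A (vmult A (vstar A x) x) = (vnorm A x)\<^sup>2"

definition clinear_map ::
    "('v, 'r) cvec_scheme \<Rightarrow> ('w, 's) cvec_scheme \<Rightarrow> ('v \<Rightarrow> 'w) \<Rightarrow> bool" where
  "clinear_map V W f \<longleftrightarrow>
    f \<in> carrier V \<rightarrow> carrier W \<and>
    (\<forall>x\<in>carrier V. \<forall>y\<in>carrier V. f (vadd V x y) = vadd W (f x) (f y)) \<and>
    (\<forall>c. \<forall>x\<in>carrier V. f (vscale V c x) = vscale W c (f x))"

definition bounded_clinear_map ::
    "('v, 'r) nvec_scheme \<Rightarrow> ('w, 's) nvec_scheme \<Rightarrow> ('v \<Rightarrow> 'w) \<Rightarrow> bool" where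
  "bounded_clinear_map V W f \<longleftrightarrow>
    clinear_map V W f \<and> (\<exists>K. \<forall>x\<in>carrier V. vnorm W (f x) \<le> K * vnorm V x)"

definition star_hom ::
    "('a, 'r) salg_scheme \<Rightarrow> ('b, 's) salg_scheme \<Rightarrow> ('a \<Rightarrow> 'b) \<Rightarrow> bool" where
  "star_hom A B f \<longleftrightarrow>
    bounded_clinear_map A B f \<and>
    (\<forall>x\<in>carrier A. \<forall>y\<in>carrier A. f (vmult A x y) = vmult B (f x) (f y)) \<and>
    (\<forall>x\<in>carrier A. f (vstar A x) = vstar B (f x))"

definition closed_subalgebra :: "('a, 'r) nalg_scheme \<Rightarrow> 'a set \<Rightarrow> bool" where
  "closed_subalgebra A M \<longleftrightarrow>
    vzero A \<in> M \<and>
    (\<forall>x\<in>M. \<forall>y\<in>M. vadd A x y \<in> M \<and> vmult A x y \<in> M) \<and>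
    (\<forall>c. \<forall>x\<in>M. vscale A c x \<in> M) \<and>
    closedin (norm_topology A) M"

definition closed_algebra_generated :: "('a, 'r) nalg_scheme \<Rightarrow> 'a set \<Rightarrow> 'a set" where
  "closed_algebra_generated A S = \<Inter>{M. closed_subalgebra A M \<and> S \<subseteq> M}"


section \<open>Derivations\<close>

definition derivation :: "('a, 'r) nalg_scheme \<Rightarrow> ('a \<Rightarrow> 'a) \<Rightarrow> bool" where
  "derivation A \<delta> \<longleftrightarrow>
    bounded_clinear_map A A \<delta> \<and>
    (\<forall>x\<in>carrier A. \<forall>y\<in>carrier A.
      \<delta> (vmult A x y) = vadd A (vmult A (\<delta> x) y) (vmult A x (\<delta> y)))"

definition approximately_local_derivation ::
    "('a, 'r) nalg_scheme \<Rightarrow> ('a \<Rightarrow> 'a) \<Rightarrow> bool" where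
  "approximately_local_derivation A \<delta> \<longleftrightarrow>
    bounded_clinear_map A A \<delta> \<and>
    (\<forall>x\<in>carrier A. \<exists>D :: nat \<Rightarrow> 'a \<Rightarrow> 'a.
      (\<forall>k. derivation A (D k)) \<and>
      limitin (norm_topology A) (\<lambda>k. D k x) (\<delta> x) sequentially)"


section \<open>Toeplitz representations and tensor algebras\<close>

text \<open>The data of a C*-correspondence over an algebra with elements of type \<open>'a\<close>.\<close>

record ('a, 'v) correspondence = "'v cvec" +
  left_act :: "'a \<Rightarrow> 'v \<Rightarrow> 'v"
  right_act :: "'v \<Rightarrow> 'a \<Rightarrow> 'v"
  inner_prod :: "'v \<Rightarrow> 'v \<Rightarrow> 'a"

text \<open>Boundedness of \<open>t\<close> (for the norm given by the square root of the norm of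
  \<open>inner_prod X \<xi> \<xi>\<close>) and \<open>t (\<xi>a) = t \<xi> \<pi> a\<close> follow from the last condition.\<close>

definition toeplitz_rep ::
    "('a, 'r) salg_scheme \<Rightarrow> ('a, 'v, 's) correspondence_scheme \<Rightarrow> ('c, 'q) salg_scheme
      \<Rightarrow> ('a \<Rightarrow> 'c) \<Rightarrow> ('v \<Rightarrow> 'c) \<Rightarrow> bool" where
  "toeplitz_rep A X C \<pi> t \<longleftrightarrow>
    cstar_algebra C \<and> star_hom A C \<pi> \<and> clinear_map X C t \<and>
    (\<forall>a\<in>carrier A. \<forall>\<xi>\<in>carrier X. vmult C (\<pi> a) (t \<xi>) = t (left_act X a \<xi>)) \<and>
    (\<forall>\<xi>\<in>carrier X. \<forall>\<eta>\<in>carrier X. vmult C (vstar C (t \<xi>)) (t \<eta>) = \<pi> (inner_prod X \<xi> \<eta>))"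

text \<open>The universal property, tested on the C*-algebras whose elements have type \<open>'c\<close>.
  The factorising homomorphism is made extensional so that uniqueness refers to its values on the
  carrier.\<close>

definition universal_toeplitz_rep ::
    "'c itself \<Rightarrow> ('a, 'r) salg_scheme \<Rightarrow> ('a, 'v, 's) correspondence_scheme
      \<Rightarrow> ('b, 'q) salg_scheme \<Rightarrow> ('a \<Rightarrow> 'b) \<Rightarrow> ('v \<Rightarrow> 'b) \<Rightarrow> bool" where
  "universal_toeplitz_rep (_ :: 'c itself) A X T \<pi> t \<longleftrightarrow>
    toeplitz_rep A X T \<pi> t \<and>
    (\<forall>(C :: 'c salg) \<pi>' t'. toeplitz_rep A X C \<pi>' t' \<longrightarrow>
      (\<exists>!\<phi>. \<phi> \<in> extensional (carrier T) \<and> star_hom T C \<phi> \<and>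
        (\<forall>a\<in>carrier A. \<phi> (\<pi> a) = \<pi>' a) \<and> (\<forall>\<xi>\<in>carrier X. \<phi> (t \<xi>) = t' \<xi>)))"

definition tensor_algebra ::
    "('a, 'r) salg_scheme \<Rightarrow> ('a, 'v, 's) correspondence_scheme
      \<Rightarrow> ('b, 'q) salg_scheme \<Rightarrow> ('a \<Rightarrow> 'b) \<Rightarrow> ('v \<Rightarrow> 'b) \<Rightarrow> 'b nalg" where
  "tensor_algebra A X T \<pi> t =
    nalg.truncate (T\<lparr>carrier := closed_algebra_generated T (\<pi> ` carrier A \<union> t ` carrier X)\<rparr>)"


section \<open>The correspondence of a multivariable dynamical system\<close>

definition sigma_compact_space :: "'x topology \<Rightarrow> bool" where
  "sigma_compact_space \<Omega> \<longleftrightarrow>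
    (\<exists>K :: nat \<Rightarrow> 'x set. (\<forall>n. compactin \<Omega> (K n)) \<and> topspace \<Omega> = (\<Union>n. K n))"

text \<open>Functions on a space are represented by functions on the type that are 0 off the space.\<close>

definition c0_functions :: "'x topology \<Rightarrow> ('x \<Rightarrow> complex) set" where
  "c0_functions \<Omega> = {f. continuous_map \<Omega> euclidean f \<and> (\<forall>x. x \<notin> topspace \<Omega> \<longrightarrow> f x = 0) \<and>
    (\<forall>\<epsilon>>0. compactin \<Omega> {x \<in> topspace \<Omega>. \<epsilon> \<le> cmod (f x)})}"

definition c0_algebra :: "'x topology \<Rightarrow> ('x \<Rightarrow> complex) salg" where
  "c0_algebra \<Omega> =
    \<lparr>carrier = c0_functions \<Omega>,
     vzero = (\<lambda>x. 0),
     vadd = (\<lambda>f g x. f x + g x),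
     vscale = (\<lambda>c f x. c * f x),
     vnorm = (\<lambda>f. SUP x. cmod (f x)),
     vmult = (\<lambda>f g x. f x * g x),
     vstar = (\<lambda>f x. cnj (f x))\<rparr>"

definition dynamical_correspondence ::
    "('g, 'r) monoid_scheme \<Rightarrow> 'x topology \<Rightarrow> ('g \<Rightarrow> 'x \<Rightarrow> 'x)
      \<Rightarrow> ('x \<Rightarrow> complex, 'g \<times> 'x \<Rightarrow> complex) correspondence" where
  "dynamical_correspondence G \<Omega> \<sigma> =
    \<lparr>carrier = c0_functions (prod_topology (discrete_topology (carrier G)) \<Omega>),
     vzero = (\<lambda>e. 0),
     vadd = (\<lambda>F F' e. F e + F' e),
     vscale = (\<lambda>c F e. c * F e),
     left_act = (\<lambda>f F (g, x). f (\<sigma> g x) * F (g, x)),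
     right_act = (\<lambda>F h (g, x). F (g, x) * h x),
     inner_prod = (\<lambda>F F' x. \<Sum>g\<in>carrier G. cnj (F (g, x)) * F' (g, x))\<rparr>"

text \<open>HOL cannot quantify over all types in one formula, so a type must be chosen on which the
  universal property is tested. The Fock representation of the Toeplitz algebra of
  \<open>dynamical_correspondence G \<Omega> \<sigma>\<close> on the Hilbert space with orthonormal basis the finite
  paths \<open>(g\<^sub>n \<dots> g\<^sub>1, x)\<close> is faithful, so a copy of the Toeplitz algebra is
  carried by the type of matrices indexed by paths. Every other Toeplitz representation generates a
  quotient of it, hence an algebra with a copy carried by the same type. Thus the universal
  property for C*-algebras with elements in this type implies it for all C*-algebras, whatever the
  type of their elements; in particular for those with elements in the type of the universal
  algebra itself.\<close>

type_synonym ('g, 'x) path_matrix = "'g list \<times> 'x \<Rightarrow> 'g list \<times> 'x \<Rightarrow> complex"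

end

(* Every element a of the tensor algebra has coefficients indexed by the paths of the graph, read
   off from the Fock representation, and Fejer means of the gauge action show that these determine
   a. Since G is finite every orbit is finite, so each path lies on a closed path, which can be
   chosen such that the rotations of its edge word are distinct. Weighted closed paths of length n
   give bounded representations of the tensor algebra onto the n x n matrices, and as the path and
   the weight vary these see all coefficients. The kernel P of such a representation is invariant
   under derivations D: otherwise some q in P with D q a nonzero multiple of a matrix unit modulo
   P would make D^k (q^k) grow like k!. So an approximately local derivation induces a map d of the
   matrices with A d(B) C = 0 whenever A B = 0 = B C and d 1 = 0. Such a map is a derivation, by
   the Leibniz rule for idempotents. *)
theory Submission
  imports Defs "HOL-Complex_Analysis.Cauchy_Integral_Formula" "HOL-Library.Function_Algebras"
begin

section \<open>Matrices of bounded operators on l2\<close>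

text \<open>The Leibniz rule relates the values of a map at three elements, and the derivations that
  approximate \<delta> may change with the element, so the rule does not pass to the limit directly.
  Invariance of the kernel, the zero product condition and vanishing at 1 each concern the value at
  one element only and do pass to the limit; this is why the matrix problem is posed with zero
  products. The coefficients of an element are bounded by its norm but in general not absolutely
  summable over the path lengths. A weight of modulus below 1 makes these series converge, and each
  matrix entry becomes a power series in the weight, from which single coefficients are recovered.
  Universality is available for two types of test algebras: path matrices yield the Fock
  representation, the type of \<open>T\<close> yields the gauge action. Injectivity of the Fock
  representation on the tensor algebra has to be proved. It rests on \<open>p\<^sup>* p\<close>
  lying in the image of \<open>\<pi>\<close> for homogeneous \<open>p\<close>, so that the Fock
  matrix of \<open>p\<close> controls its norm.\<close>

abbreviation l2 :: "('j \<Rightarrow> complex) \<Rightarrow> 'j set \<Rightarrow> real" where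
  "l2 u F \<equiv> L2_set (\<lambda>i. cmod (u i)) F"

text \<open>Testing on finite sets \<open>F\<close> of rows and on vectors supported on finite sets
  \<open>H\<close> expresses boundedness on the Hilbert space over an arbitrary index type without
  constructing that space.\<close>

definition opbound :: "('j \<Rightarrow> 'j \<Rightarrow> complex) \<Rightarrow> real \<Rightarrow> bool" where
  "opbound M K \<longleftrightarrow> 0 \<le> K \<and>
    (\<forall>F H u. finite F \<longrightarrow> finite H \<longrightarrow> l2 (\<lambda>i. \<Sum>j\<in>H. M i j * u j) F \<le> K * l2 u H)"

definition l2_bounded :: "('j \<Rightarrow> complex) \<Rightarrow> real \<Rightarrow> bool" where
  "l2_bounded u K \<longleftrightarrow> (\<forall>F. finite F \<longrightarrow> l2 u F \<le> K)"

text \<open>Bilinear rather than sesquilinear, since it serves as row times column in the matrix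
  product.\<close>

definition dot :: "('j \<Rightarrow> complex) \<Rightarrow> ('j \<Rightarrow> complex) \<Rightarrow> complex" where
  "dot u v = (\<Sum>\<^sub>\<infinity>k. u k * v k)"

definition mprod :: "('j \<Rightarrow> 'j \<Rightarrow> complex) \<Rightarrow> ('j \<Rightarrow> 'j \<Rightarrow> complex) \<Rightarrow> 'j \<Rightarrow> 'j \<Rightarrow> complex" where
  "mprod M N i j = dot (M i) (\<lambda>k. N k j)"

definition adj :: "('j \<Rightarrow> 'j \<Rightarrow> complex) \<Rightarrow> 'j \<Rightarrow> 'j \<Rightarrow> complex" where
  "adj M i j = cnj (M j i)"

lemma mprod_row: "mprod M N i = (\<lambda>j. dot (M i) (\<lambda>k. N k j))"
  by (simp add: mprod_def fun_eq_iff)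

lemma opboundD: "opbound M K \<Longrightarrow> finite F \<Longrightarrow> finite H \<Longrightarrow> l2 (\<lambda>i. \<Sum>j\<in>H. M i j * u j) F \<le> K * l2 u H"
  by (simp add: opbound_def)

lemma l2_Cauchy_Schwarz: "(\<Sum>i\<in>F. cmod (u i * v i)) \<le> l2 u F * l2 v F"
  using L2_set_mult_ineq[of "\<lambda>i. cmod (u i)" "\<lambda>i. cmod (v i)" F] by (simp add: norm_mult)

lemma cmod_sum_le_l2: "cmod (\<Sum>i\<in>F. u i * v i) \<le> l2 u F * l2 v F"
  using norm_sum[of "\<lambda>i. u i * v i" F] l2_Cauchy_Schwarz[of u v F] by linarith

lemma l2_square: "complex_of_real ((l2 u F)\<^sup>2) = (\<Sum>i\<in>F. cnj (u i) * u i)"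
proof -
  have "(l2 u F)\<^sup>2 = (\<Sum>i\<in>F. (cmod (u i))\<^sup>2)"
    by (simp add: L2_set_def sum_nonneg)
  then show ?thesis
    by (simp only: of_real_sum complex_norm_square mult.commute)
qed

lemma l2_add: "l2 (\<lambda>i. u i + v i) F \<le> l2 u F + l2 v F"
proof -
  have "l2 (\<lambda>i. u i + v i) F \<le> L2_set (\<lambda>i. cmod (u i) + cmod (v i)) F"
    by (rule L2_set_mono) (auto simp: norm_triangle_ineq)
  also have "\<dots> \<le> l2 u F + l2 v F" by (rule L2_set_triangle_ineq)
  finally show ?thesis .
qed

lemma l2_scale: "l2 (\<lambda>i. c * u i) F = cmod c * l2 u F"
  by (simp add: norm_mult L2_set_right_distrib)

lemma l2_bounded_nonneg: "l2_bounded u K \<Longrightarrow> 0 \<le> K"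
  unfolding l2_bounded_def by (metis L2_set_empty finite.emptyI)

text \<open>Cauchy-Schwarz bounds all finite sums of moduli by \<open>K * L\<close>, which gives
  summability and the estimate at once.\<close>

lemma abs_summable_dot:
  assumes "l2_bounded u K" "l2_bounded v L"
  shows "(\<lambda>k. cmod (u k * v k)) summable_on UNIV" "cmod (dot u v) \<le> K * L"
proof -
  have *: "(\<Sum>i\<in>F. cmod (u i * v i)) \<le> K * L" if "finite F" for F
  proof -
    have "l2 u F * l2 v F \<le> K * L"
      using assms that l2_bounded_nonneg[OF assms(1)] by (intro mult_mono) (auto simp: l2_bounded_def)
    with l2_Cauchy_Schwarz[of u v F] show ?thesis by linarith
  qed
  show 1: "(\<lambda>k. cmod (u k * v k)) summable_on UNIV"
  proof -
    have "bdd_above (sum (\<lambda>k. cmod (u k * v k)) ` {F. F \<subseteq> UNIV \<and> finite F})"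
      by (rule bdd_aboveI2[where M = "K * L"]) (use * in auto)
    then show ?thesis by (simp only: abs_summable_iff_bdd_above)
  qed
  have "cmod (dot u v) \<le> (\<Sum>\<^sub>\<infinity>k. cmod (u k * v k))"
    unfolding dot_def by (rule norm_infsum_bound[OF 1])
  also have "\<dots> \<le> K * L" by (rule infsum_le_finite_sums[OF 1]) (auto intro: *)
  finally show "cmod (dot u v) \<le> K * L" .
qed

lemma summable_dot:
  assumes "l2_bounded u K" "l2_bounded v L"
  shows "(\<lambda>k. u k * v k) summable_on UNIV"
  by (rule abs_summable_summable) (rule abs_summable_dot(1)[OF assms])

lemma dot_sum_right:
  assumes "l2_bounded u K" "\<And>j. j \<in> H \<Longrightarrow> \<exists>L. l2_bounded (v j) L" "finite H"
  shows "dot u (\<lambda>k. \<Sum>j\<in>H. v j k * c j) = (\<Sum>j\<in>H. dot u (v j) * c j)"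
proof -
  have "(\<lambda>k. \<Sum>j\<in>H. u k * v j k * c j) summable_on UNIV
    \<and> (\<Sum>\<^sub>\<infinity>k. \<Sum>j\<in>H. u k * v j k * c j) = (\<Sum>j\<in>H. (\<Sum>\<^sub>\<infinity>k. u k * v j k) * c j)"
    using assms(3,2)
  proof (induction H)
    case (insert j H)
    obtain L where "l2_bounded (v j) L" using insert by blast
    then have s: "(\<lambda>k. u k * v j k) summable_on UNIV" using summable_dot assms(1) by blast
    then have "(\<lambda>k. u k * v j k * c j) summable_on UNIV" by (rule summable_on_cmult_left)
    with insert s show ?case
      by (simp add: infsum_add summable_on_add infsum_cmult_left)
  qed simp
  then show ?thesis by (simp add: dot_def sum_distrib_left mult.assoc)
qed

lemma dot_add_right:
  assumes "l2_bounded u K" "l2_bounded v L" "l2_bounded w L'"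
  shows "dot u (\<lambda>k. v k + w k) = dot u v + dot u w"
  using summable_dot[OF assms(1,2)] summable_dot[OF assms(1,3)]
  by (simp add: dot_def distrib_left infsum_add)

lemma dot_scale_right: "dot u (\<lambda>k. c * v k) = c * dot u v"
  unfolding dot_def by (simp add: mult.left_commute[of _ c] infsum_cmult_right')

lemma dot_commute: "dot u v = dot v u"
  by (simp add: dot_def mult.commute)

text \<open>The supremum of the finite sums of squares is nearly attained on \<open>H\<close>;
  whatever a further finite set adds is at most the gap \<open>e\<^sup>2\<close>.\<close>

lemma l2_bounded_tail:
  assumes "l2_bounded w W" "0 < e"
  obtains H where "finite H" "l2_bounded (\<lambda>k. if k \<in> H then 0 else w k) e"
proof -
  define S where "S = (\<lambda>F. \<Sum>k\<in>F. (cmod (w k))\<^sup>2) ` {F. finite F}"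
  have l2S: "(l2 w F)\<^sup>2 = (\<Sum>k\<in>F. (cmod (w k))\<^sup>2)" for F
    by (simp add: L2_set_def sum_nonneg)
  have bdd: "bdd_above S"
  proof -
    have "(\<Sum>k\<in>F. (cmod (w k))\<^sup>2) \<le> W\<^sup>2" if "finite F" for F
    proof -
      have "l2 w F \<le> W" using assms(1) that by (simp add: l2_bounded_def)
      then show ?thesis unfolding l2S[symmetric] by (rule power_mono) simp
    qed
    then show ?thesis unfolding S_def by (intro bdd_aboveI2[where M = "W\<^sup>2"]) blast
  qed
  have "Sup S - e\<^sup>2 < Sup S" using assms by simp
  moreover have "S \<noteq> {}" by (auto simp: S_def)
  ultimately obtain s where "s \<in> S" "Sup S - e\<^sup>2 < s"
    using less_cSup_iff[OF _ bdd] by blast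
  then obtain H where H: "finite H" "Sup S - e\<^sup>2 < (\<Sum>k\<in>H. (cmod (w k))\<^sup>2)"
    unfolding S_def by blast
  have "l2 (\<lambda>k. if k \<in> H then 0 else w k) F \<le> e" if F: "finite F" for F
  proof -
    have "(\<Sum>k\<in>H \<union> (F - H). (cmod (w k))\<^sup>2) \<le> Sup S"
      using H F by (intro cSup_upper[OF _ bdd]) (auto simp: S_def)
    then have "(\<Sum>k\<in>F - H. (cmod (w k))\<^sup>2) \<le> e\<^sup>2"
      using H F by (subst (asm) sum.union_disjoint) auto
    moreover have "(\<Sum>k\<in>F. (cmod (if k \<in> H then 0 else w k))\<^sup>2) = (\<Sum>k\<in>F - H. (cmod (w k))\<^sup>2)"
      using F by (intro sum.mono_neutral_cong_right) auto
    ultimately show ?thesis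
      unfolding L2_set_def using assms(2) by (intro real_le_lsqrt) (auto intro: sum_nonneg)
  qed
  with H show thesis by (intro that) (auto simp: l2_bounded_def)
qed

section \<open>Bounded matrices: rows, columns, adjoints and products\<close>

lemma opbound_nonneg: "opbound M K \<Longrightarrow> 0 \<le> K"
  by (simp add: opbound_def)

lemma opbound_column:
  assumes "opbound M K"
  shows "l2_bounded (\<lambda>k. M k j) K"
  unfolding l2_bounded_def using opboundD[OF assms, of _ "{j}" "\<lambda>_. 1"] by (simp add: )

text \<open>Duality: for \<open>w = adj M u\<close> on a finite set, the square of the norm of
  \<open>w\<close> is the pairing of \<open>u\<close> with \<open>M w\<close>, hence at most
  \<open>K\<close> times the norms of \<open>u\<close> and \<open>w\<close>; then divide by the norm
  of \<open>w\<close>.\<close>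

lemma opbound_adj:
  assumes "opbound M K"
  shows "opbound (adj M) K"
  unfolding opbound_def
proof (intro conjI allI impI)
  fix F H :: "'a set" and u :: "'a \<Rightarrow> complex"
  assume fin: "finite F" "finite H"
  define w where "w i = (\<Sum>j\<in>H. adj M i j * u j)" for i
  have "complex_of_real ((l2 w F)\<^sup>2) = (\<Sum>i\<in>F. cnj (w i) * w i)" by (rule l2_square)
  also have "\<dots> = (\<Sum>i\<in>F. \<Sum>j\<in>H. M j i * cnj (u j) * w i)"
    by (simp add: w_def adj_def sum_distrib_right)
  also have "\<dots> = (\<Sum>j\<in>H. cnj (u j) * (\<Sum>i\<in>F. M j i * w i))"
    by (subst sum.swap) (simp add: sum_distrib_left mult_ac)
  finally have "cmod (complex_of_real ((l2 w F)\<^sup>2)) = cmod (\<Sum>j\<in>H. cnj (u j) * (\<Sum>i\<in>F. M j i * w i))"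
    by (rule arg_cong)
  then have "(l2 w F)\<^sup>2 = cmod (\<Sum>j\<in>H. cnj (u j) * (\<Sum>i\<in>F. M j i * w i))"
    by (simp only: norm_of_real abs_power2)
  also have "\<dots> \<le> l2 (\<lambda>j. cnj (u j)) H * l2 (\<lambda>j. \<Sum>i\<in>F. M j i * w i) H"
    by (rule cmod_sum_le_l2)
  also have "\<dots> \<le> l2 u H * (K * l2 w F)"
    using opboundD[OF assms fin(2,1)] by (simp add: mult_left_mono)
  finally have *: "l2 w F * l2 w F \<le> (K * l2 u H) * l2 w F"
    by (simp add: power2_eq_square mult_ac)
  show "l2 (\<lambda>i. \<Sum>j\<in>H. adj M i j * u j) F \<le> K * l2 u H"
  proof (cases "l2 w F = 0")
    case True
    then show ?thesis using opbound_nonneg[OF assms] by (simp flip: w_def)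
  next
    case False
    then have "0 < l2 w F" using L2_set_nonneg[of "\<lambda>i. cmod (w i)" F] by linarith
    with * show ?thesis by (simp flip: w_def)
  qed
qed (use opbound_nonneg[OF assms] in auto)

lemma opbound_row:
  assumes "opbound M K"
  shows "l2_bounded (M i) K"
  using opbound_column[OF opbound_adj[OF assms], of i] by (simp add: l2_bounded_def adj_def)

lemma opbound_entry:
  assumes "opbound M K"
  shows "cmod (M i j) \<le> K"
proof -
  have "l2 (\<lambda>k. M k j) {i} \<le> K"
    using opbound_column[OF assms, of j] unfolding l2_bounded_def by blast
  then show ?thesis by simp
qed

text \<open>The bound extends from finitely supported to square-summable vectors, since the norm
  over a fixed finite set of rows depends continuously on finitely many convergent sums.\<close>

lemma l2_bounded_dot:
  assumes "opbound M K" "l2_bounded w W"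
  shows "l2_bounded (\<lambda>i. dot (M i) w) (K * W)"
  unfolding l2_bounded_def
proof (intro allI impI)
  fix F :: "'a set" assume F: "finite F"
  have lim: "((\<lambda>H. \<Sum>k\<in>H. M i k * w k) \<longlongrightarrow> dot (M i) w) (finite_subsets_at_top UNIV)" for i
    using summable_dot[OF opbound_row[OF assms(1)] assms(2)] unfolding dot_def
    by (rule infsum_tendsto)
  have "((\<lambda>H. l2 (\<lambda>i. \<Sum>k\<in>H. M i k * w k) F) \<longlongrightarrow> l2 (\<lambda>i. dot (M i) w) F) (finite_subsets_at_top UNIV)"
    unfolding L2_set_def by (intro tendsto_intros lim)
  moreover have "l2 (\<lambda>i. \<Sum>k\<in>H. M i k * w k) F \<le> K * W" if "finite H" for H
    using opboundD[OF assms(1) F that, of w] assms(2) that opbound_nonneg[OF assms(1)]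
    unfolding l2_bounded_def by (meson mult_left_mono order_trans)
  then have "\<forall>\<^sub>F H in finite_subsets_at_top UNIV. l2 (\<lambda>i. \<Sum>k\<in>H. M i k * w k) F \<le> K * W"
    by (intro eventually_finite_subsets_at_top_weakI) auto
  ultimately show "l2 (\<lambda>i. dot (M i) w) F \<le> K * W"
    by (intro tendsto_upperbound) auto
qed

lemma opbound_mprod:
  assumes "opbound M K" "opbound N L"
  shows "opbound (mprod M N) (K * L)"
  unfolding opbound_def
proof (intro conjI allI impI)
  fix F H :: "'a set" and u :: "'a \<Rightarrow> complex"
  assume fin: "finite F" "finite H"
  define w where "w k = (\<Sum>j\<in>H. N k j * u j)" for k
  have "l2_bounded w (L * l2 u H)"
    unfolding l2_bounded_def w_def using opboundD[OF assms(2) _ fin(2)] by blast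
  from l2_bounded_dot[OF assms(1) this] fin
  have "l2 (\<lambda>i. dot (M i) w) F \<le> K * (L * l2 u H)" by (simp add: l2_bounded_def)
  moreover have "dot (M i) w = (\<Sum>j\<in>H. mprod M N i j * u j)" for i
    unfolding w_def mprod_def
    by (rule dot_sum_right[OF opbound_row[OF assms(1)] _ fin(2)]) (use opbound_column[OF assms(2)] in blast)
  ultimately show "l2 (\<lambda>i. \<Sum>j\<in>H. mprod M N i j * u j) F \<le> K * L * l2 u H"
    by (simp add: mult.assoc)
qed (use opbound_nonneg[OF assms(1)] opbound_nonneg[OF assms(2)] in auto)

lemma opbound_cnj:
  assumes "opbound M K"
  shows "opbound (\<lambda>i j. cnj (M i j)) K"
  unfolding opbound_def
proof (intro conjI allI impI)
  fix F H :: "'a set" and u :: "'a \<Rightarrow> complex"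
  assume fin: "finite F" "finite H"
  have "cmod (\<Sum>j\<in>H. cnj (M i j) * u j) = cmod (\<Sum>j\<in>H. M i j * cnj (u j))" for i
  proof -
    have "(\<Sum>j\<in>H. cnj (M i j) * u j) = cnj (\<Sum>j\<in>H. M i j * cnj (u j))" by simp
    then show ?thesis by (simp only: complex_mod_cnj)
  qed
  then show "l2 (\<lambda>i. \<Sum>j\<in>H. cnj (M i j) * u j) F \<le> K * l2 u H"
    using opboundD[OF assms fin, of "\<lambda>j. cnj (u j)"] by simp
qed (use opbound_nonneg[OF assms] in auto)

text \<open>Associativity of row, matrix and column. The double sum need not converge absolutely, so
  the order of summation is not interchanged; instead both sides are bounded functionals of
  \<open>w\<close> that agree on finitely supported vectors, and the tail of \<open>w\<close> is
  small.\<close>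

lemma dot_assoc:
  assumes "l2_bounded a A" "opbound N L" "l2_bounded w W"
  shows "dot a (\<lambda>k. dot (N k) w) = dot (\<lambda>l. dot a (\<lambda>k. N k l)) w"
proof -
  define f where "f v = dot a (\<lambda>k. dot (N k) v)" for v
  define g where "g v = dot (\<lambda>l. dot a (\<lambda>k. N k l)) v" for v
  have a': "l2_bounded (\<lambda>l. dot a (\<lambda>k. N k l)) (L * A)"
  proof -
    have "opbound (\<lambda>i j. N j i) L"
      using opbound_cnj[OF opbound_adj[OF assms(2)]] by (simp add: adj_def)
    from l2_bounded_dot[OF this assms(1)] show ?thesis by (simp add: dot_commute[of a])
  qed
  have bf: "cmod (f v) \<le> A * L * V" and bg: "cmod (g v) \<le> A * L * V" if "l2_bounded v V" for v V
    using abs_summable_dot(2)[OF assms(1) l2_bounded_dot[OF assms(2) that]]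
      abs_summable_dot(2)[OF a' that] by (simp_all add: f_def g_def mult_ac)
  have fin: "f (\<lambda>k. if k \<in> H then w k else 0) = g (\<lambda>k. if k \<in> H then w k else 0)" if H: "finite H" for H
  proof -
    have fs: "dot b (\<lambda>k. if k \<in> H then w k else 0) = (\<Sum>k\<in>H. b k * w k)" for b :: "'a \<Rightarrow> complex"
    proof -
      have "(\<Sum>\<^sub>\<infinity>k. b k * (if k \<in> H then w k else 0)) = (\<Sum>\<^sub>\<infinity>k\<in>H. b k * w k)"
        by (rule infsum_cong_neutral) auto
      then show ?thesis using H by (simp add: dot_def)
    qed
    show ?thesis
      unfolding f_def g_def fs
      by (rule dot_sum_right[OF assms(1) _ H]) (use opbound_column[OF assms(2)] in blast)
  qed
  have "cmod (f w - g w) \<le> 0 + e" if e: "0 < e" for e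
  proof -
    \<comment> \<open>The 2 accounts for the tail under \<open>f\<close> and under \<open>g\<close>;
      the added 1 excludes division by 0.\<close>
    define e' where "e' = e / (2 * (A * L + 1))"
    have AL: "0 \<le> A * L" using l2_bounded_nonneg[OF assms(1)] opbound_nonneg[OF assms(2)] by simp
    then have e': "0 < e'" using e by (simp add: e'_def)
    obtain H where H: "finite H" "l2_bounded (\<lambda>k. if k \<in> H then 0 else w k) e'"
      using l2_bounded_tail[OF assms(3) e'] .
    let ?t = "\<lambda>k. if k \<in> H then 0 else w k" and ?h = "\<lambda>k. if k \<in> H then w k else 0"
    have h: "l2_bounded ?h W"
      unfolding l2_bounded_def
    proof (intro allI impI)
      fix F :: "'a set" assume "finite F"
      have "l2 ?h F \<le> l2 w F" by (rule L2_set_mono) auto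
      then show "l2 ?h F \<le> W" using assms(3) \<open>finite F\<close> unfolding l2_bounded_def by force
    qed
    have w: "w = (\<lambda>k. ?h k + ?t k)" by auto
    have "f w = f ?h + f ?t"
    proof -
      have "dot (N k) w = dot (N k) ?h + dot (N k) ?t" for k
        by (subst w, rule dot_add_right[OF opbound_row[OF assms(2)] h H(2)])
      then show ?thesis
        unfolding f_def
        using dot_add_right[OF assms(1) l2_bounded_dot[OF assms(2) h] l2_bounded_dot[OF assms(2) H(2)]] by simp
    qed
    moreover have "g w = g ?h + g ?t"
      unfolding g_def by (subst w, rule dot_add_right[OF a' h H(2)])
    ultimately have "cmod (f w - g w) = cmod (f ?t - g ?t)" using fin[OF H(1)] by simp
    also have "\<dots> \<le> cmod (f ?t) + cmod (g ?t)" by (rule norm_triangle_ineq4)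
    also have "\<dots> \<le> 2 * (A * L * e')" using bf[OF H(2)] bg[OF H(2)] by simp
    also have "\<dots> \<le> e" using e AL by (simp add: e'_def field_simps)
    finally show ?thesis by simp
  qed
  then have "cmod (f w - g w) \<le> 0" by (rule field_le_epsilon)
  then show ?thesis by (simp add: f_def g_def)
qed

lemma mprod_assoc:
  assumes "opbound M K" "opbound N L" "opbound P R"
  shows "mprod (mprod M N) P = mprod M (mprod N P)"
  using dot_assoc[OF opbound_row[OF assms(1)] assms(2) opbound_column[OF assms(3)]]
  by (intro ext) (simp add: mprod_row)

lemma opbound_add:
  assumes "opbound M K" "opbound N L"
  shows "opbound (\<lambda>i j. M i j + N i j) (K + L)"
  unfolding opbound_def
proof (intro conjI allI impI)
  fix F H :: "'a set" and u :: "'a \<Rightarrow> complex"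
  assume fin: "finite F" "finite H"
  show "l2 (\<lambda>i. \<Sum>j\<in>H. (M i j + N i j) * u j) F \<le> (K + L) * l2 u H"
    using l2_add[of "\<lambda>i. \<Sum>j\<in>H. M i j * u j" "\<lambda>i. \<Sum>j\<in>H. N i j * u j" F]
      opboundD[OF assms(1) fin, of u] opboundD[OF assms(2) fin, of u]
    by (simp add: distrib_right sum.distrib)
qed (use opbound_nonneg[OF assms(1)] opbound_nonneg[OF assms(2)] in auto)

lemma opbound_scale:
  assumes "opbound M K"
  shows "opbound (\<lambda>i j. c * M i j) (cmod c * K)"
  unfolding opbound_def
proof (intro conjI allI impI)
  fix F H :: "'a set" and u :: "'a \<Rightarrow> complex"
  assume fin: "finite F" "finite H"
  show "l2 (\<lambda>i. \<Sum>j\<in>H. c * M i j * u j) F \<le> cmod c * K * l2 u H"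
    using l2_scale[of c "\<lambda>i. \<Sum>j\<in>H. M i j * u j" F] opboundD[OF assms fin, of u]
    by (simp add: sum_distrib_left mult.assoc mult_left_mono)
qed (use opbound_nonneg[OF assms] in auto)

lemma opbound_0: "opbound (\<lambda>i j. 0) 0"
  by (simp add: opbound_def L2_set_0')

section \<open>The operator norm, the C*-inequality and the Schur test\<close>

definition opnorm :: "('j \<Rightarrow> 'j \<Rightarrow> complex) \<Rightarrow> real" where
  "opnorm M = Inf {K. opbound M K}"

lemma opnorm_le: "opbound M K \<Longrightarrow> opnorm M \<le> K"
  unfolding opnorm_def by (rule cInf_lower) (auto intro: bdd_belowI[where m = 0] opbound_nonneg)

lemma opbound_opnorm:
  assumes "opbound M K"
  shows "opbound M (opnorm M)"
  unfolding opbound_def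
proof (intro conjI allI impI)
  show "0 \<le> opnorm M"
    unfolding opnorm_def using assms opbound_nonneg by (intro cInf_greatest) auto
  fix F H :: "'a set" and u :: "'a \<Rightarrow> complex"
  assume fin: "finite F" "finite H"
  show "l2 (\<lambda>i. \<Sum>j\<in>H. M i j * u j) F \<le> opnorm M * l2 u H"
  proof (cases "l2 u H = 0")
    case True
    then show ?thesis using opboundD[OF assms fin, of u] by simp
  next
    case False
    then have pos: "0 < l2 u H" using L2_set_nonneg[of "\<lambda>i. cmod (u i)" H] by linarith
    have "l2 (\<lambda>i. \<Sum>j\<in>H. M i j * u j) F / l2 u H \<le> opnorm M"
      unfolding opnorm_def using assms pos opboundD[OF _ fin, of M _ u]
      by (intro cInf_greatest) (auto simp: pos_divide_le_eq)
    then show ?thesis using pos by (simp add: pos_divide_le_eq)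
  qed
qed

text \<open>For \<open>w = M u\<close> the square of the norm of \<open>w\<close> pairs
  \<open>u\<close> with \<open>adj M\<close> applied to \<open>M u\<close>, hence is at most
  \<open>L\<close> times the square of the norm of \<open>u\<close>. This is the half of the
  C*-identity that does not follow from submultiplicativity.\<close>

lemma opbound_of_adj_mprod:
  assumes "opbound M K" "opbound (mprod (adj M) M) L"
  shows "opbound M (sqrt L)"
  unfolding opbound_def
proof (intro conjI allI impI)
  show "0 \<le> sqrt L" using opbound_nonneg[OF assms(2)] by simp
  fix F H :: "'a set" and u :: "'a \<Rightarrow> complex"
  assume fin: "finite F" "finite H"
  define w where "w k = (\<Sum>j\<in>H. M k j * u j)" for k
  have w: "l2_bounded w (K * l2 u H)"
    unfolding l2_bounded_def w_def using opboundD[OF assms(1) _ fin(2)] by blast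
  have cw: "l2_bounded (\<lambda>k. cnj (w k)) (K * l2 u H)" using w by (simp add: l2_bounded_def)
  have d: "dot (\<lambda>k. cnj (w k)) w = (\<Sum>j\<in>H. cnj (u j) * (\<Sum>j'\<in>H. mprod (adj M) M j j' * u j'))"
  proof -
    have "dot (adj M j) w = (\<Sum>j'\<in>H. mprod (adj M) M j j' * u j')" for j
      unfolding w_def mprod_def
      by (rule dot_sum_right[OF opbound_row[OF opbound_adj[OF assms(1)]] _ fin(2)])
        (use opbound_column[OF assms(1)] in blast)
    moreover have "(\<lambda>k. cnj (w k)) = (\<lambda>k. \<Sum>j\<in>H. adj M j k * cnj (u j))"
      by (simp add: w_def adj_def)
    then have "dot w (\<lambda>k. cnj (w k)) = (\<Sum>j\<in>H. dot w (adj M j) * cnj (u j))"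
      using dot_sum_right[OF w _ fin(2), of "adj M" "\<lambda>j. cnj (u j)"] opbound_row[OF opbound_adj[OF assms(1)]]
      by auto
    ultimately show ?thesis
      by (simp add: dot_commute[of w] mult.commute)
  qed
  have "(l2 w F)\<^sup>2 \<le> cmod (dot (\<lambda>k. cnj (w k)) w)"
  proof -
    have s: "(\<lambda>k. (cmod (w k))\<^sup>2) summable_on UNIV"
      using abs_summable_dot(1)[OF cw w] by (simp add: norm_mult power2_eq_square)
    have "dot (\<lambda>k. cnj (w k)) w = (\<Sum>\<^sub>\<infinity>k. complex_of_real ((cmod (w k))\<^sup>2))"
      unfolding dot_def by (intro infsum_cong) (subst complex_norm_square, rule mult.commute)
    also have "\<dots> = complex_of_real (\<Sum>\<^sub>\<infinity>k. (cmod (w k))\<^sup>2)"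
      using has_sum_of_real[OF has_sum_infsum[OF s]] by (rule infsumI)
    finally have "cmod (dot (\<lambda>k. cnj (w k)) w) = (\<Sum>\<^sub>\<infinity>k. (cmod (w k))\<^sup>2)"
      by (simp add: infsum_nonneg)
    moreover have "(\<Sum>k\<in>F. (cmod (w k))\<^sup>2) \<le> (\<Sum>\<^sub>\<infinity>k. (cmod (w k))\<^sup>2)"
      by (rule finite_sum_le_infsum[OF s fin(1)]) auto
    ultimately show ?thesis by (simp add: L2_set_def sum_nonneg)
  qed
  also have "\<dots> \<le> l2 (\<lambda>j. cnj (u j)) H * l2 (\<lambda>j. \<Sum>j'\<in>H. mprod (adj M) M j j' * u j') H"
    unfolding d by (rule cmod_sum_le_l2)
  also have "\<dots> \<le> l2 u H * (L * l2 u H)"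
    using opboundD[OF assms(2) fin(2,2)] by (simp add: mult_left_mono)
  finally have "(l2 w F)\<^sup>2 \<le> (sqrt L * l2 u H)\<^sup>2"
    using opbound_nonneg[OF assms(2)] by (simp add: power_mult_distrib) (simp add: power2_eq_square mult_ac)
  then show "l2 (\<lambda>i. \<Sum>j\<in>H. M i j * u j) F \<le> sqrt L * l2 u H"
    unfolding w_def by (rule power2_le_imp_le) (simp add: opbound_nonneg[OF assms(2)])
qed

text \<open>Schur test: each modulus is split into two square roots. Cauchy-Schwarz then uses up the
  row sums, and the column sums enter after summation over the rows.\<close>

lemma opbound_Schur:
  assumes rows: "\<And>i H. finite H \<Longrightarrow> (\<Sum>j\<in>H. cmod (M i j)) \<le> K"
    and cols: "\<And>j F. finite F \<Longrightarrow> (\<Sum>i\<in>F. cmod (M i j)) \<le> K"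
  shows "opbound M K"
  unfolding opbound_def
proof (intro conjI allI impI)
  show K: "0 \<le> K" using rows[of "{}"] by simp
  fix F H :: "'a set" and u :: "'a \<Rightarrow> complex"
  assume fin: "finite F" "finite H"
  have "(cmod (\<Sum>j\<in>H. M i j * u j))\<^sup>2 \<le> K * (\<Sum>j\<in>H. cmod (M i j) * (cmod (u j))\<^sup>2)" for i
  proof -
    define a where "a j = sqrt (cmod (M i j))" for j
    define b where "b j = a j * cmod (u j)" for j
    have ab: "cmod (M i j * u j) = \<bar>a j\<bar> * \<bar>b j\<bar>" for j
      by (simp add: a_def b_def norm_mult abs_mult)
    have "cmod (\<Sum>j\<in>H. M i j * u j) \<le> (\<Sum>j\<in>H. cmod (M i j * u j))"
      by (rule norm_sum)
    also have "\<dots> = (\<Sum>j\<in>H. \<bar>a j\<bar> * \<bar>b j\<bar>)"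
      by (simp only: ab)
    also have "\<dots> \<le> L2_set a H * L2_set b H"
      by (rule L2_set_mult_ineq)
    finally have "(cmod (\<Sum>j\<in>H. M i j * u j))\<^sup>2 \<le> (L2_set a H * L2_set b H)\<^sup>2"
      by (rule power_mono) simp
    also have "\<dots> = (\<Sum>j\<in>H. (a j)\<^sup>2) * (\<Sum>j\<in>H. (b j)\<^sup>2)"
      by (simp add: L2_set_def sum_nonneg power_mult_distrib)
    also have "\<dots> = (\<Sum>j\<in>H. cmod (M i j)) * (\<Sum>j\<in>H. cmod (M i j) * (cmod (u j))\<^sup>2)"
      by (simp add: a_def b_def power_mult_distrib)
    also have "\<dots> \<le> K * (\<Sum>j\<in>H. cmod (M i j) * (cmod (u j))\<^sup>2)"
      using rows[OF fin(2)] by (intro mult_right_mono) (auto intro: sum_nonneg)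
    finally show ?thesis .
  qed
  then have "(\<Sum>i\<in>F. (cmod (\<Sum>j\<in>H. M i j * u j))\<^sup>2) \<le> (\<Sum>i\<in>F. K * (\<Sum>j\<in>H. cmod (M i j) * (cmod (u j))\<^sup>2))"
    by (rule sum_mono)
  also have "\<dots> = K * (\<Sum>j\<in>H. (\<Sum>i\<in>F. cmod (M i j)) * (cmod (u j))\<^sup>2)"
  proof -
    have "(\<Sum>i\<in>F. \<Sum>j\<in>H. cmod (M i j) * (cmod (u j))\<^sup>2) = (\<Sum>j\<in>H. (\<Sum>i\<in>F. cmod (M i j)) * (cmod (u j))\<^sup>2)"
      by (subst sum.swap) (simp add: sum_distrib_right)
    then show ?thesis by (simp flip: sum_distrib_left)
  qed
  also have "\<dots> \<le> K * (\<Sum>j\<in>H. K * (cmod (u j))\<^sup>2)"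
    by (intro mult_left_mono sum_mono mult_right_mono cols[OF fin(1)] K) simp
  finally have "(l2 (\<lambda>i. \<Sum>j\<in>H. M i j * u j) F)\<^sup>2 \<le> (K * l2 u H)\<^sup>2"
    by (simp add: L2_set_def sum_nonneg power_mult_distrib power2_eq_square[of K] mult.assoc flip: sum_distrib_left)
  then show "l2 (\<lambda>i. \<Sum>j\<in>H. M i j * u j) F \<le> K * l2 u H"
    by (rule power2_le_imp_le) (simp add: K)
qed

section \<open>Carrier-based normed spaces and the C*-algebra of bounded matrices\<close>

text \<open>A Banach space without completeness. It provides the metric of the matrix algebra before
  completeness is proved there, and it is the setting in which the tensor algebra is
  treated.\<close>

locale normed_cvec = complex_vector_space V
  for V :: "('v, 'r) nvec_scheme" +
  assumes vnorm_eq_0: "x \<in> carrier V \<Longrightarrow> vnorm V x = 0 \<longleftrightarrow> x = vzero V"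
    and vnorm_triangle: "\<lbrakk>x \<in> carrier V; y \<in> carrier V\<rbrakk>
      \<Longrightarrow> vnorm V (vadd V x y) \<le> vnorm V x + vnorm V y"
    and vnorm_scale: "x \<in> carrier V \<Longrightarrow> vnorm V (vscale V c x) = cmod c * vnorm V x"

section \<open>Arithmetic in carrier-based vector spaces\<close>

context complex_vector_space
begin

abbreviation sub :: "'v \<Rightarrow> 'v \<Rightarrow> 'v" where
  "sub x y \<equiv> vadd V x (vscale V (- 1) y)"

lemma add_closed: "x \<in> carrier V \<Longrightarrow> y \<in> carrier V \<Longrightarrow> vadd V x y \<in> carrier V"
  and zero_closed: "vzero V \<in> carrier V"
  and add_assoc: "\<lbrakk>x \<in> carrier V; y \<in> carrier V; z \<in> carrier V\<rbrakk>
    \<Longrightarrow> vadd V (vadd V x y) z = vadd V x (vadd V y z)"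
  and add_zero_left: "x \<in> carrier V \<Longrightarrow> vadd V (vzero V) x = x"
  and add_commute: "\<lbrakk>x \<in> carrier V; y \<in> carrier V\<rbrakk> \<Longrightarrow> vadd V x y = vadd V y x"
proof -
  interpret g: comm_group "\<lparr>carrier = carrier V, mult = vadd V, one = vzero V\<rparr>"
    by (rule add_group)
  show "x \<in> carrier V \<Longrightarrow> y \<in> carrier V \<Longrightarrow> vadd V x y \<in> carrier V"
    using g.m_closed by simp
  show "vzero V \<in> carrier V" using g.one_closed by simp
  show "\<lbrakk>x \<in> carrier V; y \<in> carrier V; z \<in> carrier V\<rbrakk>
    \<Longrightarrow> vadd V (vadd V x y) z = vadd V x (vadd V y z)" using g.m_assoc by simp
  show "x \<in> carrier V \<Longrightarrow> vadd V (vzero V) x = x" using g.l_one by simp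
  show "\<lbrakk>x \<in> carrier V; y \<in> carrier V\<rbrakk> \<Longrightarrow> vadd V x y = vadd V y x" using g.m_comm by simp
qed

lemma add_zero_right: "x \<in> carrier V \<Longrightarrow> vadd V x (vzero V) = x"
  using add_commute[of x "vzero V"] add_zero_left zero_closed by simp

lemma add_idem_zero:
  assumes "x \<in> carrier V" "vadd V x x = x"
  shows "x = vzero V"
proof -
  interpret g: comm_group "\<lparr>carrier = carrier V, mult = vadd V, one = vzero V\<rparr>"
    by (rule add_group)
  show ?thesis using g.l_cancel_one[of x x] assms by simp
qed

lemma scale_0: "x \<in> carrier V \<Longrightarrow> vscale V 0 x = vzero V"
  using scale_add_left[of x 0 0] scale_closed[of x 0] by (intro add_idem_zero) simp_all

lemma scale_zero: "vscale V c (vzero V) = vzero V"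
  using scale_scale[OF zero_closed, of c 0] scale_0[OF zero_closed] by simp

lemma sub_self: "x \<in> carrier V \<Longrightarrow> sub x x = vzero V"
  using scale_add_left[of x 1 "- 1"] scale_0[of x] scale_one[of x] by simp

lemma sub_closed: "x \<in> carrier V \<Longrightarrow> y \<in> carrier V \<Longrightarrow> sub x y \<in> carrier V"
  by (simp add: add_closed scale_closed)

lemma add_left_commute: "\<lbrakk>x \<in> carrier V; y \<in> carrier V; z \<in> carrier V\<rbrakk>
    \<Longrightarrow> vadd V x (vadd V y z) = vadd V y (vadd V x z)"
  using add_assoc[of x y z] add_assoc[of y x z] add_commute[of x y] by simp

lemmas add_ac = add_assoc add_commute add_left_commute

lemma sub_add_cancel:
  assumes "x \<in> carrier V" "y \<in> carrier V"
  shows "vadd V (sub x y) y = x"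
proof -
  have "vadd V (sub x y) y = vadd V x (vadd V (vscale V (- 1) y) y)"
    using assms by (simp add: add_assoc scale_closed)
  also have "vadd V (vscale V (- 1) y) y = vzero V"
    using sub_self[OF assms(2)] assms by (simp add: add_commute scale_closed)
  finally show ?thesis using assms by (simp add: add_zero_right)
qed

lemma sub_eq_zero:
  assumes "x \<in> carrier V" "y \<in> carrier V" "sub x y = vzero V"
  shows "x = y"
  using sub_add_cancel[OF assms(1,2)] assms add_zero_left by simp

lemma sub_add_sub:
  assumes "x \<in> carrier V" "y \<in> carrier V" "z \<in> carrier V"
  shows "vadd V (sub x y) (sub y z) = sub x z"
proof -
  have "vadd V (sub x y) (sub y z) = vadd V (vadd V (sub x y) y) (vscale V (- 1) z)"
    using assms by (simp add: add_assoc scale_closed add_closed)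
  then show ?thesis using sub_add_cancel assms by simp
qed

lemma scale_sub: "x \<in> carrier V \<Longrightarrow> y \<in> carrier V \<Longrightarrow> vscale V (- 1) (sub x y) = sub y x"
  by (simp add: scale_add_right scale_scale scale_closed scale_one add_commute)

end

section \<open>The metric of a carrier-based norm\<close>

context normed_cvec
begin

lemma vnorm_zero: "vnorm V (vzero V) = 0"
  using vnorm_eq_0 zero_closed by blast

lemma vnorm_sub_commute: "x \<in> carrier V \<Longrightarrow> y \<in> carrier V \<Longrightarrow> vnorm V (sub x y) = vnorm V (sub y x)"
  using vnorm_scale[of "sub x y" "- 1"] by (simp add: scale_sub sub_closed)

lemma vnorm_sub_triangle:
  assumes "x \<in> carrier V" "y \<in> carrier V" "z \<in> carrier V"
  shows "vnorm V (sub x z) \<le> vnorm V (sub x y) + vnorm V (sub y z)"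
  using vnorm_triangle[of "sub x y" "sub y z"] sub_add_sub[OF assms] assms by (simp add: sub_closed)

lemma vnorm_nonneg: "x \<in> carrier V \<Longrightarrow> 0 \<le> vnorm V x"
proof -
  assume x: "x \<in> carrier V"
  have "vnorm V (sub x x) \<le> vnorm V x + vnorm V (vscale V (- 1) x)"
    using x by (intro vnorm_triangle scale_closed)
  then show ?thesis using x by (simp add: sub_self vnorm_zero vnorm_scale)
qed

lemma vnorm_le_sub:
  assumes "x \<in> carrier V" "y \<in> carrier V"
  shows "vnorm V x \<le> vnorm V (sub x y) + vnorm V y"
  using vnorm_triangle[of "sub x y" y] assms by (simp add: sub_closed sub_add_cancel)

sublocale Metric_space "carrier V" "vdist V"
proof
  show "0 \<le> vdist V x y" for x y by (simp add: vdist_def vnorm_nonneg sub_closed)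
  show "vdist V x y = vdist V y x" for x y by (simp add: vdist_def vnorm_sub_commute)
  show "x \<in> carrier V \<Longrightarrow> y \<in> carrier V \<Longrightarrow> (vdist V x y = 0) = (x = y)" for x y
    using sub_eq_zero sub_self by (auto simp: vdist_def vnorm_eq_0 sub_closed)
  show "x \<in> carrier V \<Longrightarrow> y \<in> carrier V \<Longrightarrow> z \<in> carrier V \<Longrightarrow> vdist V x z \<le> vdist V x y + vdist V y z" for x y z
    by (simp add: vdist_def vnorm_sub_triangle)
qed

lemma closedin_norm_topologyI:
  assumes "S \<subseteq> carrier V"
    and "\<And>x. x \<in> carrier V \<Longrightarrow> (\<And>e. 0 < e \<Longrightarrow> \<exists>y\<in>S. vnorm V (sub x y) < e) \<Longrightarrow> x \<in> S"
  shows "closedin mtopology S"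
  unfolding closedin_metric
proof (intro conjI allI impI assms(1))
  fix x assume x: "x \<in> carrier V - S"
  then obtain e where e: "0 < e" "\<And>y. y \<in> S \<Longrightarrow> \<not> vnorm V (sub x y) < e"
    using assms(2) by blast
  have "disjnt S (mball x e)"
    using e(2) x by (auto simp: disjnt_def vdist_def)
  with e(1) show "\<exists>r>0. disjnt S (mball x r)" by blast
qed

lemma limitin_norm_topology:
  assumes "\<And>n. f n \<in> carrier V"
  shows "limitin mtopology f x sequentially \<longleftrightarrow>
    x \<in> carrier V \<and> (\<lambda>n. vnorm V (sub (f n) x)) \<longlonglongrightarrow> 0"
proof -
  have "vdist V (f n) x = vnorm V (sub (f n) x)" if "x \<in> carrier V" for n
    using that assms by (simp add: vdist_def)
  moreover have "0 \<le> vnorm V (sub (f n) x)" if "x \<in> carrier V" for n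
    using that assms by (simp add: vnorm_nonneg sub_closed)
  ultimately show ?thesis
    using assms by (auto simp: limitin_metric tendsto_iff)
qed

end

sublocale complex_banach_space \<subseteq> normed_cvec
  using norm_eq_0 norm_triangle norm_scale by unfold_locales auto

lemma complex_vector_spaceI:
  assumes "\<And>x y. \<lbrakk>x \<in> carrier V; y \<in> carrier V\<rbrakk> \<Longrightarrow> vadd V x y \<in> carrier V"
    and "vzero V \<in> carrier V"
    and "\<And>x y z. \<lbrakk>x \<in> carrier V; y \<in> carrier V; z \<in> carrier V\<rbrakk>
      \<Longrightarrow> vadd V (vadd V x y) z = vadd V x (vadd V y z)"
    and "\<And>x y. \<lbrakk>x \<in> carrier V; y \<in> carrier V\<rbrakk> \<Longrightarrow> vadd V x y = vadd V y x"
    and "\<And>x. x \<in> carrier V \<Longrightarrow> vadd V (vzero V) x = x"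
    and "\<And>x. x \<in> carrier V \<Longrightarrow> vadd V x (vscale V (- 1) x) = vzero V"
    and scale: "\<And>x c. x \<in> carrier V \<Longrightarrow> vscale V c x \<in> carrier V"
      "\<And>x y c. \<lbrakk>x \<in> carrier V; y \<in> carrier V\<rbrakk>
        \<Longrightarrow> vscale V c (vadd V x y) = vadd V (vscale V c x) (vscale V c y)"
      "\<And>x c d. x \<in> carrier V \<Longrightarrow> vscale V (c + d) x = vadd V (vscale V c x) (vscale V d x)"
      "\<And>x c d. x \<in> carrier V \<Longrightarrow> vscale V c (vscale V d x) = vscale V (c * d) x"
      "\<And>x. x \<in> carrier V \<Longrightarrow> vscale V 1 x = x"
  shows "complex_vector_space V"
proof (rule complex_vector_space.intro)
  show "comm_group \<lparr>carrier = carrier V, mult = vadd V, one = vzero V\<rparr>"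
  proof (rule comm_groupI)
    show "\<exists>y\<in>carrier \<lparr>carrier = carrier V, mult = vadd V, one = vzero V\<rparr>.
      y \<otimes>\<^bsub>\<lparr>carrier = carrier V, mult = vadd V, one = vzero V\<rparr>\<^esub> x =
      \<one>\<^bsub>\<lparr>carrier = carrier V, mult = vadd V, one = vzero V\<rparr>\<^esub>"
      if "x \<in> carrier \<lparr>carrier = carrier V, mult = vadd V, one = vzero V\<rparr>" for x
    proof -
      have x: "x \<in> carrier V" using that by simp
      then have "vadd V (vscale V (- 1) x) x = vzero V"
        using assms(4)[of "vscale V (- 1) x" x] assms(6) scale(1) by simp
      then show ?thesis using scale(1)[OF x] by (intro bexI[of _ "vscale V (- 1) x"]) simp_all
    qed
    show "x \<otimes>\<^bsub>\<lparr>carrier = carrier V, mult = vadd V, one = vzero V\<rparr>\<^esub> y =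
      y \<otimes>\<^bsub>\<lparr>carrier = carrier V, mult = vadd V, one = vzero V\<rparr>\<^esub> x"
      if "x \<in> carrier \<lparr>carrier = carrier V, mult = vadd V, one = vzero V\<rparr>"
        "y \<in> carrier \<lparr>carrier = carrier V, mult = vadd V, one = vzero V\<rparr>" for x y
      using assms(4)[of x y] that by simp
  qed (simp_all add: assms(1,2,3,5))
qed (use scale in auto)

section \<open>The C*-algebra of bounded matrices\<close>

definition opalg :: "('j \<Rightarrow> 'j \<Rightarrow> complex) salg" where
  "opalg =
    \<lparr>carrier = {M. \<exists>K. opbound M K},
     vzero = (\<lambda>i j. 0),
     vadd = (\<lambda>M N i j. M i j + N i j),
     vscale = (\<lambda>c M i j. c * M i j),
     vnorm = opnorm,
     vmult = mprod,
     vstar = adj\<rparr>"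

lemma opalg_simps:
  "carrier opalg = {M. \<exists>K. opbound M K}" "vzero opalg = (\<lambda>i j. 0)"
  "vadd opalg = (\<lambda>M N i j. M i j + N i j)" "vscale opalg = (\<lambda>c M i j. c * M i j)"
  "vnorm opalg = opnorm" "vmult opalg = mprod" "vstar opalg = adj"
  by (simp_all add: opalg_def)

lemma opbound_mono: "opbound M K \<Longrightarrow> K \<le> K' \<Longrightarrow> opbound M K'"
  unfolding opbound_def by (meson L2_set_nonneg mult_right_mono order_trans)

lemma opnorm_nonneg: "opbound M K \<Longrightarrow> 0 \<le> opnorm M"
  by (rule opbound_nonneg[OF opbound_opnorm])

text \<open>Lower semicontinuity of the operator norm: each test involves finitely many entries, so
  entrywise convergence is enough.\<close>

lemma opbound_limit:
  assumes "\<forall>\<^sub>F m in sequentially. opbound (M m) K" "\<And>i j. (\<lambda>m. M m i j) \<longlonglongrightarrow> L i j"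
  shows "opbound L K"
  unfolding opbound_def
proof (intro conjI allI impI)
  show "0 \<le> K"
    using eventually_happens'[OF _ assms(1)] opbound_nonneg by force
  fix F H :: "'a set" and u :: "'a \<Rightarrow> complex"
  assume fin: "finite F" "finite H"
  have "(\<lambda>m. l2 (\<lambda>i. \<Sum>j\<in>H. M m i j * u j) F) \<longlonglongrightarrow> l2 (\<lambda>i. \<Sum>j\<in>H. L i j * u j) F"
    unfolding L2_set_def by (intro tendsto_intros assms(2))
  moreover have "\<forall>\<^sub>F m in sequentially. l2 (\<lambda>i. \<Sum>j\<in>H. M m i j * u j) F \<le> K * l2 u H"
    using assms(1) by eventually_elim (rule opboundD[OF _ fin])
  ultimately show "l2 (\<lambda>i. \<Sum>j\<in>H. L i j * u j) F \<le> K * l2 u H"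
    by (intro tendsto_upperbound) auto
qed

lemma opbound_diff:
  assumes "opbound M K" "opbound N L"
  shows "opbound (\<lambda>i j. M i j - N i j) (K + L)"
  using opbound_add[OF assms(1) opbound_scale[OF assms(2), of "- 1"]] by simp

lemma opnorm_scale:
  assumes "opbound M K"
  shows "opnorm (\<lambda>i j. c * M i j) = cmod c * opnorm M"
proof (rule antisym)
  have le: "opnorm (\<lambda>i j. c * N i j) \<le> cmod c * opnorm N" if "opbound N L" for c N L
    using that by (intro opnorm_le opbound_scale opbound_opnorm)
  show "opnorm (\<lambda>i j. c * M i j) \<le> cmod c * opnorm M" by (rule le[OF assms])
  show "cmod c * opnorm M \<le> opnorm (\<lambda>i j. c * M i j)"
  proof (cases "c = 0")
    case True
    then show ?thesis using opnorm_nonneg[OF opbound_scale[OF assms, of c]] by simp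
  next
    case False
    have "opnorm M \<le> cmod (inverse c) * opnorm (\<lambda>i j. c * M i j)"
      using le[OF opbound_scale[OF assms, of c], of "inverse c"] False
      by (simp flip: mult.assoc)
    then have "opnorm M \<le> inverse (cmod c) * opnorm (\<lambda>i j. c * M i j)"
      by (simp only: norm_inverse)
    with False show ?thesis by (simp add: field_simps)
  qed
qed

lemma adj_adj: "adj (adj M) = M"
  by (intro ext) (simp add: adj_def)

lemma adj_mprod:
  shows "adj (mprod M N) = mprod (adj N) (adj M)"
  by (intro ext) (simp add: adj_def mprod_def dot_def mult.commute flip: infsum_cnj)

lemma mprod_add_left:
  assumes "opbound M K" "opbound N L" "opbound P R"
  shows "mprod (\<lambda>i j. M i j + N i j) P = (\<lambda>i j. mprod M P i j + mprod N P i j)"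
  using dot_add_right[OF opbound_column[OF assms(3)] opbound_row[OF assms(1)] opbound_row[OF assms(2)]]
  by (intro ext) (simp add: mprod_def dot_commute[of "\<lambda>k. P k _"])

lemma mprod_add_right:
  assumes "opbound M K" "opbound N L" "opbound P R"
  shows "mprod P (\<lambda>i j. M i j + N i j) = (\<lambda>i j. mprod P M i j + mprod P N i j)"
  using dot_add_right[OF opbound_row[OF assms(3)] opbound_column[OF assms(1)] opbound_column[OF assms(2)]]
  by (intro ext) (simp add: mprod_def)

lemma opalg_normed_cvec: "normed_cvec (opalg :: ('j \<Rightarrow> 'j \<Rightarrow> complex) salg)"
proof (intro normed_cvec.intro normed_cvec_axioms.intro)
  show "complex_vector_space (opalg :: ('j \<Rightarrow> 'j \<Rightarrow> complex) salg)"
    by (rule complex_vector_spaceI)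
      (auto simp: opalg_simps algebra_simps intro: opbound_add opbound_scale opbound_0)
next
  fix x y :: "'j \<Rightarrow> 'j \<Rightarrow> complex" and c
  assume "x \<in> carrier opalg"
  then obtain K where K: "opbound x K" by (auto simp: opalg_simps)
  show "(vnorm opalg x = 0) = (x = vzero opalg)"
  proof
    assume "vnorm opalg x = 0"
    then have "opbound x 0" using opbound_opnorm[OF K] by (simp add: opalg_simps)
    from opbound_entry[OF this] show "x = vzero opalg" by (intro ext) (simp add: opalg_simps)
  next
    assume "x = vzero opalg"
    then have "opbound x 0" using opbound_0 by (simp add: opalg_simps)
    then show "vnorm opalg x = 0"
      using opnorm_le[of x 0] opnorm_nonneg[of x 0] by (simp add: opalg_simps)
  qed
  show "vnorm opalg (vscale opalg c x) = cmod c * vnorm opalg x"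
    using opnorm_scale[OF K] by (simp add: opalg_simps)
  assume "y \<in> carrier opalg"
  then obtain L where L: "opbound y L" by (auto simp: opalg_simps)
  show "vnorm opalg (vadd opalg x y) \<le> vnorm opalg x + vnorm opalg y"
    using opnorm_le[OF opbound_add[OF opbound_opnorm[OF K] opbound_opnorm[OF L]]]
    by (simp add: opalg_simps)
qed

text \<open>Entries are bounded by the norm, so a Cauchy sequence converges entrywise. Applying
  \<open>opbound_limit\<close> to the differences of \<open>s n\<close> and \<open>s m\<close> as
  \<open>m\<close> grows upgrades this to convergence in norm.\<close>

lemma opalg_complete:
  "Metric_space.mcomplete (carrier opalg) (vdist (opalg :: ('j \<Rightarrow> 'j \<Rightarrow> complex) salg))"
proof -
  interpret normed_cvec "opalg :: ('j \<Rightarrow> 'j \<Rightarrow> complex) salg" by (rule opalg_normed_cvec)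
  show ?thesis
    unfolding mcomplete_def
  proof (intro allI impI)
    fix s :: "nat \<Rightarrow> 'j \<Rightarrow> 'j \<Rightarrow> complex"
    assume s: "MCauchy s"
    then have sc: "s n \<in> carrier opalg" for n unfolding MCauchy_def by blast
    have C: "\<exists>N. \<forall>n\<ge>N. \<forall>m\<ge>N. opbound (\<lambda>i j. s n i j - s m i j) e" if "0 < e" for e
    proof -
      have "\<exists>N. \<forall>n m. N \<le> n \<longrightarrow> N \<le> m \<longrightarrow> vdist opalg (s n) (s m) < e"
        using s that by (simp add: MCauchy_def)
      then obtain N where N: "\<forall>n m. N \<le> n \<longrightarrow> N \<le> m \<longrightarrow> vdist opalg (s n) (s m) < e" ..
      have "opbound (\<lambda>i j. s n i j - s m i j) e" if nm: "N \<le> n" "N \<le> m" for n m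
      proof -
        obtain K where K: "opbound (s n) K"
          using sc[of n] by (auto simp: opalg_simps)
        obtain L where L: "opbound (s m) L"
          using sc[of m] by (auto simp: opalg_simps)
        have "vdist opalg (s n) (s m) < e" using N nm by simp
        then have "opnorm (\<lambda>i j. s n i j - s m i j) \<le> e"
          unfolding vdist_def using sc[of n] sc[of m] by (simp add: opalg_simps)
        with opbound_opnorm[OF opbound_diff[OF K L]] show ?thesis by (rule opbound_mono)
      qed
      then show ?thesis by (intro exI[of _ N] allI impI)
    qed
    have "Cauchy (\<lambda>n. s n i j)" for i j
      unfolding Cauchy_iff
    proof (intro allI impI)
      fix e :: real assume "0 < e"
      then have "0 < e / 2" by simp
      from C[OF this] obtain N where
        N: "\<forall>n\<ge>N. \<forall>m\<ge>N. opbound (\<lambda>i j. s n i j - s m i j) (e / 2)" ..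
      have "norm (s n i j - s m i j) < e" if "N \<le> n" "N \<le> m" for n m
        using opbound_entry[OF N[rule_format, OF that], of i j] \<open>0 < e\<close> by linarith
      then show "\<exists>M. \<forall>m\<ge>M. \<forall>n\<ge>M. norm (s m i j - s n i j) < e"
        by (intro exI[of _ N] allI impI)
    qed
    then have "\<exists>l. (\<lambda>n. s n i j) \<longlonglongrightarrow> l" for i j
      using Cauchy_convergent_iff convergent_def by blast
    then obtain L where L: "\<And>i j. (\<lambda>n. s n i j) \<longlonglongrightarrow> L i j" by metis
    have D: "\<exists>N. \<forall>n\<ge>N. opbound (\<lambda>i j. s n i j - L i j) e" if e: "0 < e" for e
    proof -
      from C[OF e] obtain N where
        N: "\<forall>n\<ge>N. \<forall>m\<ge>N. opbound (\<lambda>i j. s n i j - s m i j) e" ..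
      have "opbound (\<lambda>i j. s n i j - L i j) e" if n: "N \<le> n" for n
      proof (rule opbound_limit)
        show "\<forall>\<^sub>F m in sequentially. opbound (\<lambda>i j. s n i j - s m i j) e"
          unfolding eventually_sequentially using N n by (intro exI[of _ N] allI impI) simp
      qed (intro tendsto_intros L)
      then show ?thesis by (intro exI[of _ N] allI impI)
    qed
    have Lc: "L \<in> carrier opalg"
    proof -
      obtain N where "\<forall>n\<ge>N. opbound (\<lambda>i j. s n i j - L i j) 1" using D[OF zero_less_one] ..
      then have N: "opbound (\<lambda>i j. s N i j - L i j) 1" by simp
      obtain K where "opbound (s N) K" using sc[of N] by (auto simp: opalg_simps)
      from opbound_diff[OF this N] show ?thesis unfolding opalg_simps by simp blast
    qed
    have "\<exists>N. \<forall>n\<ge>N. vdist opalg (s n) L < e" if "0 < e" for e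
    proof -
      have "0 < e / 2" using \<open>0 < e\<close> by simp
      from D[OF this] obtain N where N: "\<forall>n\<ge>N. opbound (\<lambda>i j. s n i j - L i j) (e / 2)" ..
      have "vdist opalg (s n) L < e" if "N \<le> n" for n
      proof -
        have "opnorm (\<lambda>i j. s n i j - L i j) < e"
          using opnorm_le[OF N[rule_format, OF that]] \<open>0 < e\<close> by linarith
        then show ?thesis unfolding vdist_def using sc[of n] Lc by (simp add: opalg_simps)
      qed
      then show ?thesis by (intro exI[of _ N] allI impI)
    qed
    then have "limitin mtopology s L sequentially"
      unfolding limitin_metric eventually_sequentially using sc Lc by simp
    then show "\<exists>x. limitin mtopology s x sequentially" by blast
  qed
qed

lemma opalg_cstar_algebra: "cstar_algebra (opalg :: ('j \<Rightarrow> 'j \<Rightarrow> complex) salg)"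
proof -
  interpret normed_cvec "opalg :: ('j \<Rightarrow> 'j \<Rightarrow> complex) salg" by (rule opalg_normed_cvec)
  have bound: "\<exists>K. opbound x K" if "x \<in> carrier opalg" for x :: "'j \<Rightarrow> 'j \<Rightarrow> complex"
    using that by (simp add: opalg_simps)
  show ?thesis
  proof (unfold_locales, goal_cases)
    case (1 x) then show ?case by (rule vnorm_eq_0)
  next
    case (2 x y) then show ?case by (rule vnorm_triangle)
  next
    case (3 x c) then show ?case by (rule vnorm_scale)
  next
    case 4 show ?case by (rule opalg_complete)
  next
    case (5 x y) then show ?case by (auto simp: opalg_simps intro: opbound_mprod)
  next
    case (6 x y z) then show ?case by (auto simp: opalg_simps intro: mprod_assoc)
  next
    case (7 x y z) then show ?case by (auto simp: opalg_simps intro: mprod_add_left)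
  next
    case (8 x y z) then show ?case by (auto simp: opalg_simps intro: mprod_add_right)
  next
    case (9 x y c) show ?case
      by (intro ext) (simp add: opalg_simps mprod_def dot_scale_right dot_commute[of _ "\<lambda>k. y k _"])
  next
    case (10 x y c) show ?case
      by (intro ext) (simp add: opalg_simps mprod_def dot_scale_right)
  next
    case (11 x y)
    then obtain K L where "opbound x K" "opbound y L" using bound by blast
    from opnorm_le[OF opbound_mprod[OF this[THEN opbound_opnorm]]] show ?case
      by (simp add: opalg_simps)
  next
    case (12 x) then show ?case by (auto simp: opalg_simps intro: opbound_adj)
  next
    case (13 x) show ?case by (simp add: opalg_simps adj_adj)
  next
    case (14 x y) show ?case by (intro ext) (simp add: opalg_simps adj_def)
  next
    case (15 x c) show ?case by (intro ext) (simp add: opalg_simps adj_def)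
  next
    case (16 x y) show ?case by (simp add: opalg_simps adj_mprod)
  next
    \<comment> \<open>One inequality is \<open>opbound_of_adj_mprod\<close>, the other combines
      submultiplicativity with \<open>opbound_adj\<close>.\<close>
    case (17 x)
    then obtain K where K: "opbound x K" using bound by blast
    note K' = opbound_opnorm[OF K]
    have b: "opbound (mprod (adj x) x) (opnorm x * opnorm x)"
      by (rule opbound_mprod[OF opbound_adj[OF K'] K'])
    have "opnorm x \<le> sqrt (opnorm (mprod (adj x) x))"
      by (rule opnorm_le[OF opbound_of_adj_mprod[OF K opbound_opnorm[OF b]]])
    then have "(opnorm x)\<^sup>2 \<le> opnorm (mprod (adj x) x)"
      using opnorm_nonneg[OF K] opnorm_nonneg[OF b] real_le_rsqrt
      by (metis power_mono real_sqrt_pow2)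
    moreover have "opnorm (mprod (adj x) x) \<le> (opnorm x)\<^sup>2"
      using opnorm_le[OF b] by (simp add: power2_eq_square)
    ultimately show ?case by (simp add: opalg_simps)
  qed
qed

section \<open>Functions vanishing at infinity\<close>

lemma c0_continuous: "f \<in> c0_functions X \<Longrightarrow> continuous_map X euclidean f"
  and c0_off: "f \<in> c0_functions X \<Longrightarrow> x \<notin> topspace X \<Longrightarrow> f x = 0"
  and c0_compactin: "f \<in> c0_functions X \<Longrightarrow> 0 < e \<Longrightarrow> compactin X {x \<in> topspace X. e \<le> cmod (f x)}"
  by (simp_all add: c0_functions_def)

text \<open>It is enough to find some compact set off which \<open>f\<close> is small: the
  superlevel set is closed and contained in it, hence compact.\<close>

lemma c0_functionsI:
  assumes cont: "continuous_map X euclidean f"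
    and off: "\<And>x. x \<notin> topspace X \<Longrightarrow> f x = 0"
    and vanish: "\<And>e. 0 < e \<Longrightarrow> \<exists>K. compactin X K \<and> (\<forall>x\<in>topspace X - K. cmod (f x) < e)"
  shows "f \<in> c0_functions X"
proof -
  have "compactin X {x \<in> topspace X. e \<le> cmod (f x)}" if e: "0 < e" for e
  proof -
    obtain K where K: "compactin X K" "\<forall>x\<in>topspace X - K. cmod (f x) < e"
      using vanish[OF e] by blast
    have "continuous_map X euclideanreal (\<lambda>x. cmod (f x))"
      using cont by (rule continuous_map_norm)
    then have "closedin X {x \<in> topspace X. cmod (f x) \<in> {e..}}"
      by (rule closedin_continuous_map_preimage) simp
    then have "closedin X {x \<in> topspace X. e \<le> cmod (f x)}" by simp
    moreover have "{x \<in> topspace X. e \<le> cmod (f x)} \<subseteq> K" using K(2) by force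
    ultimately show ?thesis using K(1) closed_compactin by blast
  qed
  with cont off show ?thesis by (simp add: c0_functions_def)
qed

lemma c0_vanish: "f \<in> c0_functions X \<Longrightarrow> 0 < e \<Longrightarrow> \<exists>K. compactin X K \<and> (\<forall>x\<in>topspace X - K. cmod (f x) < e)"
  using c0_compactin[of f X e] by (intro exI[of _ "{x \<in> topspace X. e \<le> cmod (f x)}"]) auto

lemma c0_bounded:
  assumes "f \<in> c0_functions X"
  shows "bdd_above (range (\<lambda>x. cmod (f x)))"
proof -
  have "compactin euclidean (f ` {x \<in> topspace X. 1 \<le> cmod (f x)})"
    using c0_compactin[OF assms, of 1] c0_continuous[OF assms] by (intro image_compactin) auto
  then have "bounded (f ` {x \<in> topspace X. 1 \<le> cmod (f x)})"
    by (simp add: compact_imp_bounded)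
  then obtain B where B: "\<And>x. x \<in> topspace X \<Longrightarrow> 1 \<le> cmod (f x) \<Longrightarrow> cmod (f x) \<le> B"
    by (auto simp: bounded_iff)
  have "cmod (f x) \<le> max B 1" for x
    using B[of x] c0_off[OF assms, of x] by (cases "x \<in> topspace X"; cases "1 \<le> cmod (f x)") auto
  then show ?thesis by (intro bdd_aboveI2)
qed

lemma c0_norm_upper: "f \<in> c0_functions X \<Longrightarrow> cmod (f x) \<le> vnorm (c0_algebra X) f"
  unfolding c0_algebra_def using c0_bounded[of f X] by (auto intro: cSUP_upper)

lemma c0_norm_least: "(\<And>x. cmod (f x) \<le> B) \<Longrightarrow> vnorm (c0_algebra X) f \<le> B"
  unfolding c0_algebra_def by (auto intro: cSUP_least)

text \<open>Covers products, scalar multiples and the left action, where the factor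
  \<open>f (\<sigma> g x)\<close> is known to be bounded and continuous but is not shown to vanish
  at infinity.\<close>

lemma c0_mult_bounded:
  assumes "continuous_map X euclidean a" "\<And>x. x \<in> topspace X \<Longrightarrow> cmod (a x) \<le> B" "f \<in> c0_functions X"
  shows "(\<lambda>x. a x * f x) \<in> c0_functions X"
proof (rule c0_functionsI)
  show "continuous_map X euclidean (\<lambda>x. a x * f x)"
    using assms(1) c0_continuous[OF assms(3)] by (simp add: continuous_map_atin tendsto_mult)
  show "a x * f x = 0" if "x \<notin> topspace X" for x using c0_off[OF assms(3) that] by simp
  fix e :: real assume e: "0 < e"
  define B' where "B' = max B 1"
  have B': "0 < B'" by (simp add: B'_def)
  obtain K where K: "compactin X K" "\<forall>x\<in>topspace X - K. cmod (f x) < e / B'"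
    using c0_vanish[OF assms(3), of "e / B'"] e B' by auto
  have "cmod (a x * f x) < e" if x: "x \<in> topspace X - K" for x
  proof -
    have "cmod (a x * f x) \<le> B' * cmod (f x)"
      using assms(2)[of x] x by (auto simp: norm_mult B'_def intro!: mult_right_mono)
    also have "\<dots> < B' * (e / B')" using K(2) x B' by (intro mult_strict_left_mono) auto
    finally show ?thesis using B' by simp
  qed
  with K(1) show "\<exists>K. compactin X K \<and> (\<forall>x\<in>topspace X - K. cmod (a x * f x) < e)" by blast
qed

lemma c0_mult:
  assumes "f \<in> c0_functions X" "g \<in> c0_functions X"
  shows "(\<lambda>x. f x * g x) \<in> c0_functions X"
  using c0_continuous[OF assms(1)] c0_norm_upper[OF assms(1)] assms(2) by (rule c0_mult_bounded)

lemma c0_scale: "f \<in> c0_functions X \<Longrightarrow> (\<lambda>x. c * f x) \<in> c0_functions X"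
  by (rule c0_mult_bounded[where a = "\<lambda>_. c" and B = "cmod c"]) auto

lemma c0_cnj: "f \<in> c0_functions X \<Longrightarrow> (\<lambda>x. cnj (f x)) \<in> c0_functions X"
  by (auto simp: c0_functions_def continuous_map_atin tendsto_cnj)

lemma c0_zero: "(\<lambda>x. 0) \<in> c0_functions X"
  by (rule c0_functionsI) (auto intro: exI[of _ "{}"])

lemma c0_add:
  assumes "f \<in> c0_functions X" "g \<in> c0_functions X"
  shows "(\<lambda>x. f x + g x) \<in> c0_functions X"
proof (rule c0_functionsI)
  show "continuous_map X euclidean (\<lambda>x. f x + g x)"
    using assms by (intro continuous_map_add c0_continuous)
  show "f x + g x = 0" if "x \<notin> topspace X" for x
    using c0_off[OF assms(1) that] c0_off[OF assms(2) that] by simp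
  fix e :: real assume e: "0 < e"
  obtain K where K: "compactin X K" "\<forall>x\<in>topspace X - K. cmod (f x) < e / 2"
    using c0_vanish[OF assms(1), of "e / 2"] e by auto
  obtain L where L: "compactin X L" "\<forall>x\<in>topspace X - L. cmod (g x) < e / 2"
    using c0_vanish[OF assms(2), of "e / 2"] e by auto
  have "cmod (f x + g x) < e" if "x \<in> topspace X - (K \<union> L)" for x
  proof -
    have "cmod (f x) < e / 2" "cmod (g x) < e / 2" using K L that by auto
    then show ?thesis using norm_triangle_ineq[of "f x" "g x"] by linarith
  qed
  with compactin_Un[OF K(1) L(1)]
  show "\<exists>K. compactin X K \<and> (\<forall>x\<in>topspace X - K. cmod (f x + g x) < e)" by blast
qed

lemma c0_sum: "(\<And>i. i \<in> I \<Longrightarrow> f i \<in> c0_functions X) \<Longrightarrow> (\<lambda>x. \<Sum>i\<in>I. f i x) \<in> c0_functions X"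
  by (induction I rule: infinite_finite_induct) (auto intro: c0_zero c0_add)

section \<open>Functions on the product with a discrete space\<close>

lemma continuous_map_prod_discrete:
  assumes "\<And>g. g \<in> S \<Longrightarrow> continuous_map X Y (\<lambda>x. h (g, x))"
  shows "continuous_map (prod_topology (discrete_topology S) X) Y h"
  unfolding continuous_map_def
proof (intro conjI allI impI)
  show "h \<in> topspace (prod_topology (discrete_topology S) X) \<rightarrow> topspace Y"
    using assms by (auto simp: continuous_map_def Pi_iff)
  fix U assume U: "openin Y U"
  have eq: "{p \<in> topspace (prod_topology (discrete_topology S) X). h p \<in> U}
    = \<Union>((\<lambda>g. {g} \<times> {x \<in> topspace X. h (g, x) \<in> U}) ` S)"
    by auto
  have "openin (prod_topology (discrete_topology S) X) ({g} \<times> {x \<in> topspace X. h (g, x) \<in> U})"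
    if "g \<in> S" for g
    using openin_continuous_map_preimage[OF assms[OF that] U] that
    by (simp add: openin_prod_Times_iff)
  then show "openin (prod_topology (discrete_topology S) X)
      {p \<in> topspace (prod_topology (discrete_topology S) X). h p \<in> U}"
    unfolding eq by (intro openin_Union) auto
qed

lemma c0_prod_discreteI:
  assumes "finite S"
    and slices: "\<And>g. g \<in> S \<Longrightarrow> (\<lambda>x. F (g, x)) \<in> c0_functions X"
    and off: "\<And>g x. g \<notin> S \<Longrightarrow> F (g, x) = 0"
  shows "F \<in> c0_functions (prod_topology (discrete_topology S) X)"
proof (rule c0_functionsI)
  show "continuous_map (prod_topology (discrete_topology S) X) euclidean F"
    by (rule continuous_map_prod_discrete) (rule c0_continuous[OF slices])
  show "F p = 0" if "p \<notin> topspace (prod_topology (discrete_topology S) X)" for p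
    using that off slices[THEN c0_off] by (cases p) auto
  fix e :: real assume e: "0 < e"
  have "\<forall>g\<in>S. \<exists>K. compactin X K \<and> (\<forall>x\<in>topspace X - K. cmod (F (g, x)) < e)"
    using c0_vanish[OF slices e] by blast
  then obtain K where K: "\<And>g. g \<in> S \<Longrightarrow> compactin X (K g)"
    "\<And>g x. g \<in> S \<Longrightarrow> x \<in> topspace X - K g \<Longrightarrow> cmod (F (g, x)) < e"
    by metis
  have "compactin X (\<Union>(K ` S))" using assms(1) K(1) by (intro compactin_Union) auto
  then have "compactin (prod_topology (discrete_topology S) X) (S \<times> \<Union>(K ` S))"
    using assms(1) by (simp add: compactin_Times compactin_discrete_topology)
  moreover have "\<forall>p\<in>topspace (prod_topology (discrete_topology S) X) - S \<times> \<Union>(K ` S). cmod (F p) < e"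
    using K(2) by auto
  ultimately show "\<exists>K. compactin (prod_topology (discrete_topology S) X) K \<and>
      (\<forall>x\<in>topspace (prod_topology (discrete_topology S) X) - K. cmod (F x) < e)" by blast
qed

lemma c0_prod_discrete_off:
  "F \<in> c0_functions (prod_topology (discrete_topology S) X) \<Longrightarrow> g \<notin> S \<Longrightarrow> F (g, x) = 0"
  by (rule c0_off) auto

lemma c0_prod_discrete_slice:
  assumes F: "F \<in> c0_functions (prod_topology (discrete_topology S) X)" and "g \<in> S"
  shows "(\<lambda>x. F (g, x)) \<in> c0_functions X"
proof (rule c0_functionsI)
  have "continuous_map X (prod_topology (discrete_topology S) X) (\<lambda>x. (g, x))"
    using assms(2) by (intro continuous_map_pairedI) (auto simp: continuous_map_const)
  from continuous_map_compose[OF this c0_continuous[OF F]]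
  show "continuous_map X euclidean (\<lambda>x. F (g, x))" by (simp add: o_def)
  show "F (g, x) = 0" if "x \<notin> topspace X" for x using that by (intro c0_off[OF F]) auto
  fix e :: real assume e: "0 < e"
  obtain K where K: "compactin (prod_topology (discrete_topology S) X) K"
    "\<forall>p\<in>topspace (prod_topology (discrete_topology S) X) - K. cmod (F p) < e"
    using c0_vanish[OF F e] by blast
  have "cmod (F (g, x)) < e" if "x \<in> topspace X - snd ` K" for x
    using K(2)[rule_format, of "(g, x)"] that assms(2) by force
  with image_compactin[OF K(1) continuous_map_snd]
  show "\<exists>K. compactin X K \<and> (\<forall>x\<in>topspace X - K. cmod (F (g, x)) < e)" by blast
qed

text \<open>Complete regularity gives \<open>f\<close> with \<open>f y = 0\<close> and
  \<open>f = 1\<close> off a neighbourhood \<open>U\<close> inside a compact set \<open>L\<close>;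
  then \<open>1 - f\<close> vanishes off \<open>L\<close>.\<close>

lemma c0_bump:
  assumes "locally_compact_space X" "Hausdorff_space X" "y \<in> topspace X"
  shows "\<exists>f\<in>c0_functions X. f y = 1"
proof -
  have "compactin X {y}" using assms(3) by simp
  then obtain U L where UL: "openin X U" "compactin X L" "y \<in> U" "U \<subseteq> L"
    using locally_compact_space_compact_closed_compact[of X] assms(1,2) by blast
  have "regular_space X"
    using assms by (simp add: locally_compact_Hausdorff_imp_regular_space)
  then have "completely_regular_space X"
    using assms(1) by (simp add: locally_compact_regular_imp_completely_regular_space)
  moreover have "closedin X (topspace X - U)" "y \<in> topspace X - (topspace X - U)"
    using UL(1,3) assms(3) by auto
  ultimately have "\<exists>f::'a \<Rightarrow> real. continuous_map X (top_of_set {0..1}) f \<and> f y = 0 \<and> f ` (topspace X - U) \<subseteq> {1}"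
    unfolding completely_regular_space_def by (metis (no_types, lifting))
  then obtain f :: "'a \<Rightarrow> real" where f: "continuous_map X (top_of_set {0..1}) f" "f y = 0"
    "f ` (topspace X - U) \<subseteq> {1}" by blast
  define h where "h x = (if x \<in> topspace X then complex_of_real (1 - f x) else 0)" for x
  have "continuous_map X euclidean f" using f(1) by (simp add: continuous_map_in_subtopology)
  then have "continuous_map X euclidean (\<lambda>x. complex_of_real (1 - f x))"
    by (simp add: continuous_map_atin tendsto_of_real tendsto_diff)
  then have "continuous_map X euclidean h"
    by (rule continuous_map_eq) (simp add: h_def)
  moreover have "cmod (h x) < e" if "0 < e" "x \<in> topspace X - L" for x e
  proof -
    have "f x = 1" using f(3) that UL(4) by auto
    then show ?thesis using that by (simp add: h_def)
  qed
  ultimately have "h \<in> c0_functions X"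
    using UL(2) by (intro c0_functionsI) (auto simp: h_def)
  moreover have "h y = 1" using f(2) assms(3) by (simp add: h_def)
  ultimately show ?thesis by blast
qed

lemma c0_bump_finite:
  assumes "locally_compact_space X" "Hausdorff_space X" "finite S" "S \<subseteq> topspace X"
  shows "\<exists>f\<in>c0_functions X. \<forall>y\<in>S. f y = 1"
  using assms(3,4)
proof (induction S)
  case empty
  show ?case using c0_zero by auto
next
  case (insert y S)
  then obtain f where f: "f \<in> c0_functions X" "\<forall>y\<in>S. f y = 1" by auto
  obtain h where h: "h \<in> c0_functions X" "h y = 1"
    using c0_bump[OF assms(1,2), of y] insert by blast
  \<comment> \<open>This is \<open>1 - (1 - f) (1 - h)\<close>, which takes the value 1 wherever
    \<open>f\<close> or \<open>h\<close> does.\<close>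
  have "(\<lambda>x. (f x + h x) + (- 1) * (f x * h x)) \<in> c0_functions X"
    by (intro c0_add c0_scale c0_mult f(1) h(1))
  moreover have "\<forall>z\<in>insert y S. (f z + h z) + (- 1) * (f z * h z) = 1"
    using f(2) h(2) by auto
  ultimately show ?case
    by - (rule bexI[where x = "\<lambda>x. (f x + h x) + (- 1) * (f x * h x)"], simp_all)
qed

section \<open>The Fock representation\<close>

text \<open>An index \<open>(w, x)\<close> is the path that starts at \<open>x\<close> and whose
  word \<open>w\<close> carries the last edge at its head, so \<open>foldr \<sigma> w x\<close> is
  its end. The operator prolongs a path \<open>v\<close> by \<open>u\<close>, with the coefficient
  of \<open>u\<close> evaluated at the end of \<open>v\<close>.\<close>

definition fock_matrix ::
    "('g \<Rightarrow> 'x \<Rightarrow> 'x) \<Rightarrow> ('g list \<Rightarrow> 'x \<Rightarrow> complex) \<Rightarrow> ('g, 'x) path_matrix" where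
  "fock_matrix \<sigma> c p q =
    (if snd p = snd q \<and> (\<exists>u. fst p = u @ fst q)
     then c (take (length (fst p) - length (fst q)) (fst p)) (foldr \<sigma> (fst q) (snd q)) else 0)"

text \<open>The product of such operators on the level of coefficients: the path is cut at each of
  its vertices, \<open>d\<close> sees the initial piece and \<open>c\<close> the rest, started where
  the initial piece ends.\<close>

definition path_conv ::
    "('g \<Rightarrow> 'x \<Rightarrow> 'x) \<Rightarrow> ('g list \<Rightarrow> 'x \<Rightarrow> complex) \<Rightarrow> ('g list \<Rightarrow> 'x \<Rightarrow> complex) \<Rightarrow> 'g list \<Rightarrow> 'x \<Rightarrow> complex" where
  "path_conv \<sigma> c d w x = (\<Sum>k\<le>length w. c (take k w) (foldr \<sigma> (drop k w) x) * d (drop k w) x)"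

lemma fock_matrix_append [simp]: "fock_matrix \<sigma> c (u @ v, x) (v, x) = c u (foldr \<sigma> v x)"
  by (simp add: fock_matrix_def)

lemma fock_matrix_Nil [simp]: "fock_matrix \<sigma> c (w, x) ([], x) = c w x"
  by (simp add: fock_matrix_def)

lemma fock_matrix_eq_0: "(\<And>u. p = (u @ fst q, snd q) \<Longrightarrow> False) \<Longrightarrow> fock_matrix \<sigma> c p q = 0"
  by (cases p; cases q) (auto simp: fock_matrix_def)

lemma fock_matrix_cases:
  obtains (path) u v x where "p = (u @ v, x)" "q = (v, x)" | (other) "\<And>c. fock_matrix \<sigma> c p q = 0"
proof (cases "\<exists>u. p = (u @ fst q, snd q)")
  case True
  then show thesis using path by (metis prod.collapse)
next
  case False
  show thesis by (rule other, rule fock_matrix_eq_0) (use False in blast)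
qed

text \<open>Between \<open>v\<close> and \<open>u @ v\<close> only the paths obtained from suffixes
  of \<open>u\<close> contribute, so the infinite sum is the finite sum over cuts of
  \<open>u\<close>.\<close>

lemma mprod_fock_matrix:
  "mprod (fock_matrix \<sigma> c) (fock_matrix \<sigma> d) = fock_matrix \<sigma> (path_conv \<sigma> c d)"
proof (intro ext)
  fix p q :: "'a list \<times> 'b"
  show "mprod (fock_matrix \<sigma> c) (fock_matrix \<sigma> d) p q = fock_matrix \<sigma> (path_conv \<sigma> c d) p q"
  proof (cases "\<exists>u v x. p = (u @ v, x) \<and> q = (v, x)")
    case True
    then obtain u v x where pq: "p = (u @ v, x)" "q = (v, x)" by blast
    let ?m = "\<lambda>k. (drop k u @ v, x)"
    have inj: "inj_on ?m {..length u}"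
      by (intro inj_onI) (auto dest!: arg_cong[where f = length])
    have "mprod (fock_matrix \<sigma> c) (fock_matrix \<sigma> d) p q
      = (\<Sum>\<^sub>\<infinity>m\<in>?m ` {..length u}. fock_matrix \<sigma> c p m * fock_matrix \<sigma> d m q)"
      unfolding mprod_def dot_def
    proof (rule infsum_cong_neutral)
      fix m assume m: "m \<in> UNIV - ?m ` {..length u}"
      show "fock_matrix \<sigma> c p m * fock_matrix \<sigma> d m q = 0"
      proof (rule ccontr)
        assume "\<not> ?thesis"
        then obtain u1 u2 where "p = (u1 @ fst m, snd m)" "m = (u2 @ v, x)"
          using fock_matrix_eq_0[of p m \<sigma> c] fock_matrix_eq_0[of m q \<sigma> d] pq by fastforce
        then have "m = ?m (length u1)" "length u1 \<le> length u" using pq by auto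
        with m show False by blast
      qed
    qed auto
    also have "\<dots> = (\<Sum>k\<le>length u. fock_matrix \<sigma> c p (?m k) * fock_matrix \<sigma> d (?m k) q)"
      using inj by (simp add: sum.reindex)
    also have "\<dots> = path_conv \<sigma> c d u (foldr \<sigma> v x)"
      unfolding path_conv_def
    proof (intro sum.cong refl)
      fix k assume "k \<in> {..length u}"
      have "fock_matrix \<sigma> c (take k u @ (drop k u @ v), x) (drop k u @ v, x) = c (take k u) (foldr \<sigma> (drop k u @ v) x)"
        by (rule fock_matrix_append)
      then show "fock_matrix \<sigma> c p (?m k) * fock_matrix \<sigma> d (?m k) q
        = c (take k u) (foldr \<sigma> (drop k u) (foldr \<sigma> v x)) * d (drop k u) (foldr \<sigma> v x)"
        by (simp add: pq flip: append_assoc)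
    qed
    finally show ?thesis by (simp add: pq)
  next
    case False
    have "fock_matrix \<sigma> c p m * fock_matrix \<sigma> d m q = 0" for m
    proof (rule ccontr)
      assume "\<not> ?thesis"
      then obtain u1 u2 where "p = (u1 @ fst m, snd m)" "m = (u2 @ fst q, snd q)"
        using fock_matrix_eq_0[of p m \<sigma> c] fock_matrix_eq_0[of m q \<sigma> d] by fastforce
      then have "p = ((u1 @ u2) @ fst q, snd q)" by simp
      with False show False by (metis prod.collapse)
    qed
    moreover have "fock_matrix \<sigma> (path_conv \<sigma> c d) p q = 0"
      using False by (intro fock_matrix_eq_0) (metis prod.collapse)
    ultimately show ?thesis unfolding mprod_def dot_def by (simp only: infsum_0)
  qed
qed

lemma fock_matrix_add:
  "(\<lambda>p q. fock_matrix \<sigma> c p q + fock_matrix \<sigma> d p q) = fock_matrix \<sigma> (\<lambda>w x. c w x + d w x)"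
  by (auto simp: fock_matrix_def fun_eq_iff)

lemma fock_matrix_scale:
  "(\<lambda>p q. a * fock_matrix \<sigma> c p q) = fock_matrix \<sigma> (\<lambda>w x. a * c w x)"
  by (auto simp: fock_matrix_def fun_eq_iff)

section \<open>Coefficients and Fock matrices of the generators\<close>

definition vertex_coef :: "('x \<Rightarrow> complex) \<Rightarrow> 'g list \<Rightarrow> 'x \<Rightarrow> complex" where
  "vertex_coef f w x = (if w = [] then f x else 0)"

definition edge_coef :: "('g \<times> 'x \<Rightarrow> complex) \<Rightarrow> 'g list \<Rightarrow> 'x \<Rightarrow> complex" where
  "edge_coef F w x = (if length w = 1 then F (hd w, x) else 0)"

lemma path_conv_vertex_left: "path_conv \<sigma> (vertex_coef f) d w x = f (foldr \<sigma> w x) * d w x"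
proof -
  have "path_conv \<sigma> (vertex_coef f) d w x = (\<Sum>k\<le>length w. if k = 0 then f (foldr \<sigma> w x) * d w x else 0)"
    unfolding path_conv_def by (intro sum.cong refl) (auto simp: vertex_coef_def)
  then show ?thesis by simp
qed

lemma path_conv_vertex_vertex:
  "path_conv \<sigma> (vertex_coef f) (vertex_coef h) = vertex_coef (\<lambda>x. f x * h x)"
  by (intro ext) (simp add: path_conv_vertex_left, simp add: vertex_coef_def)

lemma path_conv_vertex_edge:
  "path_conv \<sigma> (vertex_coef f) (edge_coef F) = edge_coef (\<lambda>(g, x). f (\<sigma> g x) * F (g, x))"
  by (intro ext) (simp add: path_conv_vertex_left, auto simp: edge_coef_def length_Suc_conv)

lemma path_conv_edge_left_Nil: "path_conv \<sigma> (edge_coef F) d [] x = 0"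
  by (simp add: path_conv_def edge_coef_def)

lemma path_conv_edge_left_Cons:
  "path_conv \<sigma> (edge_coef F) d (g # w) x = F (g, foldr \<sigma> w x) * d w x"
proof -
  have "path_conv \<sigma> (edge_coef F) d (g # w) x
    = (\<Sum>k\<le>length (g # w). if k = 1 then F (g, foldr \<sigma> w x) * d w x else 0)"
    unfolding path_conv_def by (intro sum.cong refl) (auto simp: edge_coef_def)
  also have "\<dots> = F (g, foldr \<sigma> w x) * d w x"
    by (subst sum.delta) auto
  finally show ?thesis .
qed

lemma path_conv_degree:
  assumes "\<And>w x. length w \<noteq> m \<Longrightarrow> c w x = 0" "\<And>w x. length w \<noteq> n \<Longrightarrow> d w x = 0" "length w \<noteq> m + n"
  shows "path_conv \<sigma> c d w x = 0"
  unfolding path_conv_def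
proof (intro sum.neutral ballI)
  fix k assume "k \<in> {..length w}"
  then show "c (take k w) (foldr \<sigma> (drop k w) x) * d (drop k w) x = 0"
    using assms(1)[of "take k w"] assms(2)[of "drop k w"] assms(3) by (cases "k = m") auto
qed

lemma fock_matrix_vertex:
  "fock_matrix \<sigma> (vertex_coef f) p q = (if p = q then f (foldr \<sigma> (fst q) (snd q)) else 0)"
  by (cases p; cases q) (auto simp: fock_matrix_def vertex_coef_def)

lemma fock_matrix_edge:
  "fock_matrix \<sigma> (edge_coef F) p q =
    (if fst p \<noteq> [] \<and> q = (tl (fst p), snd p) then F (hd (fst p), foldr \<sigma> (fst q) (snd q)) else 0)"
proof (cases rule: fock_matrix_cases[where p = p and q = q and \<sigma> = \<sigma>])
  case (path u v x)
  show ?thesis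
  proof (cases "length u = 1")
    case True
    then obtain g where "u = [g]" by (auto simp: length_Suc_conv)
    with path show ?thesis by (simp add: fock_matrix_def edge_coef_def)
  next
    case False
    \<comment> \<open>The tail drops exactly one letter of a nonempty word, so \<open>v\<close> is
      the tail of \<open>u @ v\<close> only for \<open>length u = 1\<close>.\<close>
    then have "\<not> (u @ v \<noteq> [] \<and> v = tl (u @ v))"
      by (metis add_right_cancel length_append length_tl append_Nil diff_add_inverse2 length_0_conv length_greater_0_conv One_nat_def Suc_pred add.commute plus_1_eq_Suc)
    with False path show ?thesis by (auto simp: edge_coef_def)
  qed
next
  case other
  moreover have "\<not> (fst p \<noteq> [] \<and> q = (tl (fst p), snd p))"
  proof
    assume *: "fst p \<noteq> [] \<and> q = (tl (fst p), snd p)"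
    then have "p = ([hd (fst p)] @ fst q, snd q)" by (cases p) auto
    \<comment> \<open>The case assumption holds for all coefficients at once; the constant 1 refutes
      it, having entry 1 at every prolongation.\<close>
    then have "fock_matrix \<sigma> (\<lambda>_ _. 1) p q = 1"
      by (metis fock_matrix_append prod.collapse)
    with other show False by simp
  qed
  ultimately show ?thesis by auto
qed

lemma opbound_vertex:
  assumes "\<And>x. cmod (f x) \<le> B"
  shows "opbound (fock_matrix \<sigma> (vertex_coef f)) B"
proof -
  have B: "0 \<le> B" using assms norm_ge_zero order_trans by blast
  have e: "cmod (fock_matrix \<sigma> (vertex_coef f) p q) = (if p = q then cmod (f (foldr \<sigma> (fst p) (snd p))) else 0)" for p q
    by (simp add: fock_matrix_vertex)
  show ?thesis
  proof (rule opbound_Schur)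
    fix p and H :: "('b list \<times> 'a) set" assume "finite H"
    then show "(\<Sum>q\<in>H. cmod (fock_matrix \<sigma> (vertex_coef f) p q)) \<le> B"
      unfolding e using assms B by (simp add: sum.delta)
    from \<open>finite H\<close> show "(\<Sum>q\<in>H. cmod (fock_matrix \<sigma> (vertex_coef f) q p)) \<le> B"
      unfolding e using assms B by (simp add: sum.delta' cong: if_cong)
  qed
qed

text \<open>A row has at most one nonzero entry and a column at most \<open>card S\<close>; the
  factor \<open>card S + 1\<close> dominates both counts, also for empty \<open>S\<close>.\<close>

lemma opbound_edge:
  assumes "\<And>e. cmod (F e) \<le> B" "finite S" "\<And>g x. g \<notin> S \<Longrightarrow> F (g, x) = 0"
  shows "opbound (fock_matrix \<sigma> (edge_coef F)) (real (card S + 1) * B)"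
proof (rule opbound_Schur)
  have B: "0 \<le> B" using assms(1) norm_ge_zero order_trans by blast
  fix p and H :: "('a list \<times> 'b) set" assume H: "finite H"
  have "(\<Sum>q\<in>H. cmod (fock_matrix \<sigma> (edge_coef F) p q)) \<le> (\<Sum>q\<in>H. if q = (tl (fst p), snd p) then B else 0)"
    by (intro sum_mono) (auto simp: fock_matrix_edge assms(1) B)
  also have "\<dots> \<le> B" using H B by (simp add: sum.delta)
  also have "\<dots> \<le> real (card S + 1) * B" using B by (simp add: distrib_right)
  finally show "(\<Sum>q\<in>H. cmod (fock_matrix \<sigma> (edge_coef F) p q)) \<le> real (card S + 1) * B" .
  let ?I = "(\<lambda>g. (g # fst p, snd p)) ` S"
  have "(\<Sum>q\<in>H. cmod (fock_matrix \<sigma> (edge_coef F) q p)) = (\<Sum>q\<in>H \<inter> ?I. cmod (fock_matrix \<sigma> (edge_coef F) q p))"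
  proof (rule sum.mono_neutral_right)
    show "\<forall>q\<in>H - H \<inter> ?I. cmod (fock_matrix \<sigma> (edge_coef F) q p) = 0"
    proof
      fix q assume q: "q \<in> H - H \<inter> ?I"
      show "cmod (fock_matrix \<sigma> (edge_coef F) q p) = 0"
      proof (rule ccontr)
        assume "\<not> ?thesis"
        then have *: "fst q \<noteq> []" "p = (tl (fst q), snd q)" "F (hd (fst q), foldr \<sigma> (fst p) (snd p)) \<noteq> 0"
          by (auto simp: fock_matrix_edge split: if_splits)
        then have "hd (fst q) \<in> S" using assms(3) by blast
        moreover have "q = (hd (fst q) # fst p, snd p)" using * by simp
        ultimately show False using q by blast
      qed
    qed
  qed (use H in auto)
  also have "\<dots> \<le> (\<Sum>q\<in>H \<inter> ?I. B)"
    by (intro sum_mono) (simp add: fock_matrix_edge assms(1) B)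
  also have "\<dots> \<le> real (card S) * B"
  proof -
    have "card (H \<inter> ?I) \<le> card ?I" using assms(2) by (intro card_mono) auto
    also have "\<dots> \<le> card S" by (rule card_image_le[OF assms(2)])
    finally show ?thesis using B by (simp add: mult_right_mono)
  qed
  also have "\<dots> \<le> real (card S + 1) * B" using B by (simp add: distrib_right)
  finally show "(\<Sum>q\<in>H. cmod (fock_matrix \<sigma> (edge_coef F) q p)) \<le> real (card S + 1) * B" .
qed

text \<open>A path \<open>m\<close> contributes only if removing its last edge leaves both
  \<open>p\<close> and \<open>q\<close>. So the product is diagonal, and the sum runs over the
  possible last edges.\<close>

lemma mprod_adj_edge:
  assumes "finite S" "\<And>g x. g \<notin> S \<Longrightarrow> F (g, x) = 0"
  shows "mprod (adj (fock_matrix \<sigma> (edge_coef F))) (fock_matrix \<sigma> (edge_coef F'))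
    = fock_matrix \<sigma> (vertex_coef (\<lambda>x. \<Sum>g\<in>S. cnj (F (g, x)) * F' (g, x)))"
proof (intro ext)
  fix p q :: "'a list \<times> 'b"
  let ?I = "(\<lambda>g. (g # fst p, snd p)) ` S"
  have inj: "inj_on (\<lambda>g. (g # fst p, snd p)) S" by (simp add: inj_on_def)
  have "mprod (adj (fock_matrix \<sigma> (edge_coef F))) (fock_matrix \<sigma> (edge_coef F')) p q
    = (\<Sum>\<^sub>\<infinity>m\<in>?I. cnj (fock_matrix \<sigma> (edge_coef F) m p) * fock_matrix \<sigma> (edge_coef F') m q)"
    unfolding mprod_def dot_def adj_def
  proof (rule infsum_cong_neutral)
    fix m assume m: "m \<in> UNIV - ?I"
    show "cnj (fock_matrix \<sigma> (edge_coef F) m p) * fock_matrix \<sigma> (edge_coef F') m q = 0"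
    proof (rule ccontr)
      assume "\<not> ?thesis"
      then have *: "fst m \<noteq> []" "p = (tl (fst m), snd m)" "F (hd (fst m), foldr \<sigma> (fst p) (snd p)) \<noteq> 0"
        by (auto simp: fock_matrix_edge split: if_splits)
      then have "hd (fst m) \<in> S" using assms(2) by blast
      moreover have "m = (hd (fst m) # fst p, snd p)" using * by simp
      ultimately show False using m by blast
    qed
  qed auto
  also have "\<dots> = (\<Sum>g\<in>S. if p = q then cnj (F (g, foldr \<sigma> (fst p) (snd p))) * F' (g, foldr \<sigma> (fst p) (snd p)) else 0)"
    using assms(1) inj by (auto simp: sum.reindex fock_matrix_edge intro!: sum.cong)
  also have "\<dots> = fock_matrix \<sigma> (vertex_coef (\<lambda>x. \<Sum>g\<in>S. cnj (F (g, x)) * F' (g, x))) p q"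
    by (simp add: fock_matrix_vertex)
  finally show "mprod (adj (fock_matrix \<sigma> (edge_coef F))) (fock_matrix \<sigma> (edge_coef F')) p q
    = fock_matrix \<sigma> (vertex_coef (\<lambda>x. \<Sum>g\<in>S. cnj (F (g, x)) * F' (g, x))) p q" .
qed

lemma toeplitz_rep_fock:
  assumes "finite (carrier G)"
  shows "toeplitz_rep (c0_algebra \<Omega>) (dynamical_correspondence G \<Omega> \<sigma>) opalg
    (\<lambda>f. fock_matrix \<sigma> (vertex_coef f)) (\<lambda>F. fock_matrix \<sigma> (edge_coef F))"
  unfolding toeplitz_rep_def
proof (intro conjI ballI)
  have b1: "opbound (fock_matrix \<sigma> (vertex_coef f)) (vnorm (c0_algebra \<Omega>) f)"
    if "f \<in> c0_functions \<Omega>" for f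
    by (rule opbound_vertex) (rule c0_norm_upper[OF that])
  have b2: "\<exists>K. opbound (fock_matrix \<sigma> (edge_coef F)) K"
    if F: "F \<in> c0_functions (prod_topology (discrete_topology (carrier G)) \<Omega>)" for F
  proof -
    have "opbound (fock_matrix \<sigma> (edge_coef F)) (real (card (carrier G) + 1) *
        vnorm (c0_algebra (prod_topology (discrete_topology (carrier G)) \<Omega>)) F)"
      using c0_norm_upper[OF F] assms c0_prod_discrete_off[OF F] by (rule opbound_edge)
    then show ?thesis by blast
  qed
  show "cstar_algebra (opalg :: ('a, 'c) path_matrix salg)" by (rule opalg_cstar_algebra)
  show "star_hom (c0_algebra \<Omega>) opalg (\<lambda>f. fock_matrix \<sigma> (vertex_coef f))"
    unfolding star_hom_def bounded_clinear_map_def clinear_map_def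
  proof (intro conjI ballI allI)
    show "(\<lambda>f. fock_matrix \<sigma> (vertex_coef f)) \<in> carrier (c0_algebra \<Omega>) \<rightarrow> carrier opalg"
      using b1 by (auto simp: opalg_simps c0_algebra_def)
    show "\<exists>K. \<forall>f\<in>carrier (c0_algebra \<Omega>). vnorm opalg (fock_matrix \<sigma> (vertex_coef f)) \<le> K * vnorm (c0_algebra \<Omega>) f"
    proof (intro exI[of _ 1] ballI)
      fix f assume "f \<in> carrier (c0_algebra \<Omega>)"
      then have "f \<in> c0_functions \<Omega>" by (simp add: c0_algebra_def)
      from opnorm_le[OF b1[OF this]]
      show "vnorm opalg (fock_matrix \<sigma> (vertex_coef f)) \<le> 1 * vnorm (c0_algebra \<Omega>) f"
        by (simp add: opalg_simps)
    qed
  next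
    fix f h :: "'c \<Rightarrow> complex"
    show "fock_matrix \<sigma> (vertex_coef (vadd (c0_algebra \<Omega>) f h)) =
        vadd opalg (fock_matrix \<sigma> (vertex_coef f)) (fock_matrix \<sigma> (vertex_coef h))"
      by (simp add: opalg_simps c0_algebra_def fun_eq_iff fock_matrix_vertex)
    show "fock_matrix \<sigma> (vertex_coef (vmult (c0_algebra \<Omega>) f h)) =
        vmult opalg (fock_matrix \<sigma> (vertex_coef f)) (fock_matrix \<sigma> (vertex_coef h))"
      by (simp add: opalg_simps c0_algebra_def mprod_fock_matrix path_conv_vertex_vertex)
    fix c
    show "fock_matrix \<sigma> (vertex_coef (vscale (c0_algebra \<Omega>) c f)) = vscale opalg c (fock_matrix \<sigma> (vertex_coef f))"
      by (simp add: opalg_simps c0_algebra_def fun_eq_iff fock_matrix_vertex)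
    show "fock_matrix \<sigma> (vertex_coef (vstar (c0_algebra \<Omega>) f)) = vstar opalg (fock_matrix \<sigma> (vertex_coef f))"
      by (simp add: opalg_simps c0_algebra_def fun_eq_iff fock_matrix_vertex adj_def)
  qed
  show "clinear_map (dynamical_correspondence G \<Omega> \<sigma>) opalg (\<lambda>F. fock_matrix \<sigma> (edge_coef F))"
    unfolding clinear_map_def
  proof (intro conjI ballI allI)
    show "(\<lambda>F. fock_matrix \<sigma> (edge_coef F)) \<in> carrier (dynamical_correspondence G \<Omega> \<sigma>) \<rightarrow> carrier opalg"
      using b2 by (auto simp: opalg_simps dynamical_correspondence_def)
    fix F F' :: "'a \<times> 'c \<Rightarrow> complex"
    show "fock_matrix \<sigma> (edge_coef (vadd (dynamical_correspondence G \<Omega> \<sigma>) F F')) =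
        vadd opalg (fock_matrix \<sigma> (edge_coef F)) (fock_matrix \<sigma> (edge_coef F'))"
      by (simp add: opalg_simps dynamical_correspondence_def fun_eq_iff fock_matrix_edge)
    fix c
    show "fock_matrix \<sigma> (edge_coef (vscale (dynamical_correspondence G \<Omega> \<sigma>) c F)) =
        vscale opalg c (fock_matrix \<sigma> (edge_coef F))"
      by (simp add: opalg_simps dynamical_correspondence_def fun_eq_iff fock_matrix_edge)
  qed
next
  fix f F assume "f \<in> carrier (c0_algebra \<Omega>)" "F \<in> carrier (dynamical_correspondence G \<Omega> \<sigma>)"
  show "vmult opalg (fock_matrix \<sigma> (vertex_coef f)) (fock_matrix \<sigma> (edge_coef F)) =
      fock_matrix \<sigma> (edge_coef (left_act (dynamical_correspondence G \<Omega> \<sigma>) f F))"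
    by (simp add: opalg_simps dynamical_correspondence_def mprod_fock_matrix path_conv_vertex_edge)
next
  fix F F' assume "F \<in> carrier (dynamical_correspondence G \<Omega> \<sigma>)"
  then have F: "F \<in> c0_functions (prod_topology (discrete_topology (carrier G)) \<Omega>)"
    by (simp add: dynamical_correspondence_def)
  have "mprod (adj (fock_matrix \<sigma> (edge_coef F))) (fock_matrix \<sigma> (edge_coef F'))
    = fock_matrix \<sigma> (vertex_coef (\<lambda>x. \<Sum>g\<in>carrier G. cnj (F (g, x)) * F' (g, x)))"
    using assms c0_prod_discrete_off[OF F] by (rule mprod_adj_edge)
  then show "vmult opalg (vstar opalg (fock_matrix \<sigma> (edge_coef F))) (fock_matrix \<sigma> (edge_coef F')) =
      fock_matrix \<sigma> (vertex_coef (inner_prod (dynamical_correspondence G \<Omega> \<sigma>) F F'))"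
    by (simp add: opalg_simps dynamical_correspondence_def)
qed

section \<open>Contractivity of star homomorphisms and Fejer weights\<close>

text \<open>Taking roots of order \<open>2 ^ n\<close> makes the constant \<open>K\<close> disappear
  in the limit; in the proof this is the unboundedness of the powers of \<open>a / b\<close> when
  \<open>a / b\<close> exceeds 1.\<close>

lemma le_of_iterated_squares:
  fixes a b K :: real
  assumes "0 \<le> b" "\<And>n. a ^ 2 ^ n \<le> K * b ^ 2 ^ n"
  shows "a \<le> b"
proof (rule ccontr)
  assume "\<not> a \<le> b"
  then have ab: "b < a" by simp
  show False
  proof (cases "b = 0")
    case True
    then show ?thesis using assms(2)[of 0] ab by simp
  next
    case False
    then have b: "0 < b" using assms(1) by simp
    then have q: "1 < a / b" using ab by simp
    have le: "(a / b) ^ 2 ^ n \<le> K" for n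
      using assms(2)[of n] b by (simp add: power_divide pos_divide_le_eq)
    obtain n where n: "K < (a / b) ^ n" using real_arch_pow[OF q] by blast
    have "(a / b) ^ n \<le> (a / b) ^ 2 ^ n"
      using q by (intro power_increasing) (auto simp: less_imp_le)
    with n le[of n] show False by simp
  qed
qed

context cstar_algebra
begin

lemma selfadjoint_square_norm:
  assumes "h \<in> carrier A" "vstar A h = h"
  shows "((\<lambda>s. vmult A s s) ^^ n) h \<in> carrier A"
    "vstar A (((\<lambda>s. vmult A s s) ^^ n) h) = ((\<lambda>s. vmult A s s) ^^ n) h"
    "vnorm A (((\<lambda>s. vmult A s s) ^^ n) h) = vnorm A h ^ 2 ^ n"
proof (induction n)
  case (Suc n)
  let ?s = "((\<lambda>s. vmult A s s) ^^ n) h"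
  case 1 show ?case using Suc by (simp add: mult_closed)
  case 2 show ?case using Suc by (simp add: star_mult)
  case 3
  have "vnorm A (vmult A ?s ?s) = (vnorm A ?s)\<^sup>2"
    using cstar_identity[OF Suc(1)] Suc(2) by simp
  then show ?case using Suc(3) by (simp add: mult.commute flip: power_mult)
qed (use assms in auto)

end

lemma star_hom_closed: "star_hom A B f \<Longrightarrow> x \<in> carrier A \<Longrightarrow> f x \<in> carrier B"
  and star_hom_add: "star_hom A B f \<Longrightarrow> x \<in> carrier A \<Longrightarrow> y \<in> carrier A \<Longrightarrow> f (vadd A x y) = vadd B (f x) (f y)"
  and star_hom_scale: "star_hom A B f \<Longrightarrow> x \<in> carrier A \<Longrightarrow> f (vscale A c x) = vscale B c (f x)"
  and star_hom_mult: "star_hom A B f \<Longrightarrow> x \<in> carrier A \<Longrightarrow> y \<in> carrier A \<Longrightarrow> f (vmult A x y) = vmult B (f x) (f y)"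
  and star_hom_star: "star_hom A B f \<Longrightarrow> x \<in> carrier A \<Longrightarrow> f (vstar A x) = vstar B (f x)"
  by (auto simp: star_hom_def bounded_clinear_map_def clinear_map_def)

text \<open>By definition \<open>f\<close> is bounded with some constant \<open>K\<close>. The
  C*-identity squares the norm when a self-adjoint element is squared, so the bound on all iterated
  squares of \<open>h\<close> improves the constant to 1.\<close>

lemma star_hom_contractive:
  assumes "cstar_algebra A" "cstar_algebra B" "star_hom A B f" "x \<in> carrier A"
  shows "vnorm B (f x) \<le> vnorm A x"
proof -
  interpret A: cstar_algebra A by fact
  interpret B: cstar_algebra B by fact
  obtain K where K: "\<And>x. x \<in> carrier A \<Longrightarrow> vnorm B (f x) \<le> K * vnorm A x"
    using assms(3) by (auto simp: star_hom_def bounded_clinear_map_def)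
  note closed = star_hom_closed[OF assms(3)] and mult = star_hom_mult[OF assms(3)]
    and star = star_hom_star[OF assms(3)]
  define h where "h = vmult A (vstar A x) x"
  have h: "h \<in> carrier A" "vstar A h = h"
    using assms(4) by (simp_all add: h_def A.mult_closed A.star_closed A.star_mult A.star_star)
  have fh: "f h \<in> carrier B" "vstar B (f h) = f h" using h closed star[OF h(1)] by auto
  have "f (((\<lambda>s. vmult A s s) ^^ n) h) = ((\<lambda>s. vmult B s s) ^^ n) (f h)" for n
    by (induction n) (simp_all add: mult A.selfadjoint_square_norm(1)[OF h])
  then have "vnorm B (f h) ^ 2 ^ n \<le> K * vnorm A h ^ 2 ^ n" for n
    using K[OF A.selfadjoint_square_norm(1)[OF h, of n]]
    by (simp add: A.selfadjoint_square_norm(3)[OF h] B.selfadjoint_square_norm(3)[OF fh])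
  then have "vnorm B (f h) \<le> vnorm A h"
    using A.vnorm_nonneg[OF h(1)] by (rule le_of_iterated_squares[rotated])
  moreover have "f h = vmult B (vstar B (f x)) (f x)"
    using assms(4) by (simp add: h_def mult star A.star_closed)
  ultimately have "(vnorm B (f x))\<^sup>2 \<le> (vnorm A x)\<^sup>2"
    using A.cstar_identity[OF assms(4)] B.cstar_identity[OF closed[OF assms(4)]] by (simp add: h_def)
  then show ?thesis using A.vnorm_nonneg[OF assms(4)] by (rule power2_le_imp_le)
qed

section \<open>Finite sums in carrier-based spaces\<close>

primrec vsum :: "('v, 'r) cvec_scheme \<Rightarrow> (nat \<Rightarrow> 'v) \<Rightarrow> nat \<Rightarrow> 'v" where
  "vsum V f 0 = vzero V"
| "vsum V f (Suc n) = vadd V (vsum V f n) (f n)"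

lemma vsum_cong: "(\<And>k. k < n \<Longrightarrow> f k = g k) \<Longrightarrow> vsum V f n = vsum V g n"
  by (induction n) auto

context complex_vector_space
begin

lemma vsum_closed: "(\<And>k. f k \<in> carrier V) \<Longrightarrow> vsum V f n \<in> carrier V"
  by (induction n) (auto simp: zero_closed add_closed)

lemma vsum_add:
  assumes "\<And>k. f k \<in> carrier V" "\<And>k. g k \<in> carrier V"
  shows "vsum V (\<lambda>k. vadd V (f k) (g k)) n = vadd V (vsum V f n) (vsum V g n)"
proof (induction n)
  case (Suc n)
  then show ?case using assms by (simp add: add_ac vsum_closed add_closed)
qed (simp add: add_zero_left zero_closed)

lemma vsum_scale: "(\<And>k. f k \<in> carrier V) \<Longrightarrow> vscale V c (vsum V f n) = vsum V (\<lambda>k. vscale V c (f k)) n"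
  by (induction n) (auto simp: scale_zero scale_add_right vsum_closed)

lemma vsum_scale_left: "x \<in> carrier V \<Longrightarrow> vsum V (\<lambda>k. vscale V (c k) x) n = vscale V (\<Sum>k<n. c k) x"
  by (induction n) (auto simp: scale_0 scale_add_left)

lemma vsum_zero: "vsum V (\<lambda>k. vzero V) n = vzero V"
  by (induction n) (auto simp: add_zero_left zero_closed)

lemma vsum_swap:
  assumes "\<And>j k. f j k \<in> carrier V"
  shows "vsum V (\<lambda>j. vsum V (f j) n) m = vsum V (\<lambda>k. vsum V (\<lambda>j. f j k) m) n"
proof (induction n)
  case (Suc n)
  then show ?case using assms by (simp add: vsum_add vsum_closed)
qed (simp add: vsum_zero)

lemma vsum_pad:
  assumes "\<And>k. f k \<in> carrier V" "\<And>k. n \<le> k \<Longrightarrow> f k = vzero V" "n \<le> m"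
  shows "vsum V f m = vsum V f n"
  using assms(3)
proof (induction m rule: dec_induct)
  case (step m)
  then show ?case using assms by (simp add: add_zero_right vsum_closed)
qed simp

lemma vsum_single:
  assumes "k < n" "x \<in> carrier V"
  shows "vsum V (\<lambda>j. if j = k then x else vzero V) n = x"
  using assms(1)
proof (induction n)
  case (Suc n)
  have "vsum V (\<lambda>j. if j = k then x else vzero V) k = vsum V (\<lambda>j. vzero V) k"
    by (rule vsum_cong) simp
  then show ?case using Suc assms(2)
    by (cases "k = n") (auto simp: vsum_zero add_zero_left add_zero_right)
qed simp

end

lemma (in normed_cvec) vnorm_vsum:
  "(\<And>k. f k \<in> carrier V) \<Longrightarrow> vnorm V (vsum V f n) \<le> (\<Sum>k<n. vnorm V (f k))"
proof (induction n)
  case (Suc n)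
  have "vnorm V (vsum V f (Suc n)) \<le> vnorm V (vsum V f n) + vnorm V (f n)"
    using Suc.prems by (simp add: vnorm_triangle vsum_closed)
  with Suc show ?case by fastforce
qed (simp add: vnorm_zero)

lemma clinear_map_vsum:
  assumes "complex_vector_space V" "complex_vector_space W" "clinear_map V W f" "\<And>k. q k \<in> carrier V"
  shows "f (vsum V q n) = vsum W (\<lambda>k. f (q k)) n"
proof (induction n)
  interpret V: complex_vector_space V by fact
  interpret W: complex_vector_space W by fact
  case 0
  have "f (vscale V 0 (vzero V)) = vscale W 0 (f (vzero V))"
    using assms(3) V.zero_closed unfolding clinear_map_def by blast
  moreover have "f (vzero V) \<in> carrier W"
    using assms(3) V.zero_closed unfolding clinear_map_def by blast
  ultimately show ?case
    using V.zero_closed by (simp add: V.scale_0 W.scale_0)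
next
  interpret V: complex_vector_space V by fact
  case (Suc n)
  then show ?case using assms(3,4) V.vsum_closed[of q n] by (auto simp: clinear_map_def)
qed

lemma star_hom_clinear: "star_hom A B f \<Longrightarrow> clinear_map A B f"
  by (simp add: star_hom_def bounded_clinear_map_def)

text \<open>Orthogonality of the characters of the cyclic group of order \<open>m\<close>: the sum
  is geometric with ratio \<open>r\<close>, and exponents below \<open>m\<close> make
  \<open>r = 1\<close> equivalent to \<open>a = b\<close>.\<close>

lemma sum_roots_of_unity:
  fixes m a b :: nat
  assumes "a < m" "b < m"
  defines "w \<equiv> exp (2 * of_real pi * \<i> / of_nat m)"
  shows "(\<Sum>j<m. (w ^ j) ^ a * cnj ((w ^ j) ^ b)) = (if a = b then of_nat m else 0)"
proof -
  have m: "1 \<le> m" using assms(1) by simp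
  have wk: "w ^ k = exp (2 * of_real pi * \<i> * of_nat k / of_nat m)" for k
    unfolding w_def by (simp add: mult_ac flip: exp_of_nat_mult)
  have cw: "cnj w = inverse w" unfolding w_def by (simp add: exp_cnj flip: exp_minus)
  define r where "r = w ^ a * cnj w ^ b"
  have e: "(w ^ j) ^ a * cnj ((w ^ j) ^ b) = r ^ j" for j
    by (simp add: r_def power_mult_distrib power_commutes mult.commute flip: power_mult)
  have w0: "w \<noteq> 0" by (simp add: w_def)
  have wm: "w ^ m = 1" using complex_root_unity_eq[OF m, of m 0] by (simp add: wk)
  have rm: "r ^ m = 1"
  proof -
    have "r ^ m = (w ^ m) ^ a * (cnj (w ^ m)) ^ b"
      by (simp add: r_def power_mult_distrib mult.commute flip: power_mult)
    then show ?thesis by (simp add: wm)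
  qed
  have r1: "r = 1 \<longleftrightarrow> a = b"
  proof -
    have "r = w ^ a / w ^ b" by (simp add: r_def cw power_inverse field_simps)
    then have "r = 1 \<longleftrightarrow> w ^ a = w ^ b" using w0 by simp
    also have "\<dots> \<longleftrightarrow> a mod m = b mod m" using complex_root_unity_eq[OF m, of a b] by (simp add: wk)
    finally show ?thesis using assms(1,2) by simp
  qed
  show ?thesis
  proof (cases "a = b")
    case True
    then show ?thesis unfolding e using r1 by simp
  next
    case False
    then show ?thesis unfolding e using r1 rm geometric_sum[of r m] by simp
  qed
qed

text \<open>The Fejer kernel sampled at the roots of unity of order \<open>N + d\<close>, so that no frequency below
  \<open>d\<close> is aliased.\<close>

lemma fejer_weights:
  fixes N d :: nat
  assumes "0 < N"
  shows "\<exists>(m::nat) l \<mu>. (\<forall>j. cmod (l j) = 1) \<and> (\<Sum>j<m. cmod (\<mu> j)) = 1 \<and>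
    (\<forall>k<d. (\<Sum>j<m. \<mu> j * l j ^ k) = complex_of_real (real (N - k) / real N))"
proof -
  define m where "m = N + d"
  have m: "0 < m" using assms by (simp add: m_def)
  define w where "w = exp (2 * of_real pi * \<i> / of_nat m)"
  \<comment> \<open>The Dirichlet sum; its squared modulus divided by \<open>m * N\<close> is the
    Fejer weight, normalized to total mass 1.\<close>
  define D where "D j = (\<Sum>i<N. (w ^ j) ^ i)" for j
  define \<mu> where "\<mu> j = D j * cnj (D j) / of_nat (m * N)" for j
  have fejer: "(\<Sum>j<m. \<mu> j * (w ^ j) ^ k) = of_real (real (N - k) / real N)" if k: "k < d \<or> k = 0" for k
  proof -
    have "(\<Sum>j<m. D j * cnj (D j) * (w ^ j) ^ k)
      = (\<Sum>j<m. \<Sum>i<N. \<Sum>i'<N. (w ^ j) ^ (i + k) * cnj ((w ^ j) ^ i'))"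
    proof (rule sum.cong[OF refl])
      fix j
      have "D j * cnj (D j) = (\<Sum>i<N. \<Sum>i'<N. (w ^ j) ^ i * cnj ((w ^ j) ^ i'))"
        unfolding D_def cnj_sum by (rule sum_product)
      then have "D j * cnj (D j) * (w ^ j) ^ k = (\<Sum>i<N. \<Sum>i'<N. (w ^ j) ^ i * cnj ((w ^ j) ^ i') * (w ^ j) ^ k)"
        by (simp only: sum_distrib_right)
      also have "\<dots> = (\<Sum>i<N. \<Sum>i'<N. (w ^ j) ^ (i + k) * cnj ((w ^ j) ^ i'))"
        by (intro sum.cong refl) (simp only: power_add mult_ac)
      finally show "D j * cnj (D j) * (w ^ j) ^ k = (\<Sum>i<N. \<Sum>i'<N. (w ^ j) ^ (i + k) * cnj ((w ^ j) ^ i'))" .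
    qed
    also have "\<dots> = (\<Sum>i<N. \<Sum>i'<N. \<Sum>j<m. (w ^ j) ^ (i + k) * cnj ((w ^ j) ^ i'))"
      by (subst sum.swap, rule sum.cong[OF refl], rule sum.swap)
    also have "\<dots> = (\<Sum>i<N. \<Sum>i'<N. if i + k = i' then of_nat m else 0)"
      using k unfolding w_def
      by (intro sum.cong refl sum_roots_of_unity) (auto simp: m_def)
    also have "\<dots> = (\<Sum>i<N. if i + k < N then of_nat m else 0)"
      by (intro sum.cong refl) (simp add: sum.delta)
    also have "\<dots> = (\<Sum>i\<in>{i. i < N \<and> i + k < N}. of_nat m)"
      by (simp add: sum.If_cases Int_def)
    also have "{i. i < N \<and> i + k < N} = {..<N - k}" by auto
    also have "(\<Sum>i<N - k. of_nat m) = (of_nat m * of_nat (N - k) :: complex)" by simp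
    finally have "(\<Sum>j<m. D j * cnj (D j) * (w ^ j) ^ k) = of_nat m * of_nat (N - k)" .
    moreover have "(\<Sum>j<m. \<mu> j * (w ^ j) ^ k) = (\<Sum>j<m. D j * cnj (D j) * (w ^ j) ^ k) / of_nat (m * N)"
      by (simp add: \<mu>_def sum_divide_distrib)
    ultimately show ?thesis using m assms by simp
  qed
  have norm_w: "cmod (w ^ j) = 1" for j
  proof -
    have "w = cis (2 * pi / real m)"
      by (simp add: w_def cis_conv_exp mult_ac)
    then show ?thesis by (simp add: norm_power)
  qed
  \<comment> \<open>The weights are nonnegative reals, so the sum of their moduli is the sum in
    degree 0.\<close>
  have "\<mu> j = of_real ((cmod (D j))\<^sup>2 / real (m * N))" for j
    unfolding \<mu>_def complex_norm_square[symmetric] by simp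
  then have "\<mu> j = of_real (cmod (\<mu> j))" for j
    by (metis abs_of_nonneg norm_of_real of_nat_0_le_iff zero_le_divide_iff zero_le_power2)
  then have "complex_of_real (\<Sum>j<m. cmod (\<mu> j)) = (\<Sum>j<m. \<mu> j)"
    by (metis (mono_tags, lifting) of_real_sum sum.cong)
  also have "\<dots> = 1" using fejer[of 0] assms by simp
  finally have "(\<Sum>j<m. cmod (\<mu> j)) = 1" using of_real_eq_1_iff by blast
  with fejer norm_w have "(\<forall>j. cmod (w ^ j) = 1) \<and> (\<Sum>j<m. cmod (\<mu> j)) = 1 \<and>
      (\<forall>k<d. (\<Sum>j<m. \<mu> j * (w ^ j) ^ k) = complex_of_real (real (N - k) / real N))"
    by simp
  then show ?thesis
    by (intro exI)
qed

section \<open>Coefficients and homogeneous elements of the Toeplitz algebra\<close>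

context complex_vector_space
begin

lemma sub_add_add:
  assumes "a \<in> carrier V" "b \<in> carrier V" "p \<in> carrier V" "q \<in> carrier V"
  shows "sub (vadd V a b) (vadd V p q) = vadd V (sub a p) (sub b q)"
  using assms by (simp add: scale_add_right add_ac add_closed scale_closed)

lemma sub_scale:
  assumes "a \<in> carrier V" "p \<in> carrier V"
  shows "sub (vscale V c a) (vscale V c p) = vscale V c (sub a p)"
  using assms by (simp add: scale_add_right scale_scale scale_closed mult.commute)

end

context complex_banach_algebra
begin

lemma mult_sub_left:
  assumes "a \<in> carrier A" "b \<in> carrier A" "c \<in> carrier A"
  shows "vmult A (sub a b) c = sub (vmult A a c) (vmult A b c)"
  using assms by (simp add: mult_add_left mult_scale_left scale_closed)

lemma mult_sub_right:
  assumes "a \<in> carrier A" "b \<in> carrier A" "c \<in> carrier A"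
  shows "vmult A c (sub a b) = sub (vmult A c a) (vmult A c b)"
  using assms by (simp add: mult_add_right mult_scale_right scale_closed)

lemma mult_zero_right: "x \<in> carrier A \<Longrightarrow> vmult A x (vzero A) = vzero A"
  using mult_scale_right[of x "vzero A" 0] by (simp add: scale_0 zero_closed mult_closed)

end

lemma c0_algebra_simps:
  "carrier (c0_algebra X) = c0_functions X" "vadd (c0_algebra X) = (\<lambda>f g x. f x + g x)"
  "vscale (c0_algebra X) = (\<lambda>c f x. c * f x)" "vmult (c0_algebra X) = (\<lambda>f g x. f x * g x)"
  "vstar (c0_algebra X) = (\<lambda>f x. cnj (f x))" "vzero (c0_algebra X) = (\<lambda>x. 0)"
  by (simp_all add: c0_algebra_def)

lemma dynamical_correspondence_simps:
  "carrier (dynamical_correspondence G \<Omega> \<sigma>) = c0_functions (prod_topology (discrete_topology (carrier G)) \<Omega>)"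
  "vadd (dynamical_correspondence G \<Omega> \<sigma>) = (\<lambda>F F' e. F e + F' e)"
  "vscale (dynamical_correspondence G \<Omega> \<sigma>) = (\<lambda>c F e. c * F e)"
  "left_act (dynamical_correspondence G \<Omega> \<sigma>) = (\<lambda>f F (g, x). f (\<sigma> g x) * F (g, x))"
  "inner_prod (dynamical_correspondence G \<Omega> \<sigma>) = (\<lambda>F F' x. \<Sum>g\<in>carrier G. cnj (F (g, x)) * F' (g, x))"
  by (simp_all add: dynamical_correspondence_def)

text \<open>The two universal properties have different uses: the one for path matrices provides
  \<open>fock\<close>, the one for the type of \<open>T\<close> provides the gauge action.\<close>

locale dynamical_toeplitz =
  fixes \<Omega> :: "'x topology" and G :: "('g, 'r) monoid_scheme" and \<sigma> :: "'g \<Rightarrow> 'x \<Rightarrow> 'x"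
    and T :: "'b salg" and \<pi> :: "('x \<Rightarrow> complex) \<Rightarrow> 'b" and t :: "('g \<times> 'x \<Rightarrow> complex) \<Rightarrow> 'b"
  assumes finite_G: "finite (carrier G)"
    and continuous_\<sigma>: "\<And>g. g \<in> carrier G \<Longrightarrow> continuous_map \<Omega> \<Omega> (\<sigma> g)"
    and universal_path: "universal_toeplitz_rep TYPE(('g, 'x) path_matrix)
           (c0_algebra \<Omega>) (dynamical_correspondence G \<Omega> \<sigma>) T \<pi> t"
    and universal_self: "universal_toeplitz_rep TYPE('b)
           (c0_algebra \<Omega>) (dynamical_correspondence G \<Omega> \<sigma>) T \<pi> t"
begin

abbreviation "C0 \<equiv> c0_functions \<Omega>"
abbreviation "E0 \<equiv> c0_functions (prod_topology (discrete_topology (carrier G)) \<Omega>)"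
abbreviation "X \<equiv> dynamical_correspondence G \<Omega> \<sigma>"

lemma toeplitz: "toeplitz_rep (c0_algebra \<Omega>) X T \<pi> t"
  using universal_self by (simp add: universal_toeplitz_rep_def)

sublocale cstar_algebra T
  using toeplitz by (simp add: toeplitz_rep_def)

lemma star_hom_\<pi>: "star_hom (c0_algebra \<Omega>) T \<pi>"
  using toeplitz by (simp add: toeplitz_rep_def)

lemma \<pi>_closed: "f \<in> C0 \<Longrightarrow> \<pi> f \<in> carrier T"
  and \<pi>_add: "f \<in> C0 \<Longrightarrow> h \<in> C0 \<Longrightarrow> vadd T (\<pi> f) (\<pi> h) = \<pi> (\<lambda>x. f x + h x)"
  and \<pi>_scale: "f \<in> C0 \<Longrightarrow> vscale T c (\<pi> f) = \<pi> (\<lambda>x. c * f x)"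
  and \<pi>_mult: "f \<in> C0 \<Longrightarrow> h \<in> C0 \<Longrightarrow> vmult T (\<pi> f) (\<pi> h) = \<pi> (\<lambda>x. f x * h x)"
  and \<pi>_star: "f \<in> C0 \<Longrightarrow> vstar T (\<pi> f) = \<pi> (\<lambda>x. cnj (f x))"
  using star_hom_closed[OF star_hom_\<pi>, of f] star_hom_add[OF star_hom_\<pi>, of f h]
    star_hom_scale[OF star_hom_\<pi>, of f c] star_hom_mult[OF star_hom_\<pi>, of f h]
    star_hom_star[OF star_hom_\<pi>, of f]
  by (simp_all add: c0_algebra_simps)

lemma t_closed: "F \<in> E0 \<Longrightarrow> t F \<in> carrier T"
  and t_add: "F \<in> E0 \<Longrightarrow> F' \<in> E0 \<Longrightarrow> vadd T (t F) (t F') = t (\<lambda>e. F e + F' e)"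
  and t_scale: "F \<in> E0 \<Longrightarrow> vscale T c (t F) = t (\<lambda>e. c * F e)"
  and \<pi>_t: "f \<in> C0 \<Longrightarrow> F \<in> E0 \<Longrightarrow> vmult T (\<pi> f) (t F) = t (\<lambda>(g, x). f (\<sigma> g x) * F (g, x))"
  and star_t_t: "F \<in> E0 \<Longrightarrow> F' \<in> E0 \<Longrightarrow>
    vmult T (vstar T (t F)) (t F') = \<pi> (\<lambda>x. \<Sum>g\<in>carrier G. cnj (F (g, x)) * F' (g, x))"
  using toeplitz unfolding toeplitz_rep_def clinear_map_def
  by (auto simp: c0_algebra_simps dynamical_correspondence_simps)

lemma inner_closed:
  assumes "F \<in> E0" "F' \<in> E0"
  shows "(\<lambda>x. \<Sum>g\<in>carrier G. cnj (F (g, x)) * F' (g, x)) \<in> C0"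
  by (intro c0_sum c0_mult c0_cnj c0_prod_discrete_slice[OF assms(1)] c0_prod_discrete_slice[OF assms(2)])

lemma left_act_closed:
  assumes "f \<in> C0" "F \<in> E0"
  shows "(\<lambda>(g, x). f (\<sigma> g x) * F (g, x)) \<in> E0"
proof (rule c0_prod_discreteI[OF finite_G])
  show "(case (g, x) of (g, x) \<Rightarrow> f (\<sigma> g x) * F (g, x)) = 0" if "g \<notin> carrier G" for g x
    using c0_prod_discrete_off[OF assms(2) that] by simp
  fix g assume g: "g \<in> carrier G"
  have "continuous_map \<Omega> euclidean (\<lambda>x. f (\<sigma> g x))"
    using continuous_map_compose[OF continuous_\<sigma>[OF g] c0_continuous[OF assms(1)]] by (simp add: o_def)
  then have "(\<lambda>x. f (\<sigma> g x) * F (g, x)) \<in> C0"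
    using c0_norm_upper[OF assms(1)] c0_prod_discrete_slice[OF assms(2) g] by (rule c0_mult_bounded)
  then show "(\<lambda>x. case (g, x) of (g, x) \<Rightarrow> f (\<sigma> g x) * F (g, x)) \<in> C0" by simp
qed

definition fock :: "'b \<Rightarrow> ('g, 'x) path_matrix" where
  "fock = (SOME \<phi>. star_hom T opalg \<phi> \<and> (\<forall>f\<in>C0. \<phi> (\<pi> f) = fock_matrix \<sigma> (vertex_coef f)) \<and>
    (\<forall>F\<in>E0. \<phi> (t F) = fock_matrix \<sigma> (edge_coef F)))"

lemma fock: "star_hom T opalg fock \<and> (\<forall>f\<in>C0. fock (\<pi> f) = fock_matrix \<sigma> (vertex_coef f)) \<and>
    (\<forall>F\<in>E0. fock (t F) = fock_matrix \<sigma> (edge_coef F))"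
proof -
  have "\<exists>!\<phi>. \<phi> \<in> extensional (carrier T) \<and> star_hom T opalg \<phi> \<and>
        (\<forall>a\<in>carrier (c0_algebra \<Omega>). \<phi> (\<pi> a) = fock_matrix \<sigma> (vertex_coef a)) \<and>
        (\<forall>\<xi>\<in>carrier X. \<phi> (t \<xi>) = fock_matrix \<sigma> (edge_coef \<xi>))"
    using universal_path toeplitz_rep_fock[OF finite_G, of \<Omega> \<sigma>] unfolding universal_toeplitz_rep_def by blast
  then have "\<exists>\<phi>. star_hom T opalg \<phi> \<and> (\<forall>f\<in>C0. \<phi> (\<pi> f) = fock_matrix \<sigma> (vertex_coef f)) \<and>
    (\<forall>F\<in>E0. \<phi> (t F) = fock_matrix \<sigma> (edge_coef F))"
    unfolding c0_algebra_simps dynamical_correspondence_simps by blast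
  then show ?thesis unfolding fock_def by (rule someI_ex)
qed

lemma star_hom_fock: "star_hom T opalg fock"
  and fock_\<pi>: "f \<in> C0 \<Longrightarrow> fock (\<pi> f) = fock_matrix \<sigma> (vertex_coef f)"
  and fock_t: "F \<in> E0 \<Longrightarrow> fock (t F) = fock_matrix \<sigma> (edge_coef F)"
  using fock by auto

lemma fock_add: "a \<in> carrier T \<Longrightarrow> b \<in> carrier T \<Longrightarrow> fock (vadd T a b) p q = fock a p q + fock b p q"
  and fock_scale: "a \<in> carrier T \<Longrightarrow> fock (vscale T c a) p q = c * fock a p q"
  and fock_mult: "a \<in> carrier T \<Longrightarrow> b \<in> carrier T \<Longrightarrow> fock (vmult T a b) = mprod (fock a) (fock b)"
  and fock_star: "a \<in> carrier T \<Longrightarrow> fock (vstar T a) = adj (fock a)"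
  using star_hom_add[OF star_hom_fock] star_hom_scale[OF star_hom_fock] star_hom_mult[OF star_hom_fock]
    star_hom_star[OF star_hom_fock]
  by (simp_all add: opalg_simps)

lemma opbound_fock: "a \<in> carrier T \<Longrightarrow> opbound (fock a) (vnorm T a)"
proof -
  assume a: "a \<in> carrier T"
  obtain K where "opbound (fock a) K"
    using star_hom_closed[OF star_hom_fock a] by (auto simp: opalg_simps)
  moreover have "opnorm (fock a) \<le> vnorm T a"
    using star_hom_contractive[OF cstar_algebra_axioms opalg_cstar_algebra star_hom_fock a]
    by (simp add: opalg_simps)
  ultimately show ?thesis using opbound_opnorm opbound_mono by blast
qed

lemma fock_entry: "a \<in> carrier T \<Longrightarrow> cmod (fock a p q) \<le> vnorm T a"
  by (rule opbound_entry[OF opbound_fock])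

lemma fock_sub: "a \<in> carrier T \<Longrightarrow> b \<in> carrier T \<Longrightarrow> fock (sub a b) p q = fock a p q - fock b p q"
  by (simp add: fock_add fock_scale scale_closed)

text \<open>Multiplying \<open>t\<close> by \<open>l\<close> gives another Toeplitz representation
  in \<open>T\<close>, because \<open>l * cnj l = 1\<close> leaves the inner products unchanged;
  universality supplies the homomorphism.\<close>

lemma gauge_exists:
  assumes "cmod l = 1"
  shows "\<exists>\<gamma>. star_hom T T \<gamma> \<and> (\<forall>f\<in>C0. \<gamma> (\<pi> f) = \<pi> f) \<and> (\<forall>F\<in>E0. \<gamma> (t F) = vscale T l (t F))"
proof -
  have ll: "l * cnj l = 1"
    using assms complex_norm_square[of l] by simp
  have "toeplitz_rep (c0_algebra \<Omega>) X T \<pi> (\<lambda>F. vscale T l (t F))"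
    unfolding toeplitz_rep_def clinear_map_def c0_algebra_simps dynamical_correspondence_simps
  proof (intro conjI ballI allI)
    show "cstar_algebra T" by (rule cstar_algebra_axioms)
    show "star_hom (c0_algebra \<Omega>) T \<pi>" by (rule star_hom_\<pi>)
    show "(\<lambda>F. vscale T l (t F)) \<in> E0 \<rightarrow> carrier T" by (simp add: t_closed scale_closed)
    fix F F' assume F: "F \<in> E0" "F' \<in> E0"
    show "vscale T l (t (\<lambda>e. F e + F' e)) = vadd T (vscale T l (t F)) (vscale T l (t F'))"
      using F by (simp add: scale_add_right t_closed flip: t_add)
    show "vmult T (vstar T (vscale T l (t F))) (vscale T l (t F')) =
        \<pi> (\<lambda>x. \<Sum>g\<in>carrier G. cnj (F (g, x)) * F' (g, x))"
    proof -
      have "vmult T (vstar T (vscale T l (t F))) (vscale T l (t F')) =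
          vscale T (l * cnj l) (vmult T (vstar T (t F)) (t F'))"
        using F by (simp add: star_scale mult_scale_left mult_scale_right t_closed scale_closed star_closed
            mult_closed scale_scale)
      then show ?thesis unfolding ll using F by (simp add: star_t_t scale_one \<pi>_closed inner_closed)
    qed
  next
    fix F c assume "F \<in> E0"
    then show "vscale T l (t (\<lambda>e. c * F e)) = vscale T c (vscale T l (t F))"
      by (simp add: scale_scale t_closed mult.commute flip: t_scale)
  next
    fix f F assume "f \<in> C0" "F \<in> E0"
    then show "vmult T (\<pi> f) (vscale T l (t F)) = vscale T l (t (\<lambda>(g, x). f (\<sigma> g x) * F (g, x)))"
      by (simp add: mult_scale_right \<pi>_closed t_closed \<pi>_t)
  qed
  then have "\<exists>!\<phi>. \<phi> \<in> extensional (carrier T) \<and> star_hom T T \<phi> \<and>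
        (\<forall>a\<in>carrier (c0_algebra \<Omega>). \<phi> (\<pi> a) = \<pi> a) \<and>
        (\<forall>\<xi>\<in>carrier X. \<phi> (t \<xi>) = vscale T l (t \<xi>))"
    using universal_self unfolding universal_toeplitz_rep_def by blast
  then show ?thesis unfolding c0_algebra_simps dynamical_correspondence_simps by blast
qed

section \<open>The tensor algebra and the coefficients of its elements\<close>

definition tensor :: "'b set" where
  "tensor = closed_algebra_generated T (\<pi> ` C0 \<union> t ` E0)"

lemma tensor_least: "closed_subalgebra T M \<Longrightarrow> \<pi> ` C0 \<subseteq> M \<Longrightarrow> t ` E0 \<subseteq> M \<Longrightarrow> tensor \<subseteq> M"
  unfolding tensor_def closed_algebra_generated_def by blast

lemma tensor_subset: "tensor \<subseteq> carrier T"
  by (rule tensor_least)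
    (auto simp: closed_subalgebra_def zero_closed add_closed mult_closed scale_closed \<pi>_closed t_closed)

lemma tensor_carrier: "a \<in> tensor \<Longrightarrow> a \<in> carrier T"
  using tensor_subset by blast

lemma tensor_zero: "vzero T \<in> tensor"
  and tensor_add: "a \<in> tensor \<Longrightarrow> b \<in> tensor \<Longrightarrow> vadd T a b \<in> tensor"
  and tensor_mult: "a \<in> tensor \<Longrightarrow> b \<in> tensor \<Longrightarrow> vmult T a b \<in> tensor"
  and tensor_scale: "a \<in> tensor \<Longrightarrow> vscale T c a \<in> tensor"
  and tensor_\<pi>: "f \<in> C0 \<Longrightarrow> \<pi> f \<in> tensor"
  and tensor_t: "F \<in> E0 \<Longrightarrow> t F \<in> tensor"
  unfolding tensor_def closed_algebra_generated_def closed_subalgebra_def by blast+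

text \<open>The columns of the empty paths hold the coefficients; by \<open>fock_tensor\<close> the
  other columns only repeat them.\<close>

definition coef :: "'b \<Rightarrow> 'g list \<Rightarrow> 'x \<Rightarrow> complex" where
  "coef a w x = fock a (w, x) ([], x)"

lemma coef_bound: "a \<in> carrier T \<Longrightarrow> cmod (coef a w x) \<le> vnorm T a"
  unfolding coef_def by (rule fock_entry)

lemma coef_add: "a \<in> carrier T \<Longrightarrow> b \<in> carrier T \<Longrightarrow> coef (vadd T a b) w x = coef a w x + coef b w x"
  and coef_scale: "a \<in> carrier T \<Longrightarrow> coef (vscale T c a) w x = c * coef a w x"
  by (simp_all add: coef_def fock_add fock_scale)

lemma coef_eqI: "fock a = fock_matrix \<sigma> c \<Longrightarrow> coef a = c"
  by (intro ext) (simp add: coef_def)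

text \<open>The form \<open>fock_matrix\<close> survives sums, products and limits. In a limit, the
  entry leading from \<open>v\<close> to \<open>u @ v\<close> is compared with the one leading from
  the empty path at the end of \<open>v\<close> to \<open>u\<close>.\<close>

lemma fock_tensor:
  assumes "a \<in> tensor"
  shows "fock a = fock_matrix \<sigma> (coef a)"
proof -
  let ?M = "{a \<in> carrier T. \<exists>c. fock a = fock_matrix \<sigma> c}"
  have M_eq: "fock a = fock_matrix \<sigma> (coef a)" if "a \<in> ?M" for a
    using that coef_eqI by auto
  have "closed_subalgebra T ?M"
    unfolding closed_subalgebra_def
  proof (intro conjI ballI allI)
    have "fock (vzero T) = (\<lambda>p q. 0)"
      using fock_scale[OF zero_closed, of 0] by (intro ext) (simp add: scale_0 zero_closed)
    then have "fock (vzero T) = fock_matrix \<sigma> (\<lambda>w x. 0)" by (simp add: fock_matrix_def fun_eq_iff)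
    then show "vzero T \<in> ?M" using zero_closed by blast
  next
    fix a b assume a: "a \<in> ?M" and b: "b \<in> ?M"
    then obtain c d where cd: "fock a = fock_matrix \<sigma> c" "fock b = fock_matrix \<sigma> d" by blast
    have "fock (vadd T a b) = fock_matrix \<sigma> (\<lambda>w x. c w x + d w x)"
      using a b by (intro ext) (simp add: fock_add cd flip: fock_matrix_add)
    then show "vadd T a b \<in> ?M" using a b add_closed by blast
    have "fock (vmult T a b) = fock_matrix \<sigma> (path_conv \<sigma> c d)"
      using a b by (simp add: fock_mult cd mprod_fock_matrix)
    then show "vmult T a b \<in> ?M" using a b mult_closed by blast
  next
    fix e a assume a: "a \<in> ?M"
    then obtain c where c: "fock a = fock_matrix \<sigma> c" by blast
    have "fock (vscale T e a) = fock_matrix \<sigma> (\<lambda>w x. e * c w x)"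
      using a by (intro ext) (simp add: fock_scale c flip: fock_matrix_scale)
    then show "vscale T e a \<in> ?M" using a scale_closed by blast
  next
    show "closedin mtopology ?M"
    proof (rule closedin_norm_topologyI)
      fix a assume a: "a \<in> carrier T" and lim: "\<And>e. 0 < e \<Longrightarrow> \<exists>b\<in>?M. vnorm T (sub a b) < e"
      have "fock a p q = fock_matrix \<sigma> (coef a) p q" for p q
      proof -
        have "cmod (fock a p q - fock_matrix \<sigma> (coef a) p q) \<le> 0 + e" if e: "0 < e" for e
        proof -
          obtain b where b: "b \<in> ?M" "vnorm T (sub a b) < e / 2" using lim[of "e / 2"] e by auto
          have bc: "b \<in> carrier T" using b by blast
          have 1: "cmod (fock a p q - fock b p q) \<le> e / 2" for p q
            using fock_entry[OF sub_closed[OF a bc], of p q] b(2) fock_sub[OF a bc] by simp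
          have 2: "cmod (fock_matrix \<sigma> (coef b) p q - fock_matrix \<sigma> (coef a) p q) \<le> e / 2"
          proof (cases rule: fock_matrix_cases[where p = p and q = q and \<sigma> = \<sigma>])
            case (path u v x)
            then show ?thesis
              using 1[of "(u, foldr \<sigma> v x)" "([], foldr \<sigma> v x)"] by (simp add: coef_def norm_minus_commute)
          next
            case other
            then show ?thesis using e by simp
          qed
          have "fock a p q - fock_matrix \<sigma> (coef a) p q = (fock a p q - fock b p q)
              + (fock_matrix \<sigma> (coef b) p q - fock_matrix \<sigma> (coef a) p q)"
            using M_eq[OF b(1)] by simp
          also have "cmod \<dots> \<le> e / 2 + e / 2"
            by (rule order_trans[OF norm_triangle_ineq add_mono[OF 1 2]])
          finally show ?thesis by simp
        qed
        then have "cmod (fock a p q - fock_matrix \<sigma> (coef a) p q) \<le> 0" by (rule field_le_epsilon)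
        then show ?thesis by simp
      qed
      then have "fock a = fock_matrix \<sigma> (coef a)" by blast
      with a show "a \<in> ?M" by blast
    qed blast
  qed
  then have "tensor \<subseteq> ?M"
    by (rule tensor_least) (auto simp: \<pi>_closed t_closed fock_\<pi> fock_t)
  with M_eq assms show ?thesis by blast
qed

lemma coef_mult:
  assumes "a \<in> tensor" "b \<in> tensor"
  shows "coef (vmult T a b) = path_conv \<sigma> (coef a) (coef b)"
proof (rule coef_eqI)
  show "fock (vmult T a b) = fock_matrix \<sigma> (path_conv \<sigma> (coef a) (coef b))"
    using fock_tensor[OF assms(1)] fock_tensor[OF assms(2)] assms tensor_carrier
    by (metis fock_mult mprod_fock_matrix)
qed

text \<open>Sums of right-nested products of \<open>t F\<close> that end in a single generator. The
  rule \<open>edge\<close> is separate because \<open>C0\<close> need not contain a unit with which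
  to end the product.\<close>

inductive homog :: "nat \<Rightarrow> 'b \<Rightarrow> bool" where
  vertex: "f \<in> C0 \<Longrightarrow> homog 0 (\<pi> f)"
| edge: "F \<in> E0 \<Longrightarrow> homog (Suc 0) (t F)"
| step: "F \<in> E0 \<Longrightarrow> homog k p \<Longrightarrow> homog (Suc k) (vmult T (t F) p)"
| add: "homog k p \<Longrightarrow> homog k q \<Longrightarrow> homog k (vadd T p q)"

lemma homog_carrier: "homog k p \<Longrightarrow> p \<in> carrier T"
  by (induction rule: homog.induct) (auto simp: \<pi>_closed t_closed mult_closed add_closed)

lemma homog_scale: "homog k p \<Longrightarrow> homog k (vscale T c p)"
proof (induction rule: homog.induct)
  case (vertex f)
  then show ?case using homog.vertex[OF c0_scale[OF vertex, of c]] by (simp add: \<pi>_scale)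
next
  case (edge F)
  then show ?case using homog.edge[OF c0_scale[OF edge, of c]] by (simp add: t_scale)
next
  case (step F k p)
  then show ?case
    using homog.step[of F k "vscale T c p"] by (simp add: mult_scale_right t_closed homog_carrier)
next
  case (add k p q)
  then show ?case using homog.add by (simp add: scale_add_right homog_carrier)
qed

lemma homog_left_mult: "homog k p \<Longrightarrow> f \<in> C0 \<Longrightarrow> homog k (vmult T (\<pi> f) p)"
proof (induction rule: homog.induct)
  case (vertex h)
  then show ?case using homog.vertex[OF c0_mult[of f \<Omega> h]] by (simp add: \<pi>_mult)
next
  case (edge F)
  then show ?case using homog.edge[OF left_act_closed[of f F]] by (simp add: \<pi>_t)
next
  case (step F k p)
  then show ?case
    using homog.step[OF left_act_closed[of f F]] by (simp add: \<pi>_closed t_closed homog_carrier \<pi>_t flip: mult_assoc)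
next
  case (add k p q)
  then show ?case using homog.add by (simp add: mult_add_right homog_carrier \<pi>_closed)
qed

lemma homog_mult: "homog j p \<Longrightarrow> homog k q \<Longrightarrow> homog (j + k) (vmult T p q)"
proof (induction rule: homog.induct)
  case (vertex f)
  then show ?case by (simp add: homog_left_mult)
next
  case (edge F)
  then show ?case using homog.step by simp
next
  case (step F j p)
  then show ?case using homog.step[of F "j + k"] by (simp add: t_closed homog_carrier mult_assoc)
next
  case (add j p p')
  then show ?case using homog.add by (simp add: mult_add_left homog_carrier)
qed

lemma homog_zero: "homog k (vzero T)"
proof (induction k)
  case 0
  show ?case using homog_scale[OF homog.vertex[OF c0_zero], of 0] by (simp add: scale_0 \<pi>_closed c0_zero)
next
  case (Suc k)
  show ?case using homog.step[OF c0_zero Suc] by (simp add: mult_zero_right t_closed c0_zero)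
qed

lemma homog_0: "homog 0 p \<Longrightarrow> p \<in> \<pi> ` C0"
proof (induction "0::nat" p rule: homog.induct)
  case (add p q)
  then show ?case by (auto simp: \<pi>_add intro: c0_add)
qed auto

lemma homog_Suc_induct [consumes 1, case_names edge step add]:
  assumes "homog (Suc k) p"
    and "\<And>F. k = 0 \<Longrightarrow> F \<in> E0 \<Longrightarrow> P (t F)"
    and "\<And>F p. F \<in> E0 \<Longrightarrow> homog k p \<Longrightarrow> P (vmult T (t F) p)"
    and "\<And>p q. p \<in> carrier T \<Longrightarrow> q \<in> carrier T \<Longrightarrow> P p \<Longrightarrow> P q \<Longrightarrow> P (vadd T p q)"
  shows "P p"
  using assms(1)
  by (induction "Suc k" p rule: homog.induct) (auto intro: assms(2-4) homog_carrier)

lemma \<pi>_image_add: "a \<in> \<pi> ` C0 \<Longrightarrow> b \<in> \<pi> ` C0 \<Longrightarrow> vadd T a b \<in> \<pi> ` C0"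
  by (auto simp: \<pi>_add intro: c0_add)

text \<open>Where the two products meet, \<open>star_t_t\<close> turns the adjacent edge factors
  into a function, which the next factor absorbs from the left by \<open>homog_left_mult\<close>.
  Repeating this uses up all edges.\<close>

lemma homog_star_mult: "homog k p \<Longrightarrow> homog k q \<Longrightarrow> vmult T (vstar T p) q \<in> \<pi> ` C0"
proof (induction k arbitrary: p q)
  case 0
  then obtain f h where "f \<in> C0" "p = \<pi> f" "h \<in> C0" "q = \<pi> h" using homog_0 by blast
  then show ?case by (auto simp: \<pi>_star \<pi>_mult c0_cnj intro!: imageI c0_mult)
next
  case (Suc k)
  have mid: "vmult T (vstar T (t F)) (vmult T (t F') q) \<in> {vmult T (\<pi> f) q |f. f \<in> C0}"
    if "F \<in> E0" "F' \<in> E0" "q \<in> carrier T" for F F' q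
    using that inner_closed[of F F'] by (auto simp: star_closed t_closed star_t_t simp flip: mult_assoc)
  show ?case using Suc.prems(1)
  proof (induction p rule: homog_Suc_induct)
    case (edge F)
    show ?case using Suc.prems(2)
    proof (induction q rule: homog_Suc_induct)
      case (edge F')
      then show ?case using \<open>F \<in> E0\<close> by (simp add: star_t_t inner_closed)
    next
      case (step F' q)
      then obtain h where "h \<in> C0" "q = \<pi> h" using homog_0 \<open>k = 0\<close> by blast
      with mid[of F F' q] step \<open>F \<in> E0\<close> show ?case by (auto simp: \<pi>_closed \<pi>_mult intro: c0_mult)
    next
      case (add q q')
      then show ?case using \<open>F \<in> E0\<close>
        by (simp add: mult_add_right star_closed t_closed \<pi>_image_add)
    qed
  next
    case (step F p)
    note p = homog_carrier[OF \<open>homog k p\<close>]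
    show ?case using Suc.prems(2)
    proof (induction q rule: homog_Suc_induct)
      case (edge F')
      then obtain h where h: "h \<in> C0" "p = \<pi> h" using homog_0 \<open>homog k p\<close> by blast
      have "vmult T (vstar T (vmult T (t F) p)) (t F') = vmult T (vstar T p) (vmult T (vstar T (t F)) (t F'))"
        using p edge step by (simp add: star_mult mult_assoc star_closed t_closed)
      then show ?case using h edge step
        by (simp add: star_t_t inner_closed \<pi>_star \<pi>_mult c0_cnj c0_mult)
    next
      case (step F' q)
      note q = homog_carrier[OF \<open>homog k q\<close>]
      obtain f where f: "f \<in> C0" "vmult T (vstar T (t F)) (vmult T (t F') q) = vmult T (\<pi> f) q"
        using mid[OF \<open>F \<in> E0\<close> \<open>F' \<in> E0\<close> q] by blast
      have "vmult T (vstar T (vmult T (t F) p)) (vmult T (t F') q)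
        = vmult T (vstar T p) (vmult T (vstar T (t F)) (vmult T (t F') q))"
        using p q \<open>F \<in> E0\<close> \<open>F' \<in> E0\<close> by (simp add: star_mult mult_assoc star_closed t_closed mult_closed)
      then show ?case using Suc.IH[OF \<open>homog k p\<close> homog_left_mult[OF \<open>homog k q\<close> f(1)]] f(2) by simp
    next
      case (add q q')
      then show ?case using \<open>F \<in> E0\<close> p
        by (simp add: mult_add_right star_closed t_closed mult_closed \<pi>_image_add)
    qed
  next
    case (add p p')
    then show ?case using homog_carrier[OF Suc.prems(2)]
      by (simp add: star_add mult_add_left star_closed \<pi>_image_add)
  qed
qed

lemma homog_coef: "homog k p \<Longrightarrow> length w \<noteq> k \<Longrightarrow> coef p w x = 0"
  and homog_fock: "homog k p \<Longrightarrow> fock p = fock_matrix \<sigma> (coef p)"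
proof -
  have *: "\<exists>c. fock p = fock_matrix \<sigma> c \<and> (\<forall>w x. length w \<noteq> k \<longrightarrow> c w x = 0)" if "homog k p"
    using that
  proof (induction rule: homog.induct)
    case (vertex f)
    then show ?case
      by (intro exI[of _ "vertex_coef f"] conjI) (rule fock_\<pi>, simp_all add: vertex_coef_def)
  next
    case (edge F)
    then show ?case
      by (intro exI[of _ "edge_coef F"] conjI) (rule fock_t, simp_all add: edge_coef_def)
  next
    case (step F k p)
    then obtain c where c: "fock p = fock_matrix \<sigma> c" "\<And>w x. length w \<noteq> k \<Longrightarrow> c w x = 0" by blast
    have "fock (vmult T (t F) p) = fock_matrix \<sigma> (path_conv \<sigma> (edge_coef F) c)"
      using step c by (simp add: fock_mult t_closed homog_carrier fock_t mprod_fock_matrix)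
    moreover have "path_conv \<sigma> (edge_coef F) c w x = 0" if "length w \<noteq> Suc k" for w x
      by (rule path_conv_degree[where m = 1 and n = k]) (use that c in \<open>auto simp: edge_coef_def\<close>)
    ultimately show ?case by blast
  next
    case (add k p q)
    then obtain c d where c: "fock p = fock_matrix \<sigma> c" "\<And>w x. length w \<noteq> k \<Longrightarrow> c w x = 0"
      and d: "fock q = fock_matrix \<sigma> d" "\<And>w x. length w \<noteq> k \<Longrightarrow> d w x = 0" by blast
    have "fock (vadd T p q) = fock_matrix \<sigma> (\<lambda>w x. c w x + d w x)"
      using add by (intro ext) (simp add: fock_add homog_carrier c(1) d(1) flip: fock_matrix_add)
    then show ?case using c(2) d(2) by (intro exI[of _ "\<lambda>w x. c w x + d w x"]) simp
  qed
  show "homog k p \<Longrightarrow> fock p = fock_matrix \<sigma> (coef p)" using * coef_eqI by blast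
  show "homog k p \<Longrightarrow> length w \<noteq> k \<Longrightarrow> coef p w x = 0" using * coef_eqI by blast
qed

lemma homog_gauge:
  assumes "star_hom T T \<gamma>" "\<forall>f\<in>C0. \<gamma> (\<pi> f) = \<pi> f" "\<forall>F\<in>E0. \<gamma> (t F) = vscale T l (t F)"
  shows "homog k p \<Longrightarrow> \<gamma> p = vscale T (l ^ k) p"
proof (induction rule: homog.induct)
  case (vertex f)
  then show ?case using assms(2) by (simp add: scale_one \<pi>_closed)
next
  case (edge F)
  then show ?case using assms(3) by simp
next
  case (step F k p)
  then show ?case
    using assms(3) star_hom_mult[OF assms(1)]
    by (simp add: t_closed homog_carrier mult_scale_left mult_scale_right mult_closed scale_closed scale_scale
        power_commutes)
next
  case (add k p q)
  then show ?case using star_hom_add[OF assms(1)] by (simp add: homog_carrier scale_add_right)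
qed

end

section \<open>Elements of the tensor algebra are determined by their coefficients\<close>

context dynamical_toeplitz
begin

text \<open>The product \<open>p\<^sup>* p\<close> is some \<open>\<pi> f\<close>, and
  \<open>f x\<close> is the squared norm of the column of \<open>fock p\<close> at the empty path at
  \<open>x\<close>. So these columns control the norm of \<open>p\<close>, although
  \<open>fock\<close> is not known to be isometric.\<close>

lemma homog_norm:
  obtains K where "0 \<le> K"
    "\<And>k p R. homog k p \<Longrightarrow> (\<And>x. l2_bounded (\<lambda>m. fock p m ([], x)) R) \<Longrightarrow> vnorm T p \<le> K * R"
proof -
  obtain K where K: "\<And>f. f \<in> C0 \<Longrightarrow> vnorm T (\<pi> f) \<le> K * vnorm (c0_algebra \<Omega>) f"
    using star_hom_\<pi> by (auto simp: star_hom_def bounded_clinear_map_def c0_algebra_simps)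
  have "vnorm T p \<le> sqrt \<bar>K\<bar> * R"
    if p: "homog k p" and R: "\<And>x. l2_bounded (\<lambda>m. fock p m ([], x)) R" for k p R
  proof -
    note pc = homog_carrier[OF p]
    obtain f where f: "f \<in> C0" "vmult T (vstar T p) p = \<pi> f" using homog_star_mult[OF p p] by blast
    have R0: "0 \<le> R" using l2_bounded_nonneg[OF R] .
    have "cmod (f x) \<le> R\<^sup>2" for x
    proof -
      have "f x = fock (\<pi> f) ([], x) ([], x)" using f(1) by (simp add: fock_\<pi> vertex_coef_def)
      also have "\<dots> = mprod (adj (fock p)) (fock p) ([], x) ([], x)"
        using pc by (simp add: fock_mult fock_star star_closed flip: f(2))
      also have "\<dots> = dot (\<lambda>m. cnj (fock p m ([], x))) (\<lambda>m. fock p m ([], x))"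
        by (simp add: mprod_def dot_def adj_def)
      finally have "f x = dot (\<lambda>m. cnj (fock p m ([], x))) (\<lambda>m. fock p m ([], x))" .
      moreover have "l2_bounded (\<lambda>m. cnj (fock p m ([], x))) R"
        using R[of x] by (simp add: l2_bounded_def)
      ultimately show ?thesis using abs_summable_dot(2)[OF _ R[of x]] by (simp add: power2_eq_square)
    qed
    then have fR: "vnorm (c0_algebra \<Omega>) f \<le> R\<^sup>2" by (rule c0_norm_least)
    have f0: "0 \<le> vnorm (c0_algebra \<Omega>) f"
      using c0_norm_upper[OF f(1)] norm_ge_zero order_trans by blast
    have "(vnorm T p)\<^sup>2 = vnorm T (\<pi> f)" using cstar_identity[OF pc] f(2) by simp
    also have "\<dots> \<le> K * vnorm (c0_algebra \<Omega>) f" by (rule K[OF f(1)])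
    also have "\<dots> \<le> \<bar>K\<bar> * vnorm (c0_algebra \<Omega>) f" using f0 by (intro mult_right_mono) auto
    also have "\<dots> \<le> \<bar>K\<bar> * R\<^sup>2" using fR by (intro mult_left_mono) auto
    also have "\<dots> = (sqrt \<bar>K\<bar> * R)\<^sup>2" by (simp add: power_mult_distrib)
    finally show ?thesis by (rule power2_le_imp_le) (simp add: R0)
  qed
  then show thesis using that[of "sqrt \<bar>K\<bar>"] by simp
qed

section \<open>Polynomials in the generators and their homogeneous components\<close>

inductive graded_poly :: "'b \<Rightarrow> bool" where
  homog: "homog k p \<Longrightarrow> graded_poly p"
| add: "graded_poly p \<Longrightarrow> graded_poly q \<Longrightarrow> graded_poly (vadd T p q)"

lemma graded_poly_carrier: "graded_poly p \<Longrightarrow> p \<in> carrier T"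
  by (induction rule: graded_poly.induct) (auto simp: homog_carrier add_closed)

lemma graded_poly_scale: "graded_poly p \<Longrightarrow> graded_poly (vscale T c p)"
proof (induction rule: graded_poly.induct)
  case (homog k p)
  then show ?case by (intro graded_poly.homog homog_scale)
next
  case (add p q)
  then show ?case by (simp add: scale_add_right graded_poly_carrier graded_poly.add)
qed

lemma graded_poly_mult: "graded_poly p \<Longrightarrow> graded_poly q \<Longrightarrow> graded_poly (vmult T p q)"
proof (induction rule: graded_poly.induct)
  case (homog k p)
  show ?case using homog(2)
  proof (induction rule: graded_poly.induct)
    case (homog j q)
    then show ?case using homog_mult[OF \<open>homog k p\<close>] graded_poly.homog by blast
  next
    case (add q q')
    then show ?case
      by (simp add: mult_add_right graded_poly_carrier homog_carrier[OF \<open>homog k p\<close>] graded_poly.add)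
  qed
next
  case (add p p')
  then show ?case by (simp add: mult_add_left graded_poly_carrier graded_poly.add)
qed

text \<open>Components are given in every degree, with zeros from \<open>d\<close> on, so that
  sequences of different lengths can be padded and added.\<close>

lemma graded_poly_components:
  assumes "graded_poly p"
  obtains d q where "\<And>k. homog k (q k)" "\<And>k. d \<le> k \<Longrightarrow> q k = vzero T" "p = vsum T q d"
proof -
  have "\<exists>d q. (\<forall>k. homog k (q k)) \<and> (\<forall>k\<ge>d. q k = vzero T) \<and> p = vsum T q d"
    using assms
  proof (induction rule: graded_poly.induct)
    case (homog k p)
    have "vsum T (\<lambda>j. if j = k then p else vzero T) (Suc k) = p"
      using homog_carrier[OF homog] by (intro vsum_single) auto
    then show ?case using homog homog_zero
      by (intro exI[of _ "Suc k"] exI[of _ "\<lambda>j. if j = k then p else vzero T"]) auto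
  next
    case (add p p')
    then obtain d q d' q' where
      q: "\<And>k. homog k (q k)" "\<And>k. d \<le> k \<Longrightarrow> q k = vzero T" "p = vsum T q d" and
      q': "\<And>k. homog k (q' k)" "\<And>k. d' \<le> k \<Longrightarrow> q' k = vzero T" "p' = vsum T q' d'" by blast
    have c: "q k \<in> carrier T" "q' k \<in> carrier T" for k
      using homog_carrier[OF q(1)] homog_carrier[OF q'(1)] by auto
    have "vsum T q (max d d') = p" "vsum T q' (max d d') = p'"
      using q q' c vsum_pad[of q d "max d d'"] vsum_pad[of q' d' "max d d'"] by auto
    then have "vadd T p p' = vsum T (\<lambda>k. vadd T (q k) (q' k)) (max d d')"
      using c by (simp add: vsum_add)
    moreover have "\<forall>k. homog k (vadd T (q k) (q' k))" using q q' homog.add by blast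
    moreover have "\<forall>k\<ge>max d d'. vadd T (q k) (q' k) = vzero T"
      using q q' by (simp add: add_zero_left zero_closed)
    ultimately show ?case
      by (intro exI[of _ "max d d'"] exI[of _ "\<lambda>k. vadd T (q k) (q' k)"] conjI)
  qed
  then show thesis using that by blast
qed

lemma graded_poly_dense:
  assumes "a \<in> tensor" "0 < e"
  shows "\<exists>p. graded_poly p \<and> vnorm T (sub a p) < e"
proof -
  let ?M = "{a \<in> carrier T. \<forall>e>0. \<exists>p. graded_poly p \<and> vnorm T (sub a p) < e}"
  have poly_in: "p \<in> ?M" if "graded_poly p" for p
    using that graded_poly_carrier[OF that] by (auto simp: sub_self vnorm_zero intro!: exI[of _ p])
  have "closed_subalgebra T ?M"
    unfolding closed_subalgebra_def
  proof (intro conjI ballI allI)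
    show "vzero T \<in> ?M" by (intro poly_in graded_poly.homog[OF homog_zero])
  next
    fix a b assume ab: "a \<in> ?M" "b \<in> ?M"
    then have c: "a \<in> carrier T" "b \<in> carrier T" by auto
    show "vadd T a b \<in> ?M"
    proof (intro CollectI conjI allI impI add_closed c)
      fix e :: real assume e: "0 < e"
      obtain p where p: "graded_poly p" "vnorm T (sub a p) < e / 2" using ab(1) half_gt_zero[OF e] by blast
      obtain q where q: "graded_poly q" "vnorm T (sub b q) < e / 2" using ab(2) half_gt_zero[OF e] by blast
      note pq = graded_poly_carrier[OF p(1)] graded_poly_carrier[OF q(1)]
      have "vnorm T (sub (vadd T a b) (vadd T p q)) \<le> vnorm T (sub a p) + vnorm T (sub b q)"
        unfolding sub_add_add[OF c pq] using c pq by (intro vnorm_triangle sub_closed)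
      also have "\<dots> < e" using p q by simp
      finally show "\<exists>p. graded_poly p \<and> vnorm T (sub (vadd T a b) p) < e"
        using graded_poly.add[OF p(1) q(1)] by blast
    qed
    show "vmult T a b \<in> ?M"
    proof (intro CollectI conjI allI impI mult_closed c)
      fix e :: real assume e: "0 < e"
      have nb: "0 < vnorm T b + 1" using vnorm_nonneg[OF c(2)] by simp
      then have "0 < e / 2 / (vnorm T b + 1)" using e by simp
      then obtain p where p: "graded_poly p" "vnorm T (sub a p) < e / 2 / (vnorm T b + 1)" using ab(1) by blast
      note pc = graded_poly_carrier[OF p(1)]
      have np: "0 < vnorm T p + 1" using vnorm_nonneg[OF pc] by simp
      then have "0 < e / 2 / (vnorm T p + 1)" using e by simp
      then obtain q where q: "graded_poly q" "vnorm T (sub b q) < e / 2 / (vnorm T p + 1)" using ab(2) by blast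
      note qc = graded_poly_carrier[OF q(1)]
      \<comment> \<open>Write \<open>a b - p q\<close> as \<open>(a - p) b + p (b - q)\<close>. This
        is why \<open>p\<close> was chosen before \<open>q\<close>: the accuracy required of
        \<open>q\<close> depends on the norm of \<open>p\<close>.\<close>
      have eq: "sub (vmult T a b) (vmult T p q) = vadd T (vmult T (sub a p) b) (vmult T p (sub b q))"
        using c pc qc by (simp add: mult_sub_left mult_sub_right mult_closed sub_add_sub)
      have "vnorm T (vmult T (sub a p) b) < e / 2"
      proof -
        have "vnorm T (vmult T (sub a p) b) \<le> vnorm T (sub a p) * vnorm T b"
          using c pc by (intro norm_mult sub_closed)
        also have "\<dots> \<le> vnorm T (sub a p) * (vnorm T b + 1)"
          using c pc by (intro mult_left_mono) (auto simp: vnorm_nonneg sub_closed)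
        also have "\<dots> < e / 2" using p(2) nb by (simp add: pos_less_divide_eq algebra_simps)
        finally show ?thesis .
      qed
      moreover have "vnorm T (vmult T p (sub b q)) < e / 2"
      proof -
        have "vnorm T (vmult T p (sub b q)) \<le> vnorm T p * vnorm T (sub b q)"
          using c pc qc by (intro norm_mult sub_closed)
        also have "\<dots> \<le> (vnorm T p + 1) * vnorm T (sub b q)"
          using c qc by (intro mult_right_mono) (auto simp: vnorm_nonneg sub_closed)
        also have "\<dots> < e / 2" using q(2) np by (simp add: pos_less_divide_eq algebra_simps)
        finally show ?thesis .
      qed
      ultimately have "vnorm T (sub (vmult T a b) (vmult T p q)) < e"
        unfolding eq
        using vnorm_triangle[of "vmult T (sub a p) b" "vmult T p (sub b q)"] c pc qc
        by (simp add: mult_closed sub_closed)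
      then show "\<exists>p. graded_poly p \<and> vnorm T (sub (vmult T a b) p) < e"
        using graded_poly_mult[OF p(1) q(1)] by blast
    qed
  next
    fix c a assume a: "a \<in> ?M"
    then have ac: "a \<in> carrier T" by blast
    show "vscale T c a \<in> ?M"
    proof (intro CollectI conjI allI impI scale_closed ac)
      fix e :: real assume e: "0 < e"
      have nc: "0 < cmod c + 1" by (simp add: add_nonneg_pos)
      then have "0 < e / (cmod c + 1)" using e by simp
      then obtain p where p: "graded_poly p" "vnorm T (sub a p) < e / (cmod c + 1)" using a by blast
      note pc = graded_poly_carrier[OF p(1)]
      have "vnorm T (sub (vscale T c a) (vscale T c p)) = cmod c * vnorm T (sub a p)"
        unfolding sub_scale[OF ac pc] using ac pc by (intro vnorm_scale sub_closed)
      also have "\<dots> \<le> (cmod c + 1) * vnorm T (sub a p)"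
        using ac pc by (intro mult_right_mono) (auto simp: vnorm_nonneg sub_closed)
      also have "\<dots> < e" using p(2) nc by (simp add: pos_less_divide_eq mult.commute)
      finally show "\<exists>p. graded_poly p \<and> vnorm T (sub (vscale T c a) p) < e"
        using graded_poly_scale[OF p(1)] by blast
    qed
  next
    show "closedin mtopology ?M"
    proof (rule closedin_norm_topologyI)
      fix a assume a: "a \<in> carrier T" and lim: "\<And>e. 0 < e \<Longrightarrow> \<exists>b\<in>?M. vnorm T (sub a b) < e"
      show "a \<in> ?M"
      proof (intro CollectI conjI allI impI a)
        fix e :: real assume e: "0 < e"
        obtain b where b: "b \<in> ?M" "vnorm T (sub a b) < e / 2" using lim[OF half_gt_zero[OF e]] by blast
        obtain p where p: "graded_poly p" "vnorm T (sub b p) < e / 2" using b(1) half_gt_zero[OF e] by blast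
        have "vnorm T (sub a p) < e"
          using vnorm_sub_triangle[OF a _ graded_poly_carrier[OF p(1)], of b] b p by simp
        then show "\<exists>p. graded_poly p \<and> vnorm T (sub a p) < e" using p(1) by blast
      qed
    qed blast
  qed
  then have "tensor \<subseteq> ?M"
  proof (rule tensor_least)
    show "\<pi> ` C0 \<subseteq> ?M" using poly_in graded_poly.homog[OF homog.vertex] by blast
    show "t ` E0 \<subseteq> ?M" using poly_in graded_poly.homog[OF homog.edge] by blast
  qed
  with assms show ?thesis by blast
qed

lemma fock_vsum:
  assumes "\<And>k. q k \<in> carrier T"
  shows "fock (vsum T q d) m m' = (\<Sum>k<d. fock (q k) m m')"
proof (induction d)
  case 0
  have "fock (vscale T 0 (vzero T)) m m' = 0" by (subst fock_scale) (simp_all add: zero_closed)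
  then show ?case by (simp add: scale_0 zero_closed)
next
  case (Suc d)
  then show ?case using assms by (simp add: fock_add vsum_closed)
qed

text \<open>In the column of an empty path, components of different degree live on words of
  different length, so each component is a restriction of the whole column.\<close>

lemma component_column_bound:
  assumes q: "\<And>k. homog k (q k)" "\<And>k. d \<le> k \<Longrightarrow> q k = vzero T"
  shows "l2_bounded (\<lambda>m. fock (q k) m ([], x)) (opnorm (fock (vsum T q d)))"
proof -
  have qc: "q k \<in> carrier T" for k using homog_carrier[OF q(1)] .
  have deg: "fock (q j) m ([], x) = 0" if "length (fst m) \<noteq> j" for j m
    using homog_coef[OF q(1) that, of "snd m"] homog_fock[OF q(1), of j]
    by (cases m) (auto simp: fock_matrix_def)
  have z: "fock (vzero T) m m' = 0" for m m' using fock_vsum[of q 0] qc by simp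
  have entry: "cmod (fock (q k) m ([], x)) \<le> cmod (fock (vsum T q d) m ([], x))" for m
  proof (cases "length (fst m) = k \<and> k < d")
    case True
    have "fock (vsum T q d) m ([], x) = (\<Sum>j<d. if j = k then fock (q k) m ([], x) else 0)"
      unfolding fock_vsum[OF qc] using True deg by (intro sum.cong refl) auto
    then show ?thesis using True by (simp add: sum.delta)
  next
    case False
    then show ?thesis using deg[of m k] q(2)[of k] z by (cases "k < d") auto
  qed
  have "opbound (fock (vsum T q d)) (opnorm (fock (vsum T q d)))"
    by (rule opbound_opnorm[OF opbound_fock[OF vsum_closed[OF qc]]])
  from opbound_column[OF this, of "([], x)"] show ?thesis
    unfolding l2_bounded_def
    by (meson entry L2_set_mono norm_ge_zero order_trans)
qed

text \<open>The Fejer means of the gauge action are contractive and, by the norm estimate on homogeneous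
  components, take an element of the tensor algebra with small Fock image to a small element.\<close>

lemma fock_injective_on_tensor:
  assumes a: "a \<in> tensor" and zero: "\<And>w x. coef a w x = 0"
  shows "a = vzero T"
proof -
  note ac = tensor_carrier[OF a]
  obtain C where C: "0 \<le> C" "\<And>k p R. homog k p \<Longrightarrow> (\<And>x. l2_bounded (\<lambda>m. fock p m ([], x)) R) \<Longrightarrow> vnorm T p \<le> C * R"
    using homog_norm by blast
  have fock0: "fock a m m' = 0" for m m'
    using fock_tensor[OF a] zero by (simp add: fock_matrix_def)
  have "vnorm T a \<le> 0 + 5 * e" if e: "0 < e" for e
  proof -
    obtain p where p: "graded_poly p" "vnorm T (sub a p) < e" using graded_poly_dense[OF a e] by blast
    note pc = graded_poly_carrier[OF p(1)]
    obtain d q where q: "\<And>k. homog k (q k)" "\<And>k. d \<le> k \<Longrightarrow> q k = vzero T" "p = vsum T q d"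
      using graded_poly_components[OF p(1)] by blast
    have qc: "q k \<in> carrier T" for k using homog_carrier[OF q(1)] .
    define S where "S = (\<Sum>k<d. real k * vnorm T (q k))"
    have S0: "0 \<le> S" unfolding S_def using qc by (intro sum_nonneg) (simp add: vnorm_nonneg)
    \<comment> \<open>\<open>S / N\<close> will bound the distance of \<open>p\<close> from its
      Fejer mean, hence \<open>S / e < N\<close>; the condition \<open>d < N\<close> keeps the
      degrees of \<open>p\<close> below the cutoff.\<close>
    obtain N :: nat where N: "d < N" "S / e < N"
      using reals_Archimedean2[of "max (real d) (S / e)"] by auto
    have N0: "0 < N" using N(1) by simp
    \<comment> \<open>The Fejer mean of \<open>p'\<close> will have at most \<open>N\<close>
      components of norm at most \<open>C * e'\<close>, together at most \<open>e\<close>. Since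
      \<open>e'\<close> depends on \<open>N\<close>, the second approximation \<open>p'\<close> can
      only be chosen now.\<close>
    define e' where "e' = e / (N * (C + 1))"
    have e': "0 < e'" using e C(1) N0 by (simp add: e'_def)
    obtain p' where p': "graded_poly p'" "vnorm T (sub a p') < min e e'"
      using graded_poly_dense[OF a, of "min e e'"] e e' by auto
    note p'c = graded_poly_carrier[OF p'(1)]
    obtain d' q' where q': "\<And>k. homog k (q' k)" "\<And>k. d' \<le> k \<Longrightarrow> q' k = vzero T" "p' = vsum T q' d'"
      using graded_poly_components[OF p'(1)] by blast
    have q'c: "q' k \<in> carrier T" for k using homog_carrier[OF q'(1)] .
    \<comment> \<open>All degrees of \<open>p\<close> and \<open>p'\<close> lie below
      \<open>D\<close>, so one family of weights serves both.\<close>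
    define D where "D = max d d'"
    obtain m :: nat and l \<mu> where "(\<forall>j. cmod (l j) = 1) \<and> (\<Sum>j<m. cmod (\<mu> j)) = 1 \<and>
        (\<forall>k<D. (\<Sum>j<m. \<mu> j * l j ^ k) = complex_of_real (real (N - k) / real N))"
      using fejer_weights[OF N0, of D] by (elim exE) (rule that)
    then have l: "\<And>j. cmod (l j) = 1" and \<mu>: "(\<Sum>j<m. cmod (\<mu> j)) = 1"
      and fejer: "\<And>k. k < D \<Longrightarrow> (\<Sum>j<m. \<mu> j * l j ^ k) = of_real (real (N - k) / real N)"
      by blast+
    have "\<forall>j. \<exists>\<gamma>. star_hom T T \<gamma> \<and> (\<forall>f\<in>C0. \<gamma> (\<pi> f) = \<pi> f) \<and> (\<forall>F\<in>E0. \<gamma> (t F) = vscale T (l j) (t F))"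
      using gauge_exists[OF l] by blast
    then obtain \<gamma> where \<gamma>: "\<And>j. star_hom T T (\<gamma> j)" "\<And>j. \<forall>f\<in>C0. \<gamma> j (\<pi> f) = \<pi> f"
      "\<And>j. \<forall>F\<in>E0. \<gamma> j (t F) = vscale T (l j) (t F)"
      by metis
    define \<Phi> where "\<Phi> b = vsum T (\<lambda>j. vscale T (\<mu> j) (\<gamma> j b)) m" for b
    have \<gamma>c: "b \<in> carrier T \<Longrightarrow> \<gamma> j b \<in> carrier T" for b j using star_hom_closed[OF \<gamma>(1)] .
    have \<Phi>c: "b \<in> carrier T \<Longrightarrow> \<Phi> b \<in> carrier T" for b
      unfolding \<Phi>_def by (intro vsum_closed scale_closed \<gamma>c)
    have \<Phi>_norm: "vnorm T (\<Phi> b) \<le> vnorm T b" if b: "b \<in> carrier T" for b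
    proof -
      have "vnorm T (\<Phi> b) \<le> (\<Sum>j<m. vnorm T (vscale T (\<mu> j) (\<gamma> j b)))"
        unfolding \<Phi>_def by (intro vnorm_vsum scale_closed \<gamma>c b)
      also have "\<dots> \<le> (\<Sum>j<m. cmod (\<mu> j) * vnorm T b)"
        using star_hom_contractive[OF cstar_algebra_axioms cstar_algebra_axioms \<gamma>(1) b]
        by (intro sum_mono) (simp add: vnorm_scale \<gamma>c b mult_left_mono)
      also have "\<dots> = vnorm T b" using \<mu> by (simp flip: sum_distrib_right)
      finally show ?thesis .
    qed
    have \<Phi>_sub: "\<Phi> (sub b c) = sub (\<Phi> b) (\<Phi> c)" if "b \<in> carrier T" "c \<in> carrier T" for b c
    proof -
      have "\<Phi> (sub b c) = vsum T (\<lambda>j. vadd T (vscale T (\<mu> j) (\<gamma> j b)) (vscale T (- 1) (vscale T (\<mu> j) (\<gamma> j c)))) m"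
        unfolding \<Phi>_def using that
        by (intro vsum_cong) (simp add: star_hom_add[OF \<gamma>(1)] star_hom_scale[OF \<gamma>(1)] scale_closed \<gamma>c
            scale_add_right scale_scale)
      also have "\<dots> = sub (\<Phi> b) (\<Phi> c)"
        unfolding \<Phi>_def using that by (simp add: vsum_add scale_closed \<gamma>c vsum_scale)
      finally show ?thesis .
    qed
    have \<Phi>_poly: "\<Phi> (vsum T r n) = vsum T (\<lambda>k. vscale T (of_real (real (N - k) / real N)) (r k)) n"
      if r: "\<And>k. homog k (r k)" and n: "n \<le> D" for r n
    proof -
      have rc: "r k \<in> carrier T" for k using r homog_carrier by blast
      have "\<gamma> j (vsum T r n) = vsum T (\<lambda>k. \<gamma> j (r k)) n" for j
        by (rule clinear_map_vsum[OF _ _ star_hom_clinear[OF \<gamma>(1)] rc]) unfold_locales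
      then have "\<gamma> j (vsum T r n) = vsum T (\<lambda>k. vscale T (l j ^ k) (r k)) n" for j
        using homog_gauge[OF \<gamma>(1) \<gamma>(2) \<gamma>(3) r] by simp
      then have "\<Phi> (vsum T r n) = vsum T (\<lambda>j. vsum T (\<lambda>k. vscale T (\<mu> j * l j ^ k) (r k)) n) m"
        unfolding \<Phi>_def by (simp add: vsum_scale scale_closed rc scale_scale)
      also have "\<dots> = vsum T (\<lambda>k. vsum T (\<lambda>j. vscale T (\<mu> j * l j ^ k) (r k)) m) n"
        by (intro vsum_swap scale_closed rc)
      also have "\<dots> = vsum T (\<lambda>k. vscale T (\<Sum>j<m. \<mu> j * l j ^ k) (r k)) n"
        by (simp add: vsum_scale_left rc)
      also have "\<dots> = vsum T (\<lambda>k. vscale T (of_real (real (N - k) / real N)) (r k)) n"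
        using n by (intro vsum_cong) (simp add: fejer)
      finally show ?thesis .
    qed
    \<comment> \<open>In degree \<open>k\<close> the multiplier differs from 1 by
      \<open>k / N\<close>.\<close>
    have close: "vnorm T (sub p (\<Phi> p)) \<le> e"
    proof -
      have "sub p (\<Phi> p) = vsum T (\<lambda>k. vadd T (q k) (vscale T (- 1) (vscale T (of_real (real (N - k) / real N)) (q k)))) d"
        unfolding q(3) using \<Phi>_poly[OF q(1), of d] qc
        by (simp add: D_def vsum_add vsum_scale scale_closed)
      also have "\<dots> = vsum T (\<lambda>k. vscale T (of_real (real k / real N)) (q k)) d"
      proof (rule vsum_cong)
        fix k assume k: "k < d"
        have "vadd T (q k) (vscale T (- 1) (vscale T (of_real (real (N - k) / real N)) (q k)))
          = vscale T (1 + - 1 * of_real (real (N - k) / real N)) (q k)"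
          unfolding scale_add_left[OF qc] by (simp only: scale_one[OF qc] scale_scale[OF qc])
        also have "1 + - 1 * complex_of_real (real (N - k) / real N) = of_real (1 - real (N - k) / real N)"
          by simp
        also have "1 - real (N - k) / real N = real k / real N"
          using k N(1) by (simp add: of_nat_diff field_simps)
        finally show "vadd T (q k) (vscale T (- 1) (vscale T (of_real (real (N - k) / real N)) (q k)))
          = vscale T (of_real (real k / real N)) (q k)" .
      qed
      finally have "vnorm T (sub p (\<Phi> p)) \<le> (\<Sum>k<d. vnorm T (vscale T (of_real (real k / real N)) (q k)))"
        using vnorm_vsum[of "\<lambda>k. vscale T (of_real (real k / real N)) (q k)" d] qc by (simp add: scale_closed)
      also have "\<dots> = S / N"
        unfolding S_def sum_divide_distrib by (intro sum.cong refl) (simp add: vnorm_scale qc norm_divide)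
      also have "\<dots> \<le> e" using N(2) e N0 by (simp add: field_simps)
      finally show ?thesis .
    qed
    \<comment> \<open>As \<open>fock a = 0\<close>, the Fock matrix of \<open>p'\<close> is that of
      \<open>p' - a\<close> and has norm at most \<open>e'\<close>. The number of surviving
      components is bounded by the cutoff \<open>N\<close>, not by the uncontrolled degree
      \<open>d'\<close>.\<close>
    have small: "vnorm T (\<Phi> p') \<le> e"
    proof -
      have le: "opnorm (fock p') \<le> e'"
      proof -
        have "fock p' = (\<lambda>m m'. - fock (sub a p') m m')"
          using fock_sub[OF ac p'c] fock0 by (intro ext) simp
        then have "opnorm (fock p') = opnorm (\<lambda>m m'. (- 1) * fock (sub a p') m m')" by simp
        also have "\<dots> = opnorm (fock (sub a p'))"
          using opnorm_scale[OF opbound_fock[OF sub_closed[OF ac p'c]], of "- 1"] by simp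
        also have "\<dots> \<le> vnorm T (sub a p')"
          by (rule opnorm_le[OF opbound_fock[OF sub_closed[OF ac p'c]]])
        finally show ?thesis using p'(2) by simp
      qed
      have q'n: "vnorm T (q' k) \<le> C * e'" for k
      proof -
        have "vnorm T (q' k) \<le> C * opnorm (fock (vsum T q' d'))"
          by (rule C(2)[OF q'(1)]) (rule component_column_bound[OF q'(1,2)])
        also have "\<dots> \<le> C * e'" using le C(1) q'(3) by (intro mult_left_mono) auto
        finally show ?thesis .
      qed
      have "vnorm T (\<Phi> p') \<le> (\<Sum>k<d'. vnorm T (vscale T (of_real (real (N - k) / real N)) (q' k)))"
        unfolding q'(3) \<Phi>_poly[OF q'(1), of d', unfolded D_def, OF max.cobounded2]
        by (intro vnorm_vsum scale_closed q'c)
      also have "\<dots> \<le> (\<Sum>k<d'. if k < N then C * e' else 0)"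
      proof (rule sum_mono)
        fix k
        have "vnorm T (vscale T (of_real (real (N - k) / real N)) (q' k)) = real (N - k) / real N * vnorm T (q' k)"
          by (simp add: vnorm_scale q'c norm_divide)
        also have "\<dots> \<le> (if k < N then C * e' else 0)"
        proof (cases "k < N")
          case True
          have "real (N - k) / real N * vnorm T (q' k) \<le> 1 * vnorm T (q' k)"
            using N0 by (intro mult_right_mono) (auto simp: vnorm_nonneg q'c)
          then show ?thesis using True q'n[of k] by simp
        qed simp
        finally show "vnorm T (vscale T (of_real (real (N - k) / real N)) (q' k)) \<le> (if k < N then C * e' else 0)" .
      qed
      also have "\<dots> = (\<Sum>k\<in>{..<d'} \<inter> {..<N}. C * e')"
        by (subst sum.inter_restrict) auto
      also have "\<dots> \<le> N * (C * e')"
      proof -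
        have "card ({..<d'} \<inter> {..<N}) \<le> card {..<N}" by (intro card_mono) auto
        then show ?thesis using C(1) e' by (simp add: mult_right_mono)
      qed
      also have "\<dots> \<le> N * ((C + 1) * e')" using e' by (simp add: mult_left_mono)
      also have "\<dots> = e" using N0 C(1) by (simp add: e'_def)
      finally show ?thesis .
    qed
    \<comment> \<open>Telescoping through \<open>p\<close>, \<open>\<Phi> p\<close>,
      \<open>\<Phi> a\<close> and \<open>\<Phi> p'\<close> gives the five terms.\<close>
    have "vnorm T a \<le> vnorm T (sub a p) + vnorm T (sub p (\<Phi> p)) + vnorm T (sub (\<Phi> p) (\<Phi> a))
      + vnorm T (sub (\<Phi> a) (\<Phi> p')) + vnorm T (\<Phi> p')"
      using vnorm_le_sub[OF ac \<Phi>c[OF p'c]]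
        vnorm_sub_triangle[OF ac pc \<Phi>c[OF p'c]]
        vnorm_sub_triangle[OF pc \<Phi>c[OF pc] \<Phi>c[OF p'c]]
        vnorm_sub_triangle[OF \<Phi>c[OF pc] \<Phi>c[OF ac] \<Phi>c[OF p'c]]
      by linarith
    also have "\<dots> \<le> e + e + e + e + e"
    proof -
      have "vnorm T (sub (\<Phi> p) (\<Phi> a)) \<le> e"
        using \<Phi>_norm[OF sub_closed[OF pc ac]] p(2) vnorm_sub_commute[OF ac pc] \<Phi>_sub[OF pc ac] by simp
      moreover have "vnorm T (sub (\<Phi> a) (\<Phi> p')) \<le> e"
        using \<Phi>_norm[OF sub_closed[OF ac p'c]] p'(2) \<Phi>_sub[OF ac p'c] by simp
      ultimately show ?thesis using p(2) close small by linarith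
    qed
    finally show ?thesis by simp
  qed
  then have "vnorm T a \<le> 0 + e" if "0 < e" for e
    using \<open>\<And>e. 0 < e \<Longrightarrow> vnorm T a \<le> 0 + 5 * e\<close>[of "e / 5"] that by simp
  then have "vnorm T a \<le> 0" by (rule field_le_epsilon)
  then show ?thesis using vnorm_nonneg[OF ac] vnorm_eq_0[OF ac] by simp
qed

end

section \<open>Derivations of matrix algebras\<close>

text \<open>Matrices are functions on all pairs of naturals that vanish outside the \<open>n\<close>
  by \<open>n\<close> block, so that equality, sums and differences are those of functions.\<close>

definition mats :: "nat \<Rightarrow> (nat \<Rightarrow> nat \<Rightarrow> complex) set" where
  "mats n = {M. \<forall>i j. \<not> (i < n \<and> j < n) \<longrightarrow> M i j = 0}"

definition mm :: "nat \<Rightarrow> (nat \<Rightarrow> nat \<Rightarrow> complex) \<Rightarrow> (nat \<Rightarrow> nat \<Rightarrow> complex) \<Rightarrow> nat \<Rightarrow> nat \<Rightarrow> complex" where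
  "mm n M N i j = (if i < n \<and> j < n then \<Sum>k<n. M i k * N k j else 0)"

definition smat :: "complex \<Rightarrow> (nat \<Rightarrow> nat \<Rightarrow> complex) \<Rightarrow> nat \<Rightarrow> nat \<Rightarrow> complex" where
  "smat c M i j = c * M i j"

definition mat_id :: "nat \<Rightarrow> nat \<Rightarrow> nat \<Rightarrow> complex" where
  "mat_id n i j = (if i = j \<and> i < n then 1 else 0)"

definition mat_unit :: "nat \<Rightarrow> nat \<Rightarrow> nat \<Rightarrow> nat \<Rightarrow> complex" where
  "mat_unit i j k l = (if k = i \<and> l = j then 1 else 0)"

lemma mats_closed: "M \<in> mats n \<Longrightarrow> N \<in> mats n \<Longrightarrow> M + N \<in> mats n"
  "M \<in> mats n \<Longrightarrow> N \<in> mats n \<Longrightarrow> M - N \<in> mats n"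
  "M \<in> mats n \<Longrightarrow> smat c M \<in> mats n" "mm n M N \<in> mats n" "mat_id n \<in> mats n"
  by (auto simp: mats_def smat_def mm_def mat_id_def)

lemma mat_unit_mats: "i < n \<Longrightarrow> j < n \<Longrightarrow> mat_unit i j \<in> mats n"
  by (auto simp: mats_def mat_unit_def)

lemma mm_add_left: "mm n (M + N) P = mm n M P + mm n N P"
  and mm_add_right: "mm n P (M + N) = mm n P M + mm n P N"
  and mm_diff_left: "mm n (M - N) P = mm n M P - mm n N P"
  and mm_diff_right: "mm n P (M - N) = mm n P M - mm n P N"
  by (auto simp: mm_def fun_eq_iff algebra_simps sum.distrib sum_subtractf)

lemma mm_smat_left: "mm n (smat c M) P = smat c (mm n M P)"
  and mm_smat_right: "mm n P (smat c M) = smat c (mm n P M)"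
  by (auto simp: mm_def smat_def fun_eq_iff sum_distrib_left mult_ac)

lemma smat_add: "smat c (M + N) = smat c M + smat c N"
  by (auto simp: smat_def fun_eq_iff algebra_simps)

lemma mm_assoc: "mm n (mm n M N) P = mm n M (mm n N P)"
proof (intro ext)
  fix i j
  have "(\<Sum>k<n. (\<Sum>l<n. M i l * N l k) * P k j) = (\<Sum>l<n. M i l * (\<Sum>k<n. N l k * P k j))"
    by (simp add: sum_distrib_left sum_distrib_right mult.assoc) (rule sum.swap)
  moreover have "mm n (mm n M N) P i j = (if i < n \<and> j < n then \<Sum>k<n. (\<Sum>l<n. M i l * N l k) * P k j else 0)"
    unfolding mm_def by (auto intro!: sum.cong)
  moreover have "mm n M (mm n N P) i j = (if i < n \<and> j < n then \<Sum>l<n. M i l * (\<Sum>k<n. N l k * P k j) else 0)"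
    unfolding mm_def by (auto intro!: sum.cong)
  ultimately show "mm n (mm n M N) P i j = mm n M (mm n N P) i j" by simp
qed

lemma mm_id_left: "M \<in> mats n \<Longrightarrow> mm n (mat_id n) M = M"
proof (intro ext)
  fix i j assume M: "M \<in> mats n"
  have "(\<Sum>k<n. mat_id n i k * M k j) = (\<Sum>k<n. if k = i then M i j else 0)"
    by (intro sum.cong refl) (auto simp: mat_id_def)
  with M show "mm n (mat_id n) M i j = M i j" by (auto simp: mm_def mats_def)
qed

lemma mm_id_right: "M \<in> mats n \<Longrightarrow> mm n M (mat_id n) = M"
proof (intro ext)
  fix i j assume M: "M \<in> mats n"
  have "(\<Sum>k<n. M i k * mat_id n k j) = (\<Sum>k<n. if k = j then M i j else 0)"
    by (intro sum.cong refl) (auto simp: mat_id_def)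
  with M show "mm n M (mat_id n) i j = M i j" by (auto simp: mm_def mats_def)
qed

lemma mm_mat_unit:
  assumes "i < n" "j < n" "k < n" "l < n"
  shows "mm n (mat_unit i j) (mat_unit k l) = (if j = k then mat_unit i l else 0)"
proof (intro ext)
  fix a b
  have "(\<Sum>r<n. mat_unit i j a r * mat_unit k l r b)
    = (\<Sum>r<n. if r = j then (if a = i \<and> j = k \<and> b = l then 1 else 0) else 0)"
    by (intro sum.cong refl) (auto simp: mat_unit_def)
  then show "mm n (mat_unit i j) (mat_unit k l) a b = (if j = k then mat_unit i l else 0) a b"
    using assms by (auto simp: mm_def mat_unit_def)
qed

lemma sum_fun_apply2: "(\<Sum>i\<in>I. f i) a b = (\<Sum>i\<in>I. f i a b :: complex)"
  by (induction I rule: infinite_finite_induct) auto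

lemma mats_span:
  assumes M: "M \<in> mats n" and "0 < n"
    and add: "\<And>A B. A \<in> S \<Longrightarrow> B \<in> S \<Longrightarrow> A + B \<in> S"
    and scale: "\<And>c A. A \<in> S \<Longrightarrow> smat c A \<in> S"
    and units: "\<And>i j. i < n \<Longrightarrow> j < n \<Longrightarrow> mat_unit i j \<in> S"
  shows "M \<in> S"
proof -
  have zero: "0 \<in> S"
  proof -
    have "smat 0 (mat_unit 0 0) \<in> S" using assms(2) by (intro scale units)
    moreover have "smat 0 (mat_unit 0 0) = 0" by (simp add: smat_def fun_eq_iff)
    ultimately show ?thesis by simp
  qed
  have sum: "(\<Sum>i\<in>I. f i) \<in> S" if "finite I" "\<And>i. i \<in> I \<Longrightarrow> f i \<in> S" for I :: "nat set" and f
    using that by (induction I rule: finite_induct) (auto simp: zero intro: add)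
  have "M = (\<Sum>i<n. \<Sum>j<n. smat (M i j) (mat_unit i j))"
  proof (intro ext)
    fix a b
    have "(\<Sum>i<n. \<Sum>j<n. smat (M i j) (mat_unit i j)) a b
      = (\<Sum>i<n. \<Sum>j<n. if j = b then (if i = a then M a b else 0) else 0)"
      unfolding sum_fun_apply2 by (intro sum.cong refl) (auto simp: smat_def mat_unit_def)
    also have "\<dots> = M a b" using M by (cases "b < n"; cases "a < n") (auto simp: mats_def)
    finally show "M a b = (\<Sum>i<n. \<Sum>j<n. smat (M i j) (mat_unit i j)) a b" ..
  qed
  moreover have "(\<Sum>i<n. \<Sum>j<n. smat (M i j) (mat_unit i j)) \<in> S"
    by (intro sum scale units) auto
  ultimately show ?thesis by simp
qed

text \<open>A diagonal matrix unit is idempotent; an off-diagonal one is the difference of the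
  idempotents \<open>E_ii + E_ij\<close> and \<open>E_ii\<close>.\<close>

lemma mats_span_idempotents:
  assumes M: "M \<in> mats n" and n: "0 < n"
    and add: "\<And>A B. A \<in> S \<Longrightarrow> B \<in> S \<Longrightarrow> A + B \<in> S"
    and scale: "\<And>c A. A \<in> S \<Longrightarrow> smat c A \<in> S"
    and idem: "\<And>P. P \<in> mats n \<Longrightarrow> mm n P P = P \<Longrightarrow> P \<in> S"
  shows "M \<in> S"
proof (rule mats_span[OF M n add scale])
  fix i j assume ij: "i < n" "j < n"
  show "mat_unit i j \<in> S"
  proof (cases "i = j")
    case True
    then show ?thesis using ij by (intro idem) (simp_all add: mat_unit_mats mm_mat_unit)
  next
    case False
    have 1: "mat_unit i i + mat_unit i j \<in> S"
      using ij False
      by (intro idem) (simp_all add: mat_unit_mats mats_closed mm_add_left mm_add_right mm_mat_unit)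
    have 2: "smat (- 1) (mat_unit i i) \<in> S"
      using ij by (intro scale idem) (simp_all add: mat_unit_mats mm_mat_unit)
    have "mat_unit i j = (mat_unit i i + mat_unit i j) + smat (- 1) (mat_unit i i)"
      by (simp add: fun_eq_iff smat_def)
    with add[OF 1 2] show ?thesis by simp
  qed
qed

text \<open>Expanding \<open>b = 1\<close> along \<open>P, 1 - P\<close> on the left and \<open>Q, 1 - Q\<close> on the right, the four
  instances of the zero product condition give the Leibniz rule for a pair of idempotents; these
  span all matrices.\<close>

lemma zero_product_derivation:
  assumes n: "0 < n"
    and closed: "\<And>M. M \<in> mats n \<Longrightarrow> \<Delta> M \<in> mats n"
    and add: "\<And>M N. M \<in> mats n \<Longrightarrow> N \<in> mats n \<Longrightarrow> \<Delta> (M + N) = \<Delta> M + \<Delta> N"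
    and scale: "\<And>M c. M \<in> mats n \<Longrightarrow> \<Delta> (smat c M) = smat c (\<Delta> M)"
    and one: "\<Delta> (mat_id n) = 0"
    and zero: "\<And>A B C. \<lbrakk>A \<in> mats n; B \<in> mats n; C \<in> mats n; mm n A B = 0; mm n B C = 0\<rbrakk>
      \<Longrightarrow> mm n (mm n A (\<Delta> B)) C = 0"
    and MN: "M \<in> mats n" "N \<in> mats n"
  shows "\<Delta> (mm n M N) = mm n (\<Delta> M) N + mm n M (\<Delta> N)"
proof -
  let ?I = "mat_id n"
  have diff: "\<Delta> (A - B) = \<Delta> A - \<Delta> B" if "A \<in> mats n" "B \<in> mats n" for A B
    using add[of "A - B" B] that by (simp add: mats_closed)
  have idem: "\<Delta> (mm n P Q) = mm n (\<Delta> P) Q + mm n P (\<Delta> Q)"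
    if P: "P \<in> mats n" "mm n P P = P" and Q: "Q \<in> mats n" "mm n Q Q = Q" for P Q
  proof -
    note simps = mm_diff_left mm_diff_right mm_add_left mm_add_right mm_id_left mm_id_right
      mats_closed closed diff one P Q mm_assoc
    have PP: "mm n P (mm n P Z) = mm n P Z" for Z using P(2) by (simp flip: mm_assoc)
    have QQ: "mm n Q (mm n Q Z) = mm n Q Z" for Z using Q(2) by (simp flip: mm_assoc)
    define U V A where "U = \<Delta> P" and "V = \<Delta> Q" and "A = \<Delta> (mm n P Q)"
    have m: "U \<in> mats n" "V \<in> mats n" "A \<in> mats n" "P \<in> mats n" "Q \<in> mats n"
      unfolding U_def V_def A_def by (simp_all add: closed P Q mats_closed)
    have d1: "\<Delta> (mm n P (?I - Q)) = U - A"
      unfolding U_def A_def by (simp add: simps)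
    have d2: "\<Delta> (mm n (?I - P) Q) = V - A"
      unfolding V_def A_def by (simp add: simps)
    \<comment> \<open>The image of the identity is 0, so only three of the four terms
      remain.\<close>
    have d3: "\<Delta> (mm n (?I - P) (?I - Q)) = A - U - V"
      unfolding U_def V_def A_def by (simp add: simps)
    have e1: "mm n (mm n (?I - P) Z) (?I - Q) = Z - mm n P Z - mm n Z Q + mm n P (mm n Z Q)"
      and e2: "mm n (mm n (?I - P) Z) Q = mm n Z Q - mm n P (mm n Z Q)"
      and e3: "mm n (mm n P Z) (?I - Q) = mm n P Z - mm n P (mm n Z Q)"
      if "Z \<in> mats n" for Z
      using that P(1) Q(1)
      by (simp_all add: mm_diff_left mm_diff_right mm_id_left mm_id_right mats_closed mm_assoc)
    have "mm n (mm n (?I - P) (\<Delta> (mm n P Q))) (?I - Q) = 0"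
      by (rule zero) (simp_all add: simps PP QQ)
    then have 1: "A - mm n P A - mm n A Q + mm n P (mm n A Q) = 0"
      unfolding A_def[symmetric] e1[OF m(3)] .
    have "mm n (mm n (?I - P) (\<Delta> (mm n P (?I - Q)))) Q = 0"
      by (rule zero) (simp_all add: simps PP QQ)
    then have 2: "mm n U Q - mm n A Q - (mm n P (mm n U Q) - mm n P (mm n A Q)) = 0"
      unfolding d1 e2[OF mats_closed(2)[OF m(1,3)]] by (simp only: mm_diff_left mm_diff_right)
    have "mm n (mm n P (\<Delta> (mm n (?I - P) Q))) (?I - Q) = 0"
      by (rule zero) (simp_all add: simps PP QQ)
    then have 3: "mm n P V - mm n P A - (mm n P (mm n V Q) - mm n P (mm n A Q)) = 0"
      unfolding d2 e3[OF mats_closed(2)[OF m(2,3)]] by (simp only: mm_diff_left mm_diff_right)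
    have "mm n (mm n P (\<Delta> (mm n (?I - P) (?I - Q)))) Q = 0"
      by (rule zero) (simp_all add: simps PP QQ)
    then have 4: "mm n P (mm n A Q) - mm n P (mm n U Q) - mm n P (mm n V Q) = 0"
      unfolding d3 mm_assoc by (simp only: mm_diff_left mm_diff_right)
    \<comment> \<open>First minus second minus third plus fourth relation: all terms compressed by
      \<open>P\<close> or \<open>Q\<close> cancel.\<close>
    have lin: "a = u + v" if "a - pa - aq + paq = 0" "u - aq - (puq - paq) = 0"
      "v - pa - (pvq - paq) = 0" "paq - puq - pvq = 0"
      for a pa aq paq u v puq pvq :: "nat \<Rightarrow> nat \<Rightarrow> complex"
    proof -
      have "a = u + v + ((a - pa - aq + paq) - (u - aq - (puq - paq)) - (v - pa - (pvq - paq)) + (paq - puq - pvq))"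
        by (simp add: algebra_simps)
      then show ?thesis by (simp only: that) simp
    qed
    from lin[OF 1 2 3 4] show ?thesis by (simp add: A_def U_def V_def)
  qed
  \<comment> \<open>Both sides are linear in either factor, so the rule extends from idempotents to
    all matrices, first in the left factor and then in the right one.\<close>
  have left: "\<Delta> (mm n A Q) = mm n (\<Delta> A) Q + mm n A (\<Delta> Q)"
    if A: "A \<in> mats n" and Q: "Q \<in> mats n" "mm n Q Q = Q" for A Q
  proof -
    have "A \<in> {A \<in> mats n. \<Delta> (mm n A Q) = mm n (\<Delta> A) Q + mm n A (\<Delta> Q)}"
      using A n
    proof (rule mats_span_idempotents)
      fix B C assume "B \<in> {A \<in> mats n. \<Delta> (mm n A Q) = mm n (\<Delta> A) Q + mm n A (\<Delta> Q)}"
        "C \<in> {A \<in> mats n. \<Delta> (mm n A Q) = mm n (\<Delta> A) Q + mm n A (\<Delta> Q)}"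
      then show "B + C \<in> {A \<in> mats n. \<Delta> (mm n A Q) = mm n (\<Delta> A) Q + mm n A (\<Delta> Q)}"
        by (simp add: mats_closed add mm_add_left algebra_simps)
    next
      fix c B assume "B \<in> {A \<in> mats n. \<Delta> (mm n A Q) = mm n (\<Delta> A) Q + mm n A (\<Delta> Q)}"
      then show "smat c B \<in> {A \<in> mats n. \<Delta> (mm n A Q) = mm n (\<Delta> A) Q + mm n A (\<Delta> Q)}"
        by (simp add: mats_closed scale mm_smat_left smat_add)
    qed (use idem Q in auto)
    then show ?thesis by simp
  qed
  have "N \<in> {B \<in> mats n. \<Delta> (mm n M B) = mm n (\<Delta> M) B + mm n M (\<Delta> B)}"
    using MN(2) n
  proof (rule mats_span_idempotents)
    fix B C assume "B \<in> {B \<in> mats n. \<Delta> (mm n M B) = mm n (\<Delta> M) B + mm n M (\<Delta> B)}"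
      "C \<in> {B \<in> mats n. \<Delta> (mm n M B) = mm n (\<Delta> M) B + mm n M (\<Delta> B)}"
    then show "B + C \<in> {B \<in> mats n. \<Delta> (mm n M B) = mm n (\<Delta> M) B + mm n M (\<Delta> B)}"
      by (simp add: mats_closed add mm_add_right algebra_simps)
  next
    fix c B assume "B \<in> {B \<in> mats n. \<Delta> (mm n M B) = mm n (\<Delta> M) B + mm n M (\<Delta> B)}"
    then show "smat c B \<in> {B \<in> mats n. \<Delta> (mm n M B) = mm n (\<Delta> M) B + mm n M (\<Delta> B)}"
      by (simp add: mats_closed scale mm_smat_right smat_add)
  qed (use left MN(1) in auto)
  then show ?thesis by simp
qed

section \<open>Local derivations under matrix representations\<close>

locale normed_calgebra = normed_cvec A
  for A :: "('a, 'r) nalg_scheme" +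
  assumes mult_closed: "\<lbrakk>x \<in> carrier A; y \<in> carrier A\<rbrakk> \<Longrightarrow> vmult A x y \<in> carrier A"
    and norm_mult: "\<lbrakk>x \<in> carrier A; y \<in> carrier A\<rbrakk>
      \<Longrightarrow> vnorm A (vmult A x y) \<le> vnorm A x * vnorm A y"

text \<open>\<open>rep_unit\<close> makes the representation surjective; \<open>rep_bound\<close>
  turns norm limits into entrywise limits and limits the growth of iterated derivatives in
  \<open>derivation_kernel\<close>.\<close>

locale matrix_rep = normed_calgebra A
  for A :: "('a, 'r) nalg_scheme" +
  fixes n :: nat and \<rho> :: "'a \<Rightarrow> nat \<Rightarrow> nat \<Rightarrow> complex" and K :: real
  assumes n_pos: "0 < n"
    and rep_mats: "a \<in> carrier A \<Longrightarrow> \<rho> a \<in> mats n"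
    and rep_add: "\<lbrakk>a \<in> carrier A; b \<in> carrier A\<rbrakk> \<Longrightarrow> \<rho> (vadd A a b) = \<rho> a + \<rho> b"
    and rep_scale: "a \<in> carrier A \<Longrightarrow> \<rho> (vscale A c a) = smat c (\<rho> a)"
    and rep_mult: "\<lbrakk>a \<in> carrier A; b \<in> carrier A\<rbrakk> \<Longrightarrow> \<rho> (vmult A a b) = mm n (\<rho> a) (\<rho> b)"
    and rep_bound: "a \<in> carrier A \<Longrightarrow> cmod (\<rho> a i j) \<le> K * vnorm A a"
    and rep_unit: "\<lbrakk>i < n; j < n\<rbrakk> \<Longrightarrow> \<exists>e\<in>carrier A. \<rho> e = mat_unit i j"
begin

lemma rep_onto: "M \<in> mats n \<Longrightarrow> \<exists>a\<in>carrier A. \<rho> a = M"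
proof -
  assume M: "M \<in> mats n"
  have "M \<in> {M. \<exists>a\<in>carrier A. \<rho> a = M}"
    using M n_pos
  proof (rule mats_span)
    fix B C assume "B \<in> {M. \<exists>a\<in>carrier A. \<rho> a = M}" "C \<in> {M. \<exists>a\<in>carrier A. \<rho> a = M}"
    then obtain a b where ab: "a \<in> carrier A" "\<rho> a = B" "b \<in> carrier A" "\<rho> b = C" by blast
    then have "\<rho> (vadd A a b) = B + C" by (simp add: rep_add)
    then show "B + C \<in> {M. \<exists>a\<in>carrier A. \<rho> a = M}" using ab add_closed by blast
  next
    fix c B assume "B \<in> {M. \<exists>a\<in>carrier A. \<rho> a = M}"
    then obtain a where a: "a \<in> carrier A" "\<rho> a = B" by blast
    then have "\<rho> (vscale A c a) = smat c B" by (simp add: rep_scale)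
    then show "smat c B \<in> {M. \<exists>a\<in>carrier A. \<rho> a = M}" using a scale_closed by blast
  qed (use rep_unit in auto)
  then show ?thesis by simp
qed

lemma zero_mat_eta: "(\<lambda>i j. 0) = (0 :: nat \<Rightarrow> nat \<Rightarrow> complex)"
  by (simp add: fun_eq_iff)

lemma K_nonneg: "0 \<le> K"
proof (rule ccontr)
  assume "\<not> 0 \<le> K"
  obtain e where e: "e \<in> carrier A" "\<rho> e = mat_unit 0 0" using rep_unit n_pos by blast
  have "1 \<le> K * vnorm A e" using rep_bound[OF e(1), of 0 0] by (simp add: e(2) mat_unit_def)
  moreover have "K * vnorm A e \<le> 0"
    using \<open>\<not> 0 \<le> K\<close> vnorm_nonneg[OF e(1)] by (simp add: mult_nonpos_nonneg)
  ultimately show False by simp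
qed

lemma mm_0: "mm n 0 M = 0" "mm n M 0 = 0"
  by (auto simp: mm_def fun_eq_iff)

lemma rep_sub: "a \<in> carrier A \<Longrightarrow> b \<in> carrier A \<Longrightarrow> \<rho> (sub a b) = \<rho> a - \<rho> b"
  by (simp add: rep_add rep_scale scale_closed) (simp add: smat_def fun_eq_iff)

section \<open>A single derivation under the representation\<close>

context
  fixes D
  assumes D: "derivation A D"
begin

lemma D_closed: "a \<in> carrier A \<Longrightarrow> D a \<in> carrier A"
  and D_add: "\<lbrakk>a \<in> carrier A; b \<in> carrier A\<rbrakk> \<Longrightarrow> D (vadd A a b) = vadd A (D a) (D b)"
  and D_mult: "\<lbrakk>a \<in> carrier A; b \<in> carrier A\<rbrakk>
    \<Longrightarrow> D (vmult A a b) = vadd A (vmult A (D a) b) (vmult A a (D b))"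
  using D by (auto simp: derivation_def bounded_clinear_map_def clinear_map_def)

lemma rep_D_mult: "\<lbrakk>a \<in> carrier A; b \<in> carrier A\<rbrakk>
    \<Longrightarrow> \<rho> (D (vmult A a b)) = mm n (\<rho> (D a)) (\<rho> b) + mm n (\<rho> a) (\<rho> (D b))"
  by (simp add: D_mult D_closed rep_add rep_mult mult_closed)

lemma funpow_D_closed: "a \<in> carrier A \<Longrightarrow> (D ^^ j) a \<in> carrier A"
  by (induction j) (auto simp: D_closed)

lemma funpow_D_add: "\<lbrakk>a \<in> carrier A; b \<in> carrier A\<rbrakk> \<Longrightarrow> (D ^^ j) (vadd A a b) = vadd A ((D ^^ j) a) ((D ^^ j) b)"
  by (induction j) (auto simp: D_add funpow_D_closed)

text \<open>The product rule is applied at the innermost \<open>D\<close>, so that inductions on the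
  exponent involve two terms instead of binomial sums.\<close>

lemma rep_funpow_Suc_mult:
  assumes "x \<in> carrier A" "a \<in> carrier A"
  shows "\<rho> ((D ^^ Suc j) (vmult A x a)) = \<rho> ((D ^^ j) (vmult A (D x) a)) + \<rho> ((D ^^ j) (vmult A x (D a)))"
  using assms
  by (simp add: funpow_Suc_right funpow_D_add funpow_D_closed D_mult D_closed mult_closed rep_add del: funpow.simps)

text \<open>Say that \<open>a\<close> has order \<open>k\<close> if
  \<open>\<rho> (D\<^sup>j a) = 0\<close> for all \<open>j < k\<close>. In the Leibniz expansion of
  \<open>D\<^sup>k (x a)\<close> only the term with all derivatives on \<open>a\<close> survives, so
  \<open>x\<close> preserves the order and acts on the leading term through
  \<open>\<rho> x\<close>.\<close>

lemma filtration_mult: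
  assumes "x \<in> carrier A" "a \<in> carrier A" "\<And>j. j < k \<Longrightarrow> \<rho> ((D ^^ j) a) = 0"
  shows "(\<forall>j<k. \<rho> ((D ^^ j) (vmult A x a)) = 0) \<and> \<rho> ((D ^^ k) (vmult A x a)) = mm n (\<rho> x) (\<rho> ((D ^^ k) a))"
  using assms
proof (induction k arbitrary: x a)
  case 0
  then show ?case by (simp add: rep_mult)
next
  case (Suc k)
  have Da: "\<rho> ((D ^^ j) (D a)) = \<rho> ((D ^^ Suc j) a)" for j by (simp add: funpow_Suc_right del: funpow.simps)
  have 1: "(\<forall>j<k. \<rho> ((D ^^ j) (vmult A (D x) a)) = 0) \<and> \<rho> ((D ^^ k) (vmult A (D x) a)) = 0"
    using Suc.IH[of "D x" a] Suc.prems by (simp add: D_closed mm_0 zero_mat_eta)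
  have 2: "(\<forall>j<k. \<rho> ((D ^^ j) (vmult A x (D a))) = 0)
      \<and> \<rho> ((D ^^ k) (vmult A x (D a))) = mm n (\<rho> x) (\<rho> ((D ^^ Suc k) a))"
    using Suc.IH[of x "D a"] Suc.prems unfolding Da by (simp add: D_closed zero_mat_eta del: funpow.simps)
  have "\<rho> ((D ^^ j) (vmult A x a)) = 0" if "j < Suc k" for j
  proof (cases j)
    case 0
    then show ?thesis using Suc.prems(3)[of 0] Suc.prems by (simp add: rep_mult mm_0 zero_mat_eta)
  next
    case (Suc j')
    then show ?thesis
      using 1 2 that Suc.prems by (simp add: rep_funpow_Suc_mult del: funpow.simps)
  qed
  moreover have "\<rho> ((D ^^ Suc k) (vmult A x a)) = mm n (\<rho> x) (\<rho> ((D ^^ Suc k) a))"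
    using 1 2 Suc.prems by (simp add: rep_funpow_Suc_mult del: funpow.simps)
  ultimately show ?case by blast
qed

text \<open>For \<open>q\<close> in the kernel the term without a derivative on \<open>q\<close> is
  lost as well, so the order rises by one. What survives is the term with exactly one derivative on
  \<open>q\<close>, with multiplicity \<open>k + 1\<close>; this factor is the source of the
  factorial.\<close>

lemma filtration_step:
  assumes "q \<in> carrier A" "\<rho> q = 0" "a \<in> carrier A" "\<And>j. j < k \<Longrightarrow> \<rho> ((D ^^ j) a) = 0"
  shows "(\<forall>j<Suc k. \<rho> ((D ^^ j) (vmult A q a)) = 0) \<and>
    \<rho> ((D ^^ Suc k) (vmult A q a)) = smat (of_nat (Suc k)) (mm n (\<rho> (D q)) (\<rho> ((D ^^ k) a)))"
  using assms(3,4)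
proof (induction k arbitrary: a)
  case 0
  have "\<rho> (vmult A q a) = 0" using assms 0 by (simp add: rep_mult mm_0 zero_mat_eta)
  moreover have "\<rho> (D (vmult A q a)) = mm n (\<rho> (D q)) (\<rho> a)"
    using assms 0 by (simp add: rep_D_mult mm_0 zero_mat_eta)
  ultimately show ?case by (simp add: smat_def fun_eq_iff)
next
  case (Suc k)
  have Da: "\<rho> ((D ^^ j) (D a)) = \<rho> ((D ^^ Suc j) a)" for j by (simp add: funpow_Suc_right del: funpow.simps)
  have 1: "(\<forall>j<Suc k. \<rho> ((D ^^ j) (vmult A (D q) a)) = 0) \<and>
      \<rho> ((D ^^ Suc k) (vmult A (D q) a)) = mm n (\<rho> (D q)) (\<rho> ((D ^^ Suc k) a))"
    using filtration_mult[OF D_closed[OF assms(1)] Suc.prems] .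
  have 2: "(\<forall>j<Suc k. \<rho> ((D ^^ j) (vmult A q (D a))) = 0) \<and>
    \<rho> ((D ^^ Suc k) (vmult A q (D a))) = smat (of_nat (Suc k)) (mm n (\<rho> (D q)) (\<rho> ((D ^^ Suc k) a)))"
    using Suc.IH[of "D a"] Suc.prems unfolding Da by (simp add: D_closed zero_mat_eta del: funpow.simps of_nat_Suc)
  have "\<rho> ((D ^^ j) (vmult A q a)) = 0" if "j < Suc (Suc k)" for j
  proof (cases j)
    case 0
    then show ?thesis using assms Suc.prems by (simp add: rep_mult mm_0 zero_mat_eta)
  next
    case (Suc j')
    then show ?thesis
      using 1 2 that Suc.prems assms(1) by (simp add: rep_funpow_Suc_mult del: funpow.simps)
  qed
  moreover have "\<rho> ((D ^^ Suc (Suc k)) (vmult A q a))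
      = smat (of_nat (Suc (Suc k))) (mm n (\<rho> (D q)) (\<rho> ((D ^^ Suc k) a)))"
    using 1 2 Suc.prems assms(1)
    by (simp add: rep_funpow_Suc_mult[of q a "Suc k"] del: funpow.simps) (simp add: smat_def fun_eq_iff algebra_simps)
  ultimately show ?case by blast
qed

text \<open>If \<open>\<rho> (D p) \<noteq> 0\<close> for some \<open>p\<close> in the kernel, compressing by matrix units gives \<open>q\<close> in the kernel
  with \<open>\<rho> (D q)\<close> a multiple of a matrix unit; then \<open>\<rho> (D\<^sup>k q\<^sup>k)\<close> grows like \<open>k!\<close>, but \<open>D\<close> is bounded.\<close>

lemma derivation_kernel:
  assumes p: "p \<in> carrier A" "\<rho> p = 0"
  shows "\<rho> (D p) = 0"
proof (rule ccontr)
  assume "\<rho> (D p) \<noteq> 0"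
  then obtain i j where ij: "\<rho> (D p) i j \<noteq> 0" by (auto simp: fun_eq_iff)
  define l where "l = \<rho> (D p) i j"
  have l: "l \<noteq> 0" using ij by (simp add: l_def)
  have ijn: "i < n" "j < n" using ij rep_mats[OF D_closed[OF p(1)]] by (auto simp: mats_def)
  obtain x where x: "x \<in> carrier A" "\<rho> x = mat_unit 0 i" using rep_unit n_pos ijn by blast
  obtain y where y: "y \<in> carrier A" "\<rho> y = mat_unit j 0" using rep_unit n_pos ijn by blast
  \<comment> \<open>Compression by matrix units keeps \<open>q\<close> in the kernel and moves the
    nonzero entry \<open>l\<close> to the position \<open>(0, 0)\<close>, where the powers of the
    resulting multiple of an idempotent do not vanish.\<close>
  define q where "q = vmult A (vmult A x p) y"
  have q: "q \<in> carrier A" "\<rho> q = 0"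
    using x y p by (simp_all add: q_def mult_closed rep_mult mm_0 zero_mat_eta)
  have Dq: "\<rho> (D q) = smat l (mat_unit 0 0)"
  proof (intro ext)
    fix a b :: nat
    have "\<rho> (D q) = mm n (mm n (mat_unit 0 i) (\<rho> (D p))) (mat_unit j 0)"
      using x y p by (simp add: q_def rep_D_mult mult_closed rep_mult mm_0 zero_mat_eta)
    moreover have "mm n (mat_unit 0 i) (\<rho> (D p)) a k = (if a = 0 \<and> k < n then \<rho> (D p) i k else 0)" for a k :: nat
    proof -
      have "(\<Sum>r<n. mat_unit 0 i a r * \<rho> (D p) r k) = (\<Sum>r<n. if r = i then (if a = 0 then \<rho> (D p) i k else 0) else 0)"
        by (intro sum.cong refl) (auto simp: mat_unit_def)
      then show ?thesis using ijn n_pos by (auto simp: mm_def)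
    qed
    moreover have "(\<Sum>k<n. (if a = 0 \<and> k < n then \<rho> (D p) i k else 0) * mat_unit j 0 k b)
      = (\<Sum>k<n. if k = j then (if a = 0 \<and> b = 0 then \<rho> (D p) i j else 0) else 0)"
      by (intro sum.cong refl) (auto simp: mat_unit_def)
    ultimately show "\<rho> (D q) a b = smat l (mat_unit 0 0) a b"
      using ijn n_pos by (auto simp: mm_def[of n "mm n _ _"] smat_def mat_unit_def l_def)
  qed
  \<comment> \<open>\<open>P k\<close> is the power of \<open>q\<close> with exponent
    \<open>k + 1\<close>, and it has order \<open>k + 1\<close>; hence the shift by one
    below.\<close>
  define P where "P k = (vmult A q ^^ k) q" for k
  have P: "P k \<in> carrier A \<and> (\<forall>j<Suc k. \<rho> ((D ^^ j) (P k)) = 0) \<and>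
      \<rho> ((D ^^ Suc k) (P k)) = smat (fact (Suc k) * l ^ Suc k) (mat_unit 0 0)" for k
  proof (induction k)
    case 0
    then show ?case using q Dq by (simp add: P_def)
  next
    case (Suc k)
    have "P (Suc k) = vmult A q (P k)" by (simp add: P_def)
    moreover have "mm n (\<rho> (D q)) (smat c (mat_unit 0 0)) = smat (l * c) (mat_unit 0 0)" for c
      using n_pos by (simp add: Dq mm_smat_left mm_smat_right mm_mat_unit) (simp add: smat_def fun_eq_iff)
    ultimately show ?case
      using filtration_step[OF q, of "P k" "Suc k"] Suc q(1)
      by (simp add: mult_closed del: funpow.simps fact_Suc of_nat_Suc)
        (simp add: smat_def fun_eq_iff fact_Suc mult_ac del: funpow.simps of_nat_Suc)
  qed
  obtain C where C: "\<And>x. x \<in> carrier A \<Longrightarrow> vnorm A (D x) \<le> C * vnorm A x"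
    using D by (auto simp: derivation_def bounded_clinear_map_def)
  define C' where "C' = \<bar>C\<bar>"
  have C': "vnorm A (D x) \<le> C' * vnorm A x" "0 \<le> C'" if "x \<in> carrier A" for x
    using C[OF that] vnorm_nonneg[OF that] order_trans[OF _ mult_right_mono[of C "\<bar>C\<bar>" "vnorm A x"]]
    by (auto simp: C'_def)
  have DP: "vnorm A ((D ^^ m) x) \<le> C' ^ m * vnorm A x" if x: "x \<in> carrier A" for m x
  proof (induction m)
    case (Suc m)
    have "vnorm A ((D ^^ Suc m) x) \<le> C' * vnorm A ((D ^^ m) x)"
      using C'(1)[OF funpow_D_closed[OF x]] by simp
    also have "\<dots> \<le> C' * (C' ^ m * vnorm A x)" using Suc C'(2)[OF x] by (rule mult_left_mono)
    finally show ?case by (simp add: mult.assoc)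
  qed simp
  have NP: "vnorm A (P k) \<le> vnorm A q ^ Suc k" for k
  proof (induction k)
    case (Suc k)
    have "vnorm A (P (Suc k)) \<le> vnorm A q * vnorm A (P k)"
      using norm_mult[OF q(1), of "P k"] P[of k] by (simp add: P_def)
    also have "\<dots> \<le> vnorm A q * vnorm A q ^ Suc k" using Suc vnorm_nonneg[OF q(1)] by (rule mult_left_mono)
    finally show ?case by simp
  qed (simp add: P_def)
  \<comment> \<open>Collects the constants: the factorials would be bounded by
    \<open>K * M ^ Suc k\<close>, against the convergence of the exponential series.\<close>
  define M where "M = C' * vnorm A q / cmod l"
  have le: "fact (Suc k) \<le> K * M ^ Suc k" for k
  proof -
    have "fact (Suc k) * cmod l ^ Suc k = cmod (\<rho> ((D ^^ Suc k) (P k)) 0 0)"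
      using P[of k] by (simp add: smat_def mat_unit_def Real_Vector_Spaces.norm_mult norm_power
          del: funpow.simps fact_Suc power_Suc)
    also have "\<dots> \<le> K * vnorm A ((D ^^ Suc k) (P k))"
      using P[of k] by (intro rep_bound funpow_D_closed) blast
    also have "\<dots> \<le> K * (C' ^ Suc k * vnorm A (P k))"
      using P[of k] K_nonneg by (intro mult_left_mono DP) auto
    also have "\<dots> \<le> K * (C' ^ Suc k * vnorm A q ^ Suc k)"
      using NP[of k] K_nonneg C'(2)[OF p(1)] by (intro mult_left_mono) auto
    finally show ?thesis using l by (simp add: M_def power_divide power_mult_distrib pos_le_divide_eq mult.assoc
        del: fact_Suc power_Suc)
  qed
  have "(\<lambda>m. inverse (fact m) * M ^ m) \<longlonglongrightarrow> 0"
    using summable_exp[of M] by (rule summable_LIMSEQ_zero)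
  then have "(\<lambda>m. K * (inverse (fact m) * M ^ m)) \<longlonglongrightarrow> K * 0"
    by (intro tendsto_intros)
  then have "\<forall>\<^sub>F m in sequentially. K * (inverse (fact m) * M ^ m) < 1"
    by (intro order_tendstoD(2)[where y = "K * 0"]) simp_all
  then obtain m where m: "\<And>k. m \<le> k \<Longrightarrow> K * (inverse (fact k) * M ^ k) < 1"
    by (auto simp: eventually_sequentially)
  have "K * (inverse (fact (Suc m)) * M ^ Suc m) < 1" using m[of "Suc m"] by simp
  then have "K * M ^ Suc m < fact (Suc m)"
    by (simp add: field_simps del: fact_Suc power_Suc)
  with le[of m] show False by simp
qed

text \<open>The product of \<open>x\<close> and \<open>b\<close> is in the kernel, which
  \<open>D\<close> preserves. In the product rule the term with \<open>\<rho> b\<close> on the right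
  is then removed by multiplication with \<open>\<rho> z\<close>.\<close>

lemma derivation_zero_product:
  assumes "x \<in> carrier A" "b \<in> carrier A" "z \<in> carrier A"
    and "mm n (\<rho> x) (\<rho> b) = 0" "mm n (\<rho> b) (\<rho> z) = 0"
  shows "mm n (mm n (\<rho> x) (\<rho> (D b))) (\<rho> z) = 0"
proof -
  have "\<rho> (D (vmult A x b)) = 0"
    using assms by (intro derivation_kernel) (simp_all add: mult_closed rep_mult)
  then have e: "mm n (\<rho> (D x)) (\<rho> b) + mm n (\<rho> x) (\<rho> (D b)) = 0"
    using assms by (simp add: rep_D_mult)
  have "mm n (mm n (\<rho> (D x)) (\<rho> b) + mm n (\<rho> x) (\<rho> (D b))) (\<rho> z) = 0"
    unfolding e by (rule mm_0 zero_mat_eta)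
  then show ?thesis by (simp add: mm_add_left mm_assoc assms(5) mm_0 zero_mat_eta)
qed

text \<open>A preimage \<open>u\<close> of the identity matrix need not be a unit of the algebra,
  but it is idempotent modulo the kernel; applying \<open>D\<close> gives
  \<open>\<rho> (D u) + \<rho> (D u) = \<rho> (D u)\<close>.\<close>

lemma derivation_one:
  assumes "u \<in> carrier A" "\<rho> u = mat_id n"
  shows "\<rho> (D u) = 0"
proof -
  have "\<rho> (sub (vmult A u u) u) = 0"
    using assms by (simp add: rep_sub mult_closed rep_mult mm_id_left mats_closed)
  from derivation_kernel[OF _ this]
  have "\<rho> (D (sub (vmult A u u) u)) = 0" using assms by (simp add: sub_closed mult_closed)
  moreover have "\<rho> (D (sub (vmult A u u) u)) = \<rho> (D u)"
  proof -
    have "vadd A (sub (vmult A u u) u) u = vmult A u u"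
      using assms(1) by (simp add: sub_add_cancel mult_closed)
    then have "\<rho> (D (vmult A u u)) = \<rho> (D (sub (vmult A u u) u)) + \<rho> (D u)"
      using D_add[of "sub (vmult A u u) u" u] assms(1) by (simp add: sub_closed mult_closed rep_add D_closed)
    moreover have "\<rho> (D (vmult A u u)) = \<rho> (D u) + \<rho> (D u)"
      using assms by (simp add: rep_D_mult mm_id_left mm_id_right rep_mats D_closed)
    ultimately show ?thesis by simp
  qed
  ultimately show ?thesis by simp
qed

end

text \<open>\<delta> maps the kernel into itself and so induces a map \<open>\<Delta>\<close> on
  matrices. Each use of approximating derivations takes the sequence belonging to the one element at
  which \<delta> is evaluated.\<close>

lemma approximately_local_derivation_rep:
  assumes \<delta>: "approximately_local_derivation A \<delta>" and ab: "a \<in> carrier A" "b \<in> carrier A"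
  shows "\<rho> (\<delta> (vmult A a b)) = mm n (\<rho> (\<delta> a)) (\<rho> b) + mm n (\<rho> a) (\<rho> (\<delta> b))"
proof -
  have \<delta>c: "\<delta> x \<in> carrier A" if "x \<in> carrier A" for x
    using \<delta> that by (auto simp: approximately_local_derivation_def bounded_clinear_map_def clinear_map_def)
  have \<delta>_add: "\<delta> (vadd A x y) = vadd A (\<delta> x) (\<delta> y)" if "x \<in> carrier A" "y \<in> carrier A" for x y
    using \<delta> that by (auto simp: approximately_local_derivation_def bounded_clinear_map_def clinear_map_def)
  have \<delta>_scale: "\<delta> (vscale A c x) = vscale A c (\<delta> x)" if "x \<in> carrier A" for x c
    using \<delta> that by (auto simp: approximately_local_derivation_def bounded_clinear_map_def clinear_map_def)
  have approx: "\<exists>D. (\<forall>k. derivation A (D k)) \<and> (\<forall>i j. (\<lambda>k. \<rho> (D k x) i j) \<longlonglongrightarrow> \<rho> (\<delta> x) i j)"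
    if x: "x \<in> carrier A" for x
  proof -
    obtain D :: "nat \<Rightarrow> 'a \<Rightarrow> 'a" where D: "\<And>k. derivation A (D k)"
      "limitin mtopology (\<lambda>k. D k x) (\<delta> x) sequentially"
      using \<delta> x unfolding approximately_local_derivation_def by blast
    have Dc: "D k x \<in> carrier A" for k by (rule D_closed[OF D(1) x])
    have lim: "(\<lambda>k. vnorm A (sub (D k x) (\<delta> x))) \<longlonglongrightarrow> 0"
      using D(2) limitin_norm_topology[of "\<lambda>k. D k x"] Dc by blast
    have "(\<lambda>k. \<rho> (D k x) i j) \<longlonglongrightarrow> \<rho> (\<delta> x) i j" for i j
    proof -
      have "(\<lambda>k. K * vnorm A (sub (D k x) (\<delta> x))) \<longlonglongrightarrow> K * 0" by (intro tendsto_intros lim)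
      then have lim': "(\<lambda>k. K * vnorm A (sub (D k x) (\<delta> x))) \<longlonglongrightarrow> 0" by simp
      have "norm (\<rho> (D k x) i j - \<rho> (\<delta> x) i j) \<le> K * vnorm A (sub (D k x) (\<delta> x))" for k
        using rep_bound[OF sub_closed[OF Dc \<delta>c[OF x]], of k i j] by (simp add: rep_sub Dc \<delta>c x)
      then have "(\<lambda>k. \<rho> (D k x) i j - \<rho> (\<delta> x) i j) \<longlonglongrightarrow> 0"
        by (intro Lim_null_comparison[OF _ lim']) simp
      then show ?thesis by (simp add: LIM_zero_iff)
    qed
    with D(1) show ?thesis by blast
  qed
  have kernel: "\<rho> (\<delta> x) = 0" if x: "x \<in> carrier A" "\<rho> x = 0" for x
  proof (intro ext)
    fix i j
    obtain D where D: "\<And>k. derivation A (D k)" "\<And>i j. (\<lambda>k. \<rho> (D k x) i j) \<longlonglongrightarrow> \<rho> (\<delta> x) i j"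
      using approx[OF x(1)] by blast
    have "(\<lambda>k. \<rho> (D k x) i j) = (\<lambda>k. 0)" by (intro ext) (simp add: derivation_kernel[OF D(1) x])
    with D(2)[of i j] show "\<rho> (\<delta> x) i j = 0 i j" by (simp add: LIMSEQ_const_iff)
  qed
  have factor: "\<rho> (\<delta> x) = \<rho> (\<delta> y)" if xy: "x \<in> carrier A" "y \<in> carrier A" "\<rho> x = \<rho> y" for x y
  proof -
    have "\<rho> (\<delta> (sub x y)) = 0" using xy by (intro kernel) (simp_all add: sub_closed rep_sub)
    moreover have "\<delta> (sub x y) = sub (\<delta> x) (\<delta> y)" using xy by (simp add: \<delta>_add \<delta>_scale scale_closed)
    ultimately show ?thesis using xy by (simp add: rep_sub \<delta>c)
  qed
  define lift where "lift M = (SOME x. x \<in> carrier A \<and> \<rho> x = M)" for M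
  have lift: "lift M \<in> carrier A" "\<rho> (lift M) = M" if "M \<in> mats n" for M
    using someI_ex[of "\<lambda>x. x \<in> carrier A \<and> \<rho> x = M"] rep_onto[OF that] by (auto simp: lift_def)
  define \<Delta> where "\<Delta> M = \<rho> (\<delta> (lift M))" for M
  have \<Delta>: "\<Delta> (\<rho> x) = \<rho> (\<delta> x)" if x: "x \<in> carrier A" for x
    unfolding \<Delta>_def by (rule factor) (use x lift rep_mats in auto)
  have "\<Delta> (mm n (\<rho> a) (\<rho> b)) = mm n (\<Delta> (\<rho> a)) (\<rho> b) + mm n (\<rho> a) (\<Delta> (\<rho> b))"
  proof (rule zero_product_derivation[OF n_pos])
    show "\<Delta> M \<in> mats n" if "M \<in> mats n" for M
      unfolding \<Delta>_def by (intro rep_mats \<delta>c lift that)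
  next
    fix M N assume M: "M \<in> mats n" and N: "N \<in> mats n"
    show "\<Delta> (M + N) = \<Delta> M + \<Delta> N"
      using \<Delta>[of "vadd A (lift M) (lift N)"] lift[OF M] lift[OF N]
      by (simp add: add_closed rep_add \<delta>_add \<delta>c \<Delta>_def)
  next
    fix M c assume M: "M \<in> mats n"
    show "\<Delta> (smat c M) = smat c (\<Delta> M)"
      using \<Delta>[of "vscale A c (lift M)"] lift[OF M]
      by (simp add: scale_closed rep_scale \<delta>_scale \<delta>c \<Delta>_def)
  next
    have u: "lift (mat_id n) \<in> carrier A" "\<rho> (lift (mat_id n)) = mat_id n"
      using lift mats_closed(5) by auto
    obtain D where D: "\<And>k. derivation A (D k)"
      "\<And>i j. (\<lambda>k. \<rho> (D k (lift (mat_id n))) i j) \<longlonglongrightarrow> \<rho> (\<delta> (lift (mat_id n))) i j"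
      using approx[OF u(1)] by blast
    show "\<Delta> (mat_id n) = 0"
    proof (intro ext)
      fix i j
      have "(\<lambda>k. \<rho> (D k (lift (mat_id n))) i j) = (\<lambda>k. 0)"
        by (intro ext) (simp add: derivation_one[OF D(1) u])
      with D(2)[of i j] show "\<Delta> (mat_id n) i j = 0 i j" by (simp add: LIMSEQ_const_iff \<Delta>_def)
    qed
  next
    fix X B Z
    assume XBZ: "X \<in> mats n" "B \<in> mats n" "Z \<in> mats n" "mm n X B = 0" "mm n B Z = 0"
    obtain D where D: "\<And>k. derivation A (D k)"
      "\<And>i j. (\<lambda>k. \<rho> (D k (lift B)) i j) \<longlonglongrightarrow> \<rho> (\<delta> (lift B)) i j"
      using approx[OF lift(1)[OF XBZ(2)]] by blast
    show "mm n (mm n X (\<Delta> B)) Z = 0"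
    proof (intro ext)
      fix i j
      have z: "mm n (mm n X (\<rho> (D k (lift B)))) Z = 0" for k
        using derivation_zero_product[OF D(1), of "lift X" "lift B" "lift Z" k] lift XBZ by simp
      have "(\<lambda>k. mm n (mm n X (\<rho> (D k (lift B)))) Z i j) \<longlonglongrightarrow> mm n (mm n X (\<rho> (\<delta> (lift B)))) Z i j"
      proof (cases "i < n \<and> j < n")
        case True
        have in1: "(\<lambda>k. mm n X (\<rho> (D k (lift B))) i r) \<longlonglongrightarrow> mm n X (\<rho> (\<delta> (lift B))) i r" for r
          by (cases "i < n \<and> r < n") (auto simp: mm_def intro!: tendsto_intros D(2))
        then have "(\<lambda>k. \<Sum>r<n. mm n X (\<rho> (D k (lift B))) i r * Z r j) \<longlonglongrightarrow> (\<Sum>r<n. mm n X (\<rho> (\<delta> (lift B))) i r * Z r j)"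
          by (intro tendsto_intros)
        then show ?thesis using True by (simp add: mm_def[of n "mm n _ _"])
      next
        case False
        then show ?thesis by (auto simp: mm_def[of n "mm n _ _"])
      qed
      then show "mm n (mm n X (\<Delta> B)) Z i j = 0 i j"
        unfolding z by (simp add: LIMSEQ_const_iff \<Delta>_def)
    qed
  qed (use ab rep_mats in auto)
  then show ?thesis
    unfolding rep_mult[OF ab, symmetric] \<Delta>[OF mult_closed[OF ab]] \<Delta>[OF ab(1)] \<Delta>[OF ab(2)] .
qed

end

section \<open>Representations of the tensor algebra on cycles\<close>

text \<open>Isolation of zeros at 0. Nothing is assumed at \<open>c = 0\<close>, since weights are
  nonzero; the series is therefore multiplied by \<open>c\<close>, which forces a zero there and
  shifts the coefficients to \<open>a'\<close>.\<close>

lemma power_series_coeffs_zero: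
  fixes a :: "nat \<Rightarrow> complex"
  assumes bound: "\<And>k. cmod (a k) \<le> B"
    and zero: "\<And>c. 0 < cmod c \<Longrightarrow> cmod c < 1 \<Longrightarrow> (\<Sum>k. a k * c ^ k) = 0"
  shows "a k = 0"
proof (rule ccontr)
  assume k: "a k \<noteq> 0"
  define a' where "a' m = (case m of 0 \<Rightarrow> 0 | Suc m \<Rightarrow> a m)" for m
  define f where "f c = c * (\<Sum>k. a k * c ^ k)" for c
  have sums: "(\<lambda>m. a' m * (c - 0) ^ m) sums f c" if c: "cmod (c - 0) < 1" for c
  proof -
    have "summable (\<lambda>k. B * cmod c ^ k)" using c by (intro summable_mult summable_geometric) simp
    then have "summable (\<lambda>k. a k * c ^ k)"
      by (rule summable_comparison_test'[where N = 0])
        (simp add: norm_mult norm_power mult_right_mono bound)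
    then have "(\<lambda>k. c * (a k * c ^ k)) sums f c"
      unfolding f_def by (intro sums_mult summable_sums)
    then have "(\<lambda>k. a' (Suc k) * c ^ Suc k) sums f c"
      by (simp add: a'_def mult_ac)
    from sums_Suc[OF this] show ?thesis by (simp add: a'_def)
  qed
  have "f 0 = 0" "a' (Suc k) \<noteq> 0" by (simp_all add: f_def a'_def k)
  then obtain e where e: "0 < e" "\<And>z. z \<in> cball 0 e - {0} \<Longrightarrow> f z \<noteq> 0"
    using powser_0_nonzero[where r = 1 and a = a' and \<xi> = 0 and f = f and m = "Suc k", OF zero_less_one sums] by blast
  define z where "z = complex_of_real (min e (1 / 2))"
  have "f z = 0" using e(1) zero[of z] by (simp add: f_def z_def)
  moreover have "f z \<noteq> 0" using e(1) by (intro e(2)) (auto simp: z_def dist_norm)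
  ultimately show False by simp
qed

lemma periodic_mod:
  fixes f :: "nat \<Rightarrow> 'a"
  assumes "\<And>i. f (i + n) = f i"
  shows "f (i mod n) = f i"
proof -
  have "f (j + n * q) = f j" for j q
  proof (induction q)
    case (Suc q)
    have "j + n * Suc q = (j + n * q) + n" by simp
    then show ?case using assms Suc by metis
  qed simp
  from this[of "i mod n" "i div n"] show ?thesis by simp
qed

text \<open>Reversed, because words carry the last edge at their head.\<close>

definition path_word :: "(nat \<Rightarrow> 'g) \<Rightarrow> nat \<Rightarrow> nat \<Rightarrow> 'g list" where
  "path_word s i k = rev (map s [i..<i + k])"

lemma path_word_0 [simp]: "path_word s i 0 = []"
  and path_word_Suc: "path_word s i (Suc k) = s (i + k) # path_word s i k"
  and length_path_word [simp]: "length (path_word s i k) = k"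
  by (simp_all add: path_word_def)

lemma path_word_append: "path_word s i (k + l) = path_word s (i + k) l @ path_word s i k"
  by (induction l) (simp_all add: path_word_Suc add.assoc)

lemma path_word_drop: "r \<le> k \<Longrightarrow> drop r (path_word s j k) = path_word s j (k - r)"
  and path_word_take: "r \<le> k \<Longrightarrow> take r (path_word s j k) = path_word s (j + (k - r)) r"
  using path_word_append[of s j "k - r" r] by simp_all

lemma path_word_periodic: "(\<And>i. s (i + n) = s i) \<Longrightarrow> path_word s (i + n) k = path_word s i k"
proof (induction k)
  case (Suc k)
  have "s (i + n + k) = s (i + k)" using Suc.prems[of "i + k"] by (simp add: add_ac)
  then show ?case using Suc by (simp add: path_word_Suc)
qed simp

lemma path_word_nth: "q < k \<Longrightarrow> rev (path_word s i k) ! q = s (i + q)"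
  by (simp add: path_word_def)

lemma tensor_algebra_simps:
  "carrier (tensor_algebra B Y T \<pi> t) = closed_algebra_generated T (\<pi> ` carrier B \<union> t ` carrier Y)"
  "vzero (tensor_algebra B Y T \<pi> t) = vzero T" "vadd (tensor_algebra B Y T \<pi> t) = vadd T"
  "vscale (tensor_algebra B Y T \<pi> t) = vscale T" "vnorm (tensor_algebra B Y T \<pi> t) = vnorm T"
  "vmult (tensor_algebra B Y T \<pi> t) = vmult T"
  by (simp_all add: tensor_algebra_def nalg.truncate_def)

section \<open>The tensor algebra as a normed algebra; supports of coefficients and path
  monomials\<close>

context dynamical_toeplitz
begin

abbreviation "TA \<equiv> tensor_algebra (c0_algebra \<Omega>) X T \<pi> t"

lemma carrier_TA: "carrier TA = tensor"
  by (simp add: tensor_algebra_simps tensor_def c0_algebra_simps dynamical_correspondence_simps)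

lemmas TA_simps = carrier_TA tensor_algebra_simps(2-)

lemma normed_calgebra_TA: "normed_calgebra TA"
proof (intro normed_calgebra.intro normed_calgebra_axioms.intro normed_cvec.intro normed_cvec_axioms.intro)
  show "complex_vector_space TA"
    by (rule complex_vector_spaceI)
      (auto simp: TA_simps tensor_add tensor_zero tensor_scale tensor_carrier add_assoc add_zero_left sub_self
        scale_add_right scale_add_left scale_scale scale_one intro: add_commute)
qed (auto simp: TA_simps tensor_carrier tensor_mult vnorm_eq_0 vnorm_triangle vnorm_scale norm_mult)

lemma homog_support:
  "homog k p \<Longrightarrow> \<not> (set w \<subseteq> carrier G \<and> x \<in> topspace \<Omega>) \<Longrightarrow> coef p w x = 0"
proof (induction arbitrary: w x rule: homog.induct)
  case (vertex f)
  then show ?case using c0_off[OF vertex(1), of x]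
    by (auto simp: coef_eqI[OF fock_\<pi>[OF vertex(1)]] vertex_coef_def)
next
  case (edge F)
  have "F (hd w, x) = 0" if "length w = 1"
    using that edge(2) by (intro c0_off[OF edge(1)]) (auto simp: length_Suc_conv)
  then show ?case by (simp add: coef_eqI[OF fock_t[OF edge(1)]] edge_coef_def)
next
  case (step F k p)
  have "fock (vmult T (t F) p) = fock_matrix \<sigma> (path_conv \<sigma> (edge_coef F) (coef p))"
    using step(1,2) by (simp add: fock_mult t_closed homog_carrier fock_t homog_fock mprod_fock_matrix)
  then have e: "coef (vmult T (t F) p) = path_conv \<sigma> (edge_coef F) (coef p)" by (rule coef_eqI)
  show ?case
  proof (cases w)
    case Nil
    then show ?thesis by (simp add: e path_conv_edge_left_Nil)
  next
    case (Cons g w')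
    then show ?thesis
      using step.IH[of w' x] step.prems c0_prod_discrete_off[OF step(1), of g]
      by (auto simp: e path_conv_edge_left_Cons)
  qed
next
  case (add k p q)
  then show ?case by (simp add: coef_add homog_carrier)
qed

lemma coef_sub: "a \<in> carrier T \<Longrightarrow> b \<in> carrier T \<Longrightarrow> coef (sub a b) w x = coef a w x - coef b w x"
  by (simp add: coef_def fock_sub)

text \<open>The types may be larger than the group and the space. Words and vertices outside them
  lie on none of the cycles below and are treated here.\<close>

lemma tensor_support:
  assumes a: "a \<in> tensor" and wx: "\<not> (set w \<subseteq> carrier G \<and> x \<in> topspace \<Omega>)"
  shows "coef a w x = 0"
proof -
  have p0: "coef p w x = 0" if "graded_poly p" for p
    using that
  proof (induction rule: graded_poly.induct)
    case (homog k p)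
    then show ?case using homog_support wx by blast
  next
    case (add p q)
    then show ?case by (simp add: coef_add graded_poly_carrier)
  qed
  have "cmod (coef a w x) \<le> 0 + e" if e: "0 < e" for e
  proof -
    obtain p where p: "graded_poly p" "vnorm T (sub a p) < e" using graded_poly_dense[OF a e] by blast
    note c = tensor_carrier[OF a] graded_poly_carrier[OF p(1)]
    have "coef a w x = coef (sub a p) w x" using c p0[OF p(1)] by (simp add: coef_sub)
    then show ?thesis using coef_bound[OF sub_closed[OF c], of w x] p(2) by simp
  qed
  then have "cmod (coef a w x) \<le> 0" by (rule field_le_epsilon)
  then show ?thesis by simp
qed

definition edge_bump :: "('x \<Rightarrow> complex) \<Rightarrow> 'g \<Rightarrow> 'g \<times> 'x \<Rightarrow> complex" where
  "edge_bump f g = (\<lambda>(h, y). if h = g then f y else 0)"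

lemma edge_bump_closed: "f \<in> C0 \<Longrightarrow> g \<in> carrier G \<Longrightarrow> edge_bump f g \<in> E0"
proof (rule c0_prod_discreteI[OF finite_G])
  fix h assume "f \<in> C0" "g \<in> carrier G" "h \<in> carrier G"
  then show "(\<lambda>x. edge_bump f g (h, x)) \<in> C0"
    by (cases "h = g") (simp_all add: edge_bump_def c0_zero)
qed (auto simp: edge_bump_def)

text \<open>If \<open>f\<close> is 1 along a cycle, the coefficients on that cycle single out the
  word \<open>u\<close>; up to a scalar this is how matrix units are lifted.\<close>

primrec path_monomial :: "('x \<Rightarrow> complex) \<Rightarrow> 'g list \<Rightarrow> 'b" where
  "path_monomial f [] = \<pi> f"
| "path_monomial f (g # u) = vmult T (t (edge_bump f g)) (path_monomial f u)"

lemma path_monomial_tensor: "f \<in> C0 \<Longrightarrow> set u \<subseteq> carrier G \<Longrightarrow> path_monomial f u \<in> tensor"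
  by (induction u) (simp_all add: tensor_\<pi> tensor_mult tensor_t edge_bump_closed)

end

text \<open>A closed path \<open>x 0, x 1, \<dots>\<close> of period \<open>n\<close> along edges \<open>s 0, s 1, \<dots>\<close>, with a weight \<open>c\<close> per edge,
  gives a representation on \<open>\<complex>\<^sup>n\<close>. It is onto the matrices since the rotations of the
  edge word are distinct.\<close>

locale weighted_cycle = dynamical_toeplitz \<Omega> G \<sigma> T \<pi> t
  for \<Omega> :: "'x topology" and G :: "('g, 'r) monoid_scheme" and \<sigma> T and \<pi> :: "('x \<Rightarrow> complex) \<Rightarrow> 'b" and t +
  fixes n :: nat and s :: "nat \<Rightarrow> 'g" and x :: "nat \<Rightarrow> 'x" and c :: complex and f :: "'x \<Rightarrow> complex"
  assumes n_pos: "0 < n"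
    and s_periodic: "\<And>i. s (i + n) = s i"
    and s_closed: "\<And>i. s i \<in> carrier G"
    and x_Suc: "\<And>i. x (Suc i) = \<sigma> (s i) (x i)"
    and x_periodic: "\<And>i. x (i + n) = x i"
    and rotations: "\<And>i j. i < n \<Longrightarrow> j < n \<Longrightarrow> path_word s i n = path_word s j n \<Longrightarrow> i = j"
    and c_pos: "0 < cmod c" and c_less: "cmod c < 1"
    and f_closed: "f \<in> C0" and f_x: "\<And>i. f (x i) = 1"
begin

abbreviation "W \<equiv> path_word s"

lemma foldr_W: "foldr \<sigma> (W i k) (x i) = x (i + k)"
  by (induction k) (simp_all add: path_word_Suc x_Suc)

lemma W_closed: "set (W i k) \<subseteq> carrier G"
  using s_closed by (auto simp: path_word_def)

definition weighted_coef :: "nat \<Rightarrow> nat \<Rightarrow> 'b \<Rightarrow> complex" where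
  "weighted_coef j k a = c ^ k * coef a (W j k) (x j)"

lemma weighted_coef_mod: "weighted_coef (j mod n) k a = weighted_coef j k a"
proof (rule periodic_mod)
  show "weighted_coef (i + n) k a = weighted_coef i k a" for i
    using path_word_periodic[of s n i k] s_periodic by (simp add: weighted_coef_def x_periodic)
qed

text \<open>The part of degree \<open>k\<close>: on the cycle, a path of length \<open>k\<close>
  leads from vertex \<open>j\<close> to vertex \<open>j + k\<close> modulo \<open>n\<close>.\<close>

definition comp :: "nat \<Rightarrow> 'b \<Rightarrow> nat \<Rightarrow> nat \<Rightarrow> complex" where
  "comp k a i j = (if i < n \<and> j < n \<and> (j + k) mod n = i then weighted_coef j k a else 0)"

definition rep :: "'b \<Rightarrow> nat \<Rightarrow> nat \<Rightarrow> complex" where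
  "rep a i j = (\<Sum>k. comp k a i j)"

lemma weighted_coef_mult:
  assumes "a \<in> tensor" "b \<in> tensor"
  shows "weighted_coef j k (vmult T a b) = (\<Sum>r\<le>k. weighted_coef (j + (k - r)) r a * weighted_coef j (k - r) b)"
  unfolding weighted_coef_def coef_mult[OF assms] path_conv_def length_path_word sum_distrib_left
proof (rule sum.cong[OF refl])
  fix r assume r: "r \<in> {..k}"
  then have "c ^ k = c ^ r * c ^ (k - r)" by (simp flip: power_add)
  with r show "c ^ k * (coef a (take r (W j k)) (foldr \<sigma> (drop r (W j k)) (x j)) * coef b (drop r (W j k)) (x j))
    = c ^ r * coef a (W (j + (k - r)) r) (x (j + (k - r))) * (c ^ (k - r) * coef b (W j (k - r)) (x j))"
    by (simp add: path_word_drop path_word_take foldr_W)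
qed

text \<open>A path of length \<open>k\<close> from vertex \<open>j\<close> stands at a single vertex
  after \<open>k - r\<close> edges, so for each \<open>r\<close> the sum over \<open>m\<close> has
  at most one nonzero term, the one belonging to that cut.\<close>

lemma comp_mult:
  assumes "a \<in> tensor" "b \<in> tensor" and ij: "i < n" "j < n"
  shows "comp k (vmult T a b) i j = (\<Sum>r\<le>k. \<Sum>m<n. comp r a i m * comp (k - r) b m j)"
proof -
  have inner: "(\<Sum>m<n. comp r a i m * comp (k - r) b m j)
    = (if (j + k) mod n = i then weighted_coef (j + (k - r)) r a * weighted_coef j (k - r) b else 0)"
    if r: "r \<le> k" for r
  proof -
    let ?m = "(j + (k - r)) mod n"
    have mod: "(?m + r) mod n = (j + k) mod n" using r by (simp add: mod_add_left_eq)
    have "(\<Sum>m<n. comp r a i m * comp (k - r) b m j)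
      = (\<Sum>m<n. if m = ?m then comp r a i ?m * weighted_coef j (k - r) b else 0)"
      using ij by (intro sum.cong refl) (auto simp: comp_def)
    also have "\<dots> = comp r a i ?m * weighted_coef j (k - r) b" using n_pos by simp
    also have "\<dots> = (if (j + k) mod n = i then weighted_coef (j + (k - r)) r a * weighted_coef j (k - r) b else 0)"
      using n_pos ij by (simp add: comp_def mod weighted_coef_mod)
    finally show ?thesis .
  qed
  have "(\<Sum>r\<le>k. \<Sum>m<n. comp r a i m * comp (k - r) b m j)
    = (\<Sum>r\<le>k. if (j + k) mod n = i then weighted_coef (j + (k - r)) r a * weighted_coef j (k - r) b else 0)"
    by (intro sum.cong refl inner) simp
  then show ?thesis using ij by (simp add: comp_def weighted_coef_mult[OF assms(1,2)])
qed

lemma comp_bound: "a \<in> carrier T \<Longrightarrow> cmod (comp k a i j) \<le> vnorm T a * cmod c ^ k"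
  using coef_bound[of a "W j k" "x j"] vnorm_nonneg[of a]
  by (auto simp: comp_def weighted_coef_def Real_Vector_Spaces.norm_mult norm_power mult.commute[of _ "cmod c ^ k"] intro!: mult_left_mono)

lemma summable_comp: "a \<in> carrier T \<Longrightarrow> summable (\<lambda>k. cmod (comp k a i j))"
proof -
  assume a: "a \<in> carrier T"
  have "summable (\<lambda>k. vnorm T a * cmod c ^ k)" using c_less by (intro summable_mult summable_geometric) simp
  then show ?thesis
    by (rule summable_comparison_test'[where N = 0]) (simp add: comp_bound[OF a])
qed

text \<open>Cauchy products of absolutely convergent series reduce multiplicativity to
  \<open>comp_mult\<close> in each degree.\<close>

lemma rep_mult:
  assumes a: "a \<in> tensor" and b: "b \<in> tensor"
  shows "rep (vmult T a b) = mm n (rep a) (rep b)"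
proof (intro ext)
  fix i j
  show "rep (vmult T a b) i j = mm n (rep a) (rep b) i j"
  proof (cases "i < n \<and> j < n")
    case True
    note s = summable_comp[OF tensor_carrier[OF a]] summable_comp[OF tensor_carrier[OF b]]
    have "(\<lambda>k. \<Sum>m<n. \<Sum>r\<le>k. comp r a i m * comp (k - r) b m j) sums (\<Sum>m<n. rep a i m * rep b m j)"
      unfolding rep_def by (intro sums_sum Cauchy_product_sums s)
    moreover have "comp k (vmult T a b) i j = (\<Sum>m<n. \<Sum>r\<le>k. comp r a i m * comp (k - r) b m j)" for k
      unfolding comp_mult[OF a b conjunct1[OF True] conjunct2[OF True]] by (rule sum.swap)
    ultimately show ?thesis using True by (simp add: rep_def mm_def sums_iff)
  next
    case False
    then show ?thesis by (auto simp: rep_def comp_def mm_def)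
  qed
qed

lemma coef_path_monomial:
  "set u \<subseteq> carrier G \<Longrightarrow> coef (path_monomial f u) (W j k) (x j) = (if W j k = u then 1 else 0)"
proof (induction u arbitrary: k)
  case Nil
  then show ?case by (simp add: coef_eqI[OF fock_\<pi>[OF f_closed]] vertex_coef_def f_x)
next
  case (Cons g u)
  note F = edge_bump_closed[OF f_closed, of g]
  have e: "coef (vmult T (t (edge_bump f g)) (path_monomial f u)) = path_conv \<sigma> (edge_coef (edge_bump f g)) (coef (path_monomial f u))"
    using Cons.prems F
    by (simp add: coef_mult tensor_t path_monomial_tensor f_closed coef_eqI[OF fock_t])
  show ?case
  proof (cases k)
    case 0
    then show ?thesis by (simp add: e path_conv_edge_left_Nil)
  next
    case (Suc k')
    have "edge_bump f g (s (j + k'), x (j + k')) = (if s (j + k') = g then 1 else 0)"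
      by (simp add: edge_bump_def f_x)
    then show ?thesis using Suc Cons
      by (auto simp: e path_word_Suc path_conv_edge_left_Cons foldr_W)
  qed
qed

text \<open>A word of length at least \<open>n\<close> contains a full turn, which by
  \<open>rotations\<close> determines its starting vertex; so a single degree and a single entry
  survive.\<close>

lemma rep_path_monomial:
  assumes ij: "i < n" "j < n" and k: "n \<le> k" "(j + k) mod n = i"
  shows "rep (path_monomial f (W j k)) = smat (c ^ k) (mat_unit i j)"
proof (intro ext)
  fix i' j'
  have eq: "j' = j" if "W j' k = W j k" "j' < n"
  proof -
    have "drop (k - n) (W j' k) = drop (k - n) (W j k)" using that(1) by simp
    then have "W j' n = W j n" using k(1) by (simp add: path_word_drop)
    then show ?thesis using rotations that(2) ij(2) by blast
  qed
  have "comp m (path_monomial f (W j k)) i' j' = (if m = k then smat (c ^ k) (mat_unit i j) i' j' else 0)" for m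
  proof -
    have "W j' m = W j k \<Longrightarrow> m = k" by (metis length_path_word)
    then show ?thesis
      using eq ij k(2) by (auto simp: comp_def weighted_coef_def coef_path_monomial[OF W_closed] smat_def mat_unit_def)
  qed
  then have "rep (path_monomial f (W j k)) i' j' = (\<Sum>m. if m = k then smat (c ^ k) (mat_unit i j) i' j' else 0)"
    by (simp add: rep_def)
  also have "\<dots> = smat (c ^ k) (mat_unit i j) i' j'"
    using sums_single[of k "\<lambda>_. smat (c ^ k) (mat_unit i j) i' j'"] by (simp add: sums_iff)
  finally show "rep (path_monomial f (W j k)) i' j' = smat (c ^ k) (mat_unit i j) i' j'" .
qed

lemma matrix_rep: "matrix_rep TA n rep (1 / (1 - cmod c))"
proof (intro matrix_rep.intro matrix_rep_axioms.intro normed_calgebra_TA n_pos; unfold TA_simps)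
  fix a assume a: "a \<in> tensor"
  note ac = tensor_carrier[OF a]
  show "rep a \<in> mats n" by (auto simp: mats_def rep_def comp_def)
  fix i j
  show "cmod (rep a i j) \<le> 1 / (1 - cmod c) * vnorm T a"
  proof -
    have "cmod (rep a i j) \<le> (\<Sum>k. cmod (comp k a i j))"
      unfolding rep_def by (rule summable_norm[OF summable_comp[OF ac]])
    also have "\<dots> \<le> (\<Sum>k. vnorm T a * cmod c ^ k)"
      using c_less by (intro suminf_le comp_bound ac summable_comp summable_mult summable_geometric) simp
    also have "\<dots> = 1 / (1 - cmod c) * vnorm T a"
      using c_less by (simp add: suminf_mult summable_geometric suminf_geometric)
    finally show ?thesis .
  qed
next
  fix a b assume a: "a \<in> tensor" and b: "b \<in> tensor"
  show "rep (vmult T a b) = mm n (rep a) (rep b)" by (rule rep_mult[OF a b])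
  show "rep (vadd T a b) = rep a + rep b"
  proof (intro ext)
    fix i j
    have "comp k (vadd T a b) i j = comp k a i j + comp k b i j" for k
      using a b by (simp add: comp_def weighted_coef_def coef_add tensor_carrier distrib_left)
    then show "rep (vadd T a b) i j = (rep a + rep b) i j"
      unfolding rep_def plus_fun_apply
      using suminf_add[OF summable_norm_cancel[OF summable_comp[OF tensor_carrier[OF a]]]
          summable_norm_cancel[OF summable_comp[OF tensor_carrier[OF b]]], of i j i j] by simp
  qed
next
  fix a d assume a: "a \<in> tensor"
  show "rep (vscale T d a) = smat d (rep a)"
  proof (intro ext)
    fix i j
    have "comp k (vscale T d a) i j = d * comp k a i j" for k
      using a by (simp add: comp_def weighted_coef_def coef_scale tensor_carrier)
    then show "rep (vscale T d a) i j = smat d (rep a) i j"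
      using suminf_mult[OF summable_norm_cancel[OF summable_comp[OF tensor_carrier[OF a], of i j]], of d]
      by (simp add: rep_def smat_def)
  qed
next
  fix i j assume ij: "i < n" "j < n"
  \<comment> \<open>The length must be \<open>i - j\<close> modulo \<open>n\<close>. The inner
    \<open>n\<close> keeps the subtraction within the naturals, the outer one provides the full turn
    required by \<open>rep_path_monomial\<close>.\<close>
  define k where "k = n + (n + i - j)"
  have k: "n \<le> k" "(j + k) mod n = i" using ij by (simp_all add: k_def)
  let ?p = "path_monomial f (W j k)"
  have p: "?p \<in> tensor" by (rule path_monomial_tensor[OF f_closed W_closed])
  have "rep (vscale T (inverse (c ^ k)) ?p) = mat_unit i j"
  proof (intro ext)
    fix i' j'
    have "comp m (vscale T (inverse (c ^ k)) ?p) i' j' = inverse (c ^ k) * comp m ?p i' j'" for m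
      using p by (simp add: comp_def weighted_coef_def coef_scale tensor_carrier)
    then have "rep (vscale T (inverse (c ^ k)) ?p) i' j' = inverse (c ^ k) * rep ?p i' j'"
      using suminf_mult[OF summable_norm_cancel[OF summable_comp[OF tensor_carrier[OF p], of i' j']], of "inverse (c ^ k)"]
      by (simp add: rep_def)
    then show "rep (vscale T (inverse (c ^ k)) ?p) i' j' = mat_unit i j i' j'"
      using rep_path_monomial[OF ij k] c_pos by (simp add: smat_def)
  qed
  then show "\<exists>e\<in>tensor. rep e = mat_unit i j" using tensor_scale[OF p] by blast
qed

end

text \<open>The end of a path is the image of its start under one group element, so the inverse of
  that element is an edge that closes the path.\<close>

lemma (in group_action) foldr_action:
  assumes "set w \<subseteq> carrier G" "y \<in> E"
  shows "\<exists>g\<in>carrier G. foldr \<phi> w y = \<phi> g y"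
  using assms(1)
proof (induction w)
  case Nil
  interpret group G using group_hom unfolding group_hom_def by blast
  show ?case using id_eq_one[symmetric] assms(2) by (intro bexI[of _ "\<one>"]) simp_all
next
  case (Cons h w)
  interpret group G using group_hom unfolding group_hom_def by blast
  obtain g where g: "g \<in> carrier G" "foldr \<phi> w y = \<phi> g y" using Cons by auto
  have "\<phi> (h \<otimes> g) y = \<phi> h (\<phi> g y)" using g Cons.prems assms(2) by (intro composition_rule) auto
  then show ?case using g Cons.prems by (intro bexI[of _ "h \<otimes> g"]) simp_all
qed

text \<open>The block of \<open>L + 1\<close> identity letters is longer than the word \<open>u\<close> and preceded by a letter
  \<open>h \<noteq> 1\<close>, so that it locates the starting point of a rotation; the last letter \<open>k\<close> closes the path.\<close>

lemma primitive_cycle: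
  assumes G: "group G" and act: "group_action G E \<sigma>" and u: "set u \<subseteq> carrier G" and y: "y \<in> E"
  shows "\<exists>n s. 0 < n \<and> (\<forall>i. s (i + n) = s i) \<and> (\<forall>i. s i \<in> carrier G) \<and>
    foldr \<sigma> (path_word s 0 n) y = y \<and> path_word s 0 (length u) = u \<and>
    (\<forall>i<n. \<forall>j<n. path_word s i n = path_word s j n \<longrightarrow> i = j)"
proof (cases "carrier G \<subseteq> {\<one>\<^bsub>G\<^esub>}")
  \<comment> \<open>The trivial group has no letter besides the identity to mark a position; there
    the loop of period 1 already runs through \<open>u\<close>.\<close>
  case True
  interpret group G by fact
  interpret group_action G E \<sigma> by fact
  have u1: "u = replicate (length u) \<one>\<^bsub>G\<^esub>" using u True by (intro replicate_eqI) auto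
  have "path_word (\<lambda>_. \<one>\<^bsub>G\<^esub>) 0 (length u) = replicate (length u) \<one>\<^bsub>G\<^esub>"
    by (simp add: path_word_def map_replicate_const)
  moreover have "\<sigma> \<one>\<^bsub>G\<^esub> y = y" using id_eq_one[symmetric] y by simp
  ultimately show ?thesis using u1
    by (intro exI[of _ 1] exI[of _ "\<lambda>_. \<one>\<^bsub>G\<^esub>"]) (simp add: path_word_Suc)
next
  case False
  interpret group G by fact
  interpret group_action G E \<sigma> by fact
  obtain h where h: "h \<in> carrier G" "h \<noteq> \<one>\<^bsub>G\<^esub>" using False by auto
  define L where "L = length u"
  \<comment> \<open>Letters are listed here in the order in which the path runs, hence
    \<open>rev u\<close>.\<close>
  define v' where "v' = rev u @ [h] @ replicate (L + 1) \<one>\<^bsub>G\<^esub>"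
  have v': "set v' \<subseteq> carrier G" using u h by (auto simp: v'_def)
  obtain g where g: "g \<in> carrier G" "foldr \<sigma> (rev v') y = \<sigma> g y" using foldr_action[of "rev v'" y] v' y by auto
  define v where "v = v' @ [inv\<^bsub>G\<^esub> g]"
  have v: "set v \<subseteq> carrier G" using v' g by (simp add: v_def)
  \<comment> \<open>The \<open>L\<close> letters of \<open>u\<close>, the marker \<open>h\<close>,
    the block of length \<open>L + 1\<close> and the closing letter.\<close>
  define n where "n = 2 * L + 3"
  have lv: "length v = n" by (simp add: v_def v'_def n_def L_def)
  define s where "s i = v ! (i mod n)" for i
  have n0: "0 < n" by (simp add: n_def)
  have per: "s (i + n) = s i" for i by (simp add: s_def)
  have per': "s (i + m * n) = s i" for i m by (simp add: s_def)
  have closed: "s i \<in> carrier G" for i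
    using v lv n0 by (metis mod_less_divisor nth_mem s_def subsetD)
  have "map s [0..<n] = v" using lv by (intro nth_equalityI) (simp_all add: s_def)
  then have wn: "path_word s 0 n = rev v" by (simp add: path_word_def)
  have cyc: "foldr \<sigma> (path_word s 0 n) y = y"
    using g orbit_sym_aux[OF g(1) y] by (simp add: wn v_def)
  have wu: "path_word s 0 (length u) = u"
  proof -
    have "map s [0..<length u] = rev u"
      by (intro nth_equalityI) (simp_all add: s_def v_def v'_def n_def L_def nth_append)
    then show ?thesis by (simp add: path_word_def)
  qed
  have sL: "s L = h" by (simp add: s_def v_def v'_def n_def L_def nth_append)
  have s1: "s (L + m) = \<one>\<^bsub>G\<^esub>" if "1 \<le> m" "m \<le> L + 1" for m
    using that by (simp add: s_def v_def v'_def n_def L_def nth_append nth_Cons') (intro impI, arith)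
  have rot: False if ij: "i < j" "j < n" "path_word s i n = path_word s j n" for i j
  proof -
    define p where "p = j - i"
    have p: "0 < p" "p < n" "j = i + p" using ij by (auto simp: p_def)
    have q1: "s (i + q) = s (j + q)" if "q < n" for q
      using path_word_nth[OF that, of s i] path_word_nth[OF that, of s j] ij(3) by simp
    have q2: "s (i + q) = s (j + q)" for q
    proof -
      have "s (i + q) = s (i + q mod n)" "s (j + q) = s (j + q mod n)"
        by (simp_all add: s_def mod_add_right_eq)
      then show ?thesis using q1[of "q mod n"] n0 by simp
    qed
    \<comment> \<open>Equal rotations give the relation at positions from \<open>i\<close> on;
      adding \<open>i\<close> full turns extends it to every position, so \<open>p\<close> is a
      period of \<open>s\<close>.\<close>
    have shift: "s q = s (q + p)" for q
    proof -
      have "i \<le> i * n" using n0 by simp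
      then obtain d where d: "i * n = i + d" using le_Suc_ex by blast
      have e: "i + (q + d) = q + i * n" "j + (q + d) = q + p + i * n"
        unfolding d p(3) by simp_all
      show ?thesis using q2[of "q + d"] unfolding e per' .
    qed
    \<comment> \<open>If \<open>p \<le> L + 1\<close>, a shift by \<open>p\<close> moves the marker
      \<open>h\<close> into the block of identities; otherwise the complementary shift
      \<open>n - p\<close> is at most \<open>L + 1\<close> and does the same.\<close>
    show False
    proof (cases "p \<le> L + 1")
      case True
      then show False using shift[of L] sL s1[of p] p h by simp
    next
      case False
      then have m: "1 \<le> n - p" "n - p \<le> L + 1" using p by (simp_all add: n_def)
      have e: "L + (n - p) + p = L + n" using p by simp
      have "s (L + (n - p)) = s (L + n)" using shift[of "L + (n - p)"] unfolding e .
      then show False using s1[OF m] per[of L] sL h by simp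
    qed
  qed
  have "i = j" if "i < n" "j < n" "path_word s i n = path_word s j n" for i j
    using rot[of i j] rot[of j i] that by (metis linorder_neqE_nat)
  with n0 per closed cyc wu show ?thesis
    by (intro exI[of _ n] exI[of _ s]) blast
qed

text \<open>On a cycle that starts at \<open>y\<close> and begins with \<open>w\<close>, one matrix
  entry of \<open>z\<close> is a power series in the weight. Its coefficients are those of
  \<open>z\<close> on the initial paths whose length is congruent to \<open>length w\<close>, so its
  vanishing for all weights kills the coefficient at \<open>w\<close>.\<close>

lemma (in dynamical_toeplitz) coef_zero_of_cycles:
  assumes G: "group G" and act: "group_action G (topspace \<Omega>) \<sigma>"
    and \<Omega>: "locally_compact_space \<Omega>" "Hausdorff_space \<Omega>"
    and z: "z \<in> tensor"
    and zero: "\<And>n s x c f. weighted_cycle \<Omega> G \<sigma> T \<pi> t n s x c f \<Longrightarrow> weighted_cycle.rep \<Omega> G \<sigma> T \<pi> t n s x c z = 0"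
  shows "coef z w y = 0"
proof (cases "set w \<subseteq> carrier G \<and> y \<in> topspace \<Omega>")
  case False
  then show ?thesis by (rule tensor_support[OF z])
next
  case True
  interpret group_action G "topspace \<Omega>" \<sigma> by fact
  obtain n s where n: "0 < n" and s: "\<And>i. s (i + n) = s i" "\<And>i. s i \<in> carrier G"
    and cyc: "foldr \<sigma> (path_word s 0 n) y = y" and w: "path_word s 0 (length w) = w"
    and rot: "\<And>i j. i < n \<Longrightarrow> j < n \<Longrightarrow> path_word s i n = path_word s j n \<Longrightarrow> i = j"
    using primitive_cycle[OF G act, of w y] True by blast
  define x where "x i = foldr \<sigma> (path_word s 0 i) y" for i
  have x_Suc: "x (Suc i) = \<sigma> (s i) (x i)" for i by (simp add: x_def path_word_Suc)
  have x_per: "x (i + n) = x i" for i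
  proof (induction i)
    case 0
    show ?case using cyc by (simp add: x_def)
  next
    case (Suc i)
    then show ?case using s(1)[of i] x_Suc[of "i + n"] by (simp add: x_Suc)
  qed
  have x_top: "x i \<in> topspace \<Omega>" for i
  proof (induction i)
    case 0
    show ?case using True by (simp add: x_def)
  next
    case (Suc i)
    then show ?case using element_image[OF s(2)[of i] Suc] by (simp add: x_Suc)
  qed
  \<comment> \<open>Periodicity leaves finitely many vertices, so one function in \<open>C0\<close>
    can be 1 on the whole cycle.\<close>
  obtain f where f: "f \<in> C0" "\<forall>y\<in>x ` {..<n}. f y = 1"
    using c0_bump_finite[OF \<Omega>, of "x ` {..<n}"] x_top by blast
  have fx: "f (x i) = 1" for i
    using f(2) n periodic_mod[of x n i] x_per by (metis imageI lessThan_iff mod_less_divisor)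
  define i where "i = length w mod n"
  define a where "a k = (if k mod n = i then coef z (path_word s 0 k) y else 0)" for k
  have "a (length w) = 0"
  proof (rule power_series_coeffs_zero)
    show "cmod (a k) \<le> vnorm T z" for k
      using coef_bound[OF tensor_carrier[OF z]] vnorm_nonneg[OF tensor_carrier[OF z]] by (simp add: a_def)
  next
    fix c :: complex assume c: "0 < cmod c" "cmod c < 1"
    have wc: "weighted_cycle \<Omega> G \<sigma> T \<pi> t n s x c f"
      by unfold_locales (fact n s x_Suc x_per rot c f(1) fx)+
    have "weighted_cycle.comp \<Omega> G \<sigma> T \<pi> t n s x c k z i 0 = a k * c ^ k" for k
      using n by (simp add: weighted_cycle.comp_def[OF wc] weighted_cycle.weighted_coef_def[OF wc] a_def i_def x_def)
    then show "(\<Sum>k. a k * c ^ k) = 0"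
      using fun_cong[OF fun_cong[OF zero[OF wc]], of i 0] by (simp add: weighted_cycle.rep_def[OF wc])
  qed
  then show ?thesis by (simp add: a_def i_def w)
qed

theorem corollary4p12:
  fixes \<Omega> :: "'x topology"
    and G :: "('g, 'r) monoid_scheme"
    and \<sigma> :: "'g \<Rightarrow> 'x \<Rightarrow> 'x"
    and T :: "'b salg"
    and \<pi> :: "('x \<Rightarrow> complex) \<Rightarrow> 'b"
    and t :: "('g \<times> 'x \<Rightarrow> complex) \<Rightarrow> 'b"
    and \<delta> :: "'b \<Rightarrow> 'b"
  assumes "group G" and "finite (carrier G)"
    and "locally_compact_space \<Omega>" and "Hausdorff_space \<Omega>" and "sigma_compact_space \<Omega>"
    and "group_action G (topspace \<Omega>) \<sigma>"
    and "\<And>g. g \<in> carrier G \<Longrightarrow> homeomorphic_map \<Omega> \<Omega> (\<sigma> g)"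
    and "universal_toeplitz_rep TYPE(('g, 'x) path_matrix)
           (c0_algebra \<Omega>) (dynamical_correspondence G \<Omega> \<sigma>) T \<pi> t"
    and "universal_toeplitz_rep TYPE('b)
           (c0_algebra \<Omega>) (dynamical_correspondence G \<Omega> \<sigma>) T \<pi> t"
    and "approximately_local_derivation
           (tensor_algebra (c0_algebra \<Omega>) (dynamical_correspondence G \<Omega> \<sigma>) T \<pi> t) \<delta>"
  shows "derivation
           (tensor_algebra (c0_algebra \<Omega>) (dynamical_correspondence G \<Omega> \<sigma>) T \<pi> t) \<delta>"
proof -
  interpret dynamical_toeplitz \<Omega> G \<sigma> T \<pi> t
    using assms(2,8,9) homeomorphic_imp_continuous_map[OF assms(7)] by unfold_locales
  note \<delta> = assms(10)
  have bounded: "bounded_clinear_map TA TA \<delta>"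
    using \<delta> by (simp add: approximately_local_derivation_def)
  have \<delta>c: "\<delta> a \<in> tensor" if "a \<in> tensor" for a
    using bounded that by (auto simp: bounded_clinear_map_def clinear_map_def carrier_TA)
  have "\<delta> (vmult T a b) = vadd T (vmult T (\<delta> a) b) (vmult T a (\<delta> b))"
    if a: "a \<in> tensor" and b: "b \<in> tensor" for a b
  proof -
    \<comment> \<open>The difference of both sides lies in the tensor algebra and is annihilated by
      every cycle representation. Hence its coefficients vanish, and injectivity of
      \<open>fock\<close> on the tensor algebra makes it zero.\<close>
    let ?l = "\<delta> (vmult T a b)" and ?r = "vadd T (vmult T (\<delta> a) b) (vmult T a (\<delta> b))"
    have l: "?l \<in> tensor" and r: "?r \<in> tensor"
      using a b \<delta>c by (simp_all add: tensor_mult tensor_add)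
    have z: "sub ?l ?r \<in> tensor" using l r by (simp add: tensor_add tensor_scale)
    have "coef (sub ?l ?r) w y = 0" for w y
    proof (rule coef_zero_of_cycles[OF assms(1,6,3,4) z])
      fix n s x c f assume wc: "weighted_cycle \<Omega> G \<sigma> T \<pi> t n s x c f"
      interpret R: matrix_rep TA n "weighted_cycle.rep \<Omega> G \<sigma> T \<pi> t n s x c" "1 / (1 - cmod c)"
        by (rule weighted_cycle.matrix_rep[OF wc])
      let ?\<rho> = "weighted_cycle.rep \<Omega> G \<sigma> T \<pi> t n s x c"
      note add = R.rep_add[unfolded TA_simps] and mult = R.rep_mult[unfolded TA_simps]
      have "?\<rho> ?l = mm n (?\<rho> (\<delta> a)) (?\<rho> b) + mm n (?\<rho> a) (?\<rho> (\<delta> b))"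
        by (rule R.approximately_local_derivation_rep[OF \<delta>, unfolded TA_simps, OF a b])
      moreover have "?\<rho> ?r = mm n (?\<rho> (\<delta> a)) (?\<rho> b) + mm n (?\<rho> a) (?\<rho> (\<delta> b))"
        unfolding add[OF tensor_mult[OF \<delta>c[OF a] b] tensor_mult[OF a \<delta>c[OF b]]]
          mult[OF \<delta>c[OF a] b] mult[OF a \<delta>c[OF b]] ..
      moreover have "?\<rho> (sub ?l ?r) = ?\<rho> ?l - ?\<rho> ?r"
        by (rule R.rep_sub[unfolded TA_simps, OF l r])
      ultimately show "?\<rho> (sub ?l ?r) = 0" by (simp only: diff_self)
    qed
    then have "sub ?l ?r = vzero T" by (rule fock_injective_on_tensor[OF z])
    then show ?thesis by (rule sub_eq_zero[OF tensor_carrier[OF l] tensor_carrier[OF r]])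
  qed
  then show ?thesis using bounded by (simp add: derivation_def TA_simps)
qed

end
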